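(* Let $n\ge 2$, $1\le s\le n$, and let $o_{sn}=u_{11}+\cdots+u_{ss}\in A_o(n)$. For every integer $k\ge 1$, $$\int o_{sn}^{2k}=\mathrm{Tr}\left(G_{kn}^{-1}G_{ks}\right),$$ and $\int o_{sn}^{2k+1}=0$ for every integer $k\ge 0$, where $\int$ is the Haar functional of $A_o(n)$.
   Context: $A_o(n)$ is the universal (unital) $C^*$-algebra generated by $n^2$ elements $u_{ij}$, $1\le i,j\le n$, subject to the relations making $u=(u_{ij})$ an orthogonal matrix, i.e. $u_{ij}=u_{ij}^*$ for all $i,j$ and $uu^t=u^tu=1$. It is a Hopf $C^*$-algebra with comultiplication $\Delta(u_{ij})=\sum_{k} u_{ik}\otimes u_{kj}$. The Haar functional $\int:A_o(n)\to\mathbb{C}$ is the unique positive unital linear form satisfying $(\mathrm{id}\otimes\int)\Delta(a)=(\int\otimes \mathrm{id})\Delta(a)=(\int a)\,1$ for all $a$. $D(k)$ is the set of Temperley-Lieb diagrams with $k$ upper and $k$ lower points, identified with the set of non-crossing pair partitions of $\{1,\dots,2k\}$. For $p,q\in D(k)$, $l(p,q)$ is the number of loops obtained by closing the composed diagram $p^*q$; equivalently, the number of connected components of the graph on $\{1,\dots,2k\}$ whose edges are the pairs of $p$ and the pairs of $q$. For an integer $m\ge 1$, $G_{km}$ is the matrix indexed by $D(k)\times D(k)$ with entries $G_{km}(p,q)=m^{l(p,q)}$; it is invertible for $m\ge 2$. $\mathrm{Tr}$ is the usual (unnormalized) trace of matrices. *)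

theory Defs
  imports "HOL-Analysis.Analysis" "HOL-Library.Poly_Mapping" "HOL-Library.Disjoint_Sets"
begin

section \<open>Complex star-algebras and C*-algebras\<close>

class star_algebra = ring_1 +
  fixes scaleC :: "complex \<Rightarrow> 'a \<Rightarrow> 'a" (infixr \<open>*\<^sub>C\<close> 75)
    and star :: "'a \<Rightarrow> 'a"
  assumes scaleC_add_right: "c *\<^sub>C (x + y) = c *\<^sub>C x + c *\<^sub>C y"
    and scaleC_add_left: "(c + d) *\<^sub>C x = c *\<^sub>C x + d *\<^sub>C x"
    and scaleC_scaleC: "c *\<^sub>C d *\<^sub>C x = (c * d) *\<^sub>C x"
    and scaleC_one: "1 *\<^sub>C x = x"
    and mult_scaleC_left: "(c *\<^sub>C x) * y = c *\<^sub>C (x * y)"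
    and mult_scaleC_right: "x * (c *\<^sub>C y) = c *\<^sub>C (x * y)"
    and star_star: "star (star x) = x"
    and star_add: "star (x + y) = star x + star y"
    and star_scaleC: "star (c *\<^sub>C x) = cnj c *\<^sub>C star x"
    and star_mult: "star (x * y) = star y * star x"

text \<open>Unital (nonzero) C*-algebras.\<close>

class cstar_algebra = star_algebra + real_normed_algebra_1 + banach +
  assumes scaleR_scaleC: "r *\<^sub>R x = complex_of_real r *\<^sub>C x"
    and norm_scaleC: "norm (c *\<^sub>C x) = cmod c * norm x"
    and norm_star_mult: "norm (star x * x) = (norm x)\<^sup>2"

instantiation complex :: cstar_algebra
begin

definition scaleC_complex :: "complex \<Rightarrow> complex \<Rightarrow> complex"
  where "scaleC_complex c x = c * x"

definition star_complex :: "complex \<Rightarrow> complex"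
  where "star_complex x = cnj x"

instance
  by standard
    (simp_all add: scaleC_complex_def star_complex_def algebra_simps scaleR_conv_of_real
      norm_mult power2_eq_square)

end

definition clinear :: "('a::star_algebra \<Rightarrow> 'b::star_algebra) \<Rightarrow> bool" where
  "clinear f \<longleftrightarrow> (\<forall>x y. f (x + y) = f x + f y) \<and> (\<forall>c x. f (c *\<^sub>C x) = c *\<^sub>C f x)"

definition bounded_clinear :: "('a::cstar_algebra \<Rightarrow> 'b::cstar_algebra) \<Rightarrow> bool" where
  "bounded_clinear f \<longleftrightarrow> clinear f \<and> (\<exists>K. \<forall>x. norm (f x) \<le> K * norm x)"

definition star_hom :: "('a::star_algebra \<Rightarrow> 'b::star_algebra) \<Rightarrow> bool" where
  "star_hom f \<longleftrightarrow> clinear f \<and> f 1 = 1 \<and> (\<forall>x y. f (x * y) = f x * f y) \<and>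
     (\<forall>x. f (star x) = star (f x))"

text \<open>C*-seminorms on a star-subalgebra \<open>S\<close>; nonnegativity follows from the first two clauses.\<close>

definition cstar_seminorm_on :: "'a::star_algebra set \<Rightarrow> ('a \<Rightarrow> real) \<Rightarrow> bool" where
  "cstar_seminorm_on S p \<longleftrightarrow>
     (\<forall>x\<in>S. \<forall>y\<in>S. p (x + y) \<le> p x + p y) \<and>
     (\<forall>c. \<forall>x\<in>S. p (c *\<^sub>C x) = cmod c * p x) \<and>
     (\<forall>x\<in>S. \<forall>y\<in>S. p (x * y) \<le> p x * p y) \<and>
     (\<forall>x\<in>S. p (star x * x) = (p x)\<^sup>2)"


lemma scaleC_zero_left [simp]: "0 *\<^sub>C x = 0"
  using scaleC_add_left[of 0 0 x] by simp

lemma scaleC_zero_right [simp]: "c *\<^sub>C 0 = 0"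
  using scaleC_add_right[of c 0 0] by simp

lemma star_zero [simp]: "star 0 = 0"
  using star_add[of 0 0] by simp

lemma star_one [simp]: "star 1 = 1"
  by (metis mult_1 mult_1_right star_mult star_star)


section \<open>The free unital star-algebra\<close>

text \<open>
  Words in letters \<open>x\<close> and \<open>x*\<close>: the letter \<open>(x, False)\<close> stands for the generator \<open>x\<close> and
  \<open>(x, True)\<close> for its formal adjoint. The additive notation is the one under which
  \<open>Poly_Mapping\<close> provides monoid algebras.
\<close>

datatype 'x star_word = Star_Word (letters: "('x \<times> bool) list")

instantiation star_word :: (type) monoid_add
begin

definition zero_star_word :: "'x star_word" where "zero_star_word = Star_Word []"

definition plus_star_word :: "'x star_word \<Rightarrow> 'x star_word \<Rightarrow> 'x star_word" where
  "plus_star_word v w = Star_Word (letters v @ letters w)"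

instance by standard (simp_all add: zero_star_word_def plus_star_word_def)

end

definition adj_word :: "'x star_word \<Rightarrow> 'x star_word" where
  "adj_word w = Star_Word (rev (map (\<lambda>(x, b). (x, \<not> b)) (letters w)))"

lemma letters_zero [simp]: "letters 0 = []"
  by (simp add: zero_star_word_def)

lemma letters_plus [simp]: "letters (v + w) = letters v @ letters w"
  by (simp add: plus_star_word_def)

lemma adj_word_adj_word [simp]: "adj_word (adj_word w) = w"
  by (cases w) (simp add: adj_word_def rev_map o_def case_prod_unfold)

lemma inj_adj_word [simp]: "inj adj_word"
  by (metis adj_word_adj_word injI)

lemma adj_word_plus: "adj_word (v + w) = adj_word w + adj_word v"
  by (simp add: adj_word_def plus_star_word_def)

lemma poly_mapping_eq_sum_single:
  fixes p :: "'a \<Rightarrow>\<^sub>0 'b::comm_monoid_add"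
  shows "p = (\<Sum>k\<in>Poly_Mapping.keys p. Poly_Mapping.single k (Poly_Mapping.lookup p k))"
  by (rule poly_mapping_eqI) (simp add: lookup_sum lookup_single when_def not_in_keys_iff_lookup_eq_zero)

lemma poly_mapping_single_induct [case_names zero add]:
  fixes p :: "'a \<Rightarrow>\<^sub>0 'b::comm_monoid_add"
  assumes "P 0" and "\<And>k c q. P q \<Longrightarrow> P (Poly_Mapping.single k c + q)"
  shows "P p"
proof -
  have "P (\<Sum>k\<in>K. Poly_Mapping.single k (Poly_Mapping.lookup p k))" if "finite K" for K
    using that by (induction K rule: finite_induct) (use assms in auto)
  from this[OF finite_keys, of p] show ?thesis
    by (simp flip: poly_mapping_eq_sum_single)
qed

definition adj_poly :: "('x star_word \<Rightarrow>\<^sub>0 complex) \<Rightarrow> ('x star_word \<Rightarrow>\<^sub>0 complex)" where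
  "adj_poly p = Poly_Mapping.map_key adj_word (Poly_Mapping.map cnj p)"

lemma lookup_adj_poly: "Poly_Mapping.lookup (adj_poly p) w = cnj (Poly_Mapping.lookup p (adj_word w))"
  unfolding adj_poly_def
  by (simp add: map_key.rep_eq Poly_Mapping.map.rep_eq when_def o_def)

lemma adj_poly_zero [simp]: "adj_poly 0 = 0"
  by (rule poly_mapping_eqI) (simp add: lookup_adj_poly)

lemma adj_poly_add: "adj_poly (p + q) = adj_poly p + adj_poly q"
  by (rule poly_mapping_eqI) (simp add: lookup_adj_poly lookup_add)

lemma adj_poly_adj_poly: "adj_poly (adj_poly p) = p"
  by (rule poly_mapping_eqI) (simp add: lookup_adj_poly)

lemma adj_poly_single: "adj_poly (Poly_Mapping.single w c) = Poly_Mapping.single (adj_word w) (cnj c)"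
  by (rule poly_mapping_eqI)
    (auto simp: lookup_adj_poly lookup_single when_def)

lemma adj_poly_mult: "adj_poly (p * q) = adj_poly q * adj_poly p"
proof (induction p rule: poly_mapping_single_induct)
  case (add k c p)
  have "adj_poly (Poly_Mapping.single k c * q) = adj_poly q * adj_poly (Poly_Mapping.single k c)"
    by (induction q rule: poly_mapping_single_induct)
      (simp_all add: distrib_left distrib_right adj_poly_add adj_poly_single mult_single
        adj_word_plus mult.commute)
  with add show ?case by (simp add: distrib_left distrib_right adj_poly_add)
qed simp

typedef 'x free_star_algebra = "UNIV :: ('x star_word \<Rightarrow>\<^sub>0 complex) set"
  morphisms poly_of of_poly by simp

setup_lifting type_definition_free_star_algebra

instantiation free_star_algebra :: (type) star_algebra
begin

lift_definition zero_free_star_algebra :: "'x free_star_algebra" is 0 .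
lift_definition one_free_star_algebra :: "'x free_star_algebra" is 1 .
lift_definition plus_free_star_algebra ::
  "'x free_star_algebra \<Rightarrow> 'x free_star_algebra \<Rightarrow> 'x free_star_algebra" is "(+)" .
lift_definition minus_free_star_algebra ::
  "'x free_star_algebra \<Rightarrow> 'x free_star_algebra \<Rightarrow> 'x free_star_algebra" is "(-)" .
lift_definition uminus_free_star_algebra ::
  "'x free_star_algebra \<Rightarrow> 'x free_star_algebra" is uminus .
lift_definition times_free_star_algebra ::
  "'x free_star_algebra \<Rightarrow> 'x free_star_algebra \<Rightarrow> 'x free_star_algebra" is "(*)" .
lift_definition scaleC_free_star_algebra ::
  "complex \<Rightarrow> 'x free_star_algebra \<Rightarrow> 'x free_star_algebra"
  is "\<lambda>c p. Poly_Mapping.single 0 c * p" .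
lift_definition star_free_star_algebra :: "'x free_star_algebra \<Rightarrow> 'x free_star_algebra"
  is adj_poly .

instance
proof
  have comm: "p * Poly_Mapping.single 0 c = Poly_Mapping.single 0 c * p"
    for p :: "'a star_word \<Rightarrow>\<^sub>0 complex" and c
    by (induction p rule: poly_mapping_single_induct)
      (simp_all add: distrib_left distrib_right mult_single mult.commute)
  have adj_word_0: "adj_word 0 = (0 :: 'a star_word)"
    by (simp add: adj_word_def zero_star_word_def)
  fix a b c :: "'a free_star_algebra" and s t :: complex
  show "a + b + c = a + (b + c)" by transfer (simp add: add.assoc)
  show "a + b = b + a" by transfer (simp add: add.commute)
  show "0 + a = a" by transfer simp
  show "- a + a = 0" by transfer simp
  show "a - b = a + - b" by transfer simp
  show "a * b * c = a * (b * c)" by transfer (simp add: mult.assoc)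
  show "1 * a = a" by transfer simp
  show "a * 1 = a" by transfer simp
  show "(a + b) * c = a * c + b * c" by transfer (simp add: distrib_right)
  show "a * (b + c) = a * b + a * c" by transfer (simp add: distrib_left)
  show "(0::'a free_star_algebra) \<noteq> 1" by transfer simp
  show "s *\<^sub>C (a + b) = s *\<^sub>C a + s *\<^sub>C b" by transfer (simp add: distrib_left)
  show "(s + t) *\<^sub>C a = s *\<^sub>C a + t *\<^sub>C a" by transfer (simp add: single_add distrib_right)
  show "s *\<^sub>C t *\<^sub>C a = (s * t) *\<^sub>C a"
    by transfer (simp add: mult_single flip: mult.assoc)
  show "1 *\<^sub>C a = a" by transfer simp
  show "(s *\<^sub>C a) * b = s *\<^sub>C (a * b)" by transfer (simp add: mult.assoc)
  show "a * (s *\<^sub>C b) = s *\<^sub>C (a * b)"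
    by transfer (metis comm mult.assoc)
  show "star (star a) = a" by transfer (rule adj_poly_adj_poly)
  show "star (a + b) = star a + star b" by transfer (rule adj_poly_add)
  show "star (s *\<^sub>C a) = cnj s *\<^sub>C star a"
    by transfer (simp add: adj_poly_mult adj_poly_single adj_word_0 comm)
  show "star (a * b) = star b * star a" by transfer (rule adj_poly_mult)
qed

end

lift_definition gen :: "'x \<Rightarrow> 'x free_star_algebra"
  is "\<lambda>x. Poly_Mapping.single (Star_Word [(x, False)]) 1" .

text \<open>The star-subalgebra generated by the letters in \<open>X\<close>, i.e. the free star-algebra on \<open>X\<close>.\<close>

definition free_star_on :: "'x set \<Rightarrow> 'x free_star_algebra set" where
  "free_star_on X = {f. \<forall>w\<in>Poly_Mapping.keys (poly_of f). fst ` set (letters w) \<subseteq> X}"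

definition word_val :: "('x \<Rightarrow> 'a::star_algebra) \<Rightarrow> 'x star_word \<Rightarrow> 'a" where
  "word_val v w = prod_list (map (\<lambda>(x, b). if b then star (v x) else v x) (letters w))"

text \<open>The star-homomorphism from the free star-algebra that sends \<open>gen x\<close> to \<open>v x\<close>.\<close>

definition eval_free :: "('x \<Rightarrow> 'a::star_algebra) \<Rightarrow> 'x free_star_algebra \<Rightarrow> 'a" where
  "eval_free v f = (\<Sum>w\<in>Poly_Mapping.keys (poly_of f). Poly_Mapping.lookup (poly_of f) w *\<^sub>C word_val v w)"


lemma eval_free_superset:
  assumes "finite K" "Poly_Mapping.keys (poly_of f) \<subseteq> K"
  shows "eval_free v f = (\<Sum>w\<in>K. Poly_Mapping.lookup (poly_of f) w *\<^sub>C word_val v w)"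
  unfolding eval_free_def
  by (rule sum.mono_neutral_left) (use assms in \<open>auto simp: in_keys_iff scaleC_zero_left\<close>)

lemma word_val_0 [simp]: "word_val v 0 = 1"
  by (simp add: word_val_def)

lemma word_val_plus: "word_val v (w + w') = word_val v w * word_val v w'"
  by (simp add: word_val_def)

lemma word_val_adj: "word_val v (adj_word w) = star (word_val v w)"
proof -
  have "prod_list (map (\<lambda>(x, b). if b then star (v x) else v x) (rev (map (\<lambda>(x, b). (x, \<not> b)) l))) =
      star (prod_list (map (\<lambda>(x, b). if b then star (v x) else v x) l))" for l
    by (induction l) (auto simp: star_one star_mult star_star)
  then show ?thesis by (simp add: word_val_def adj_word_def)
qed

lemma eval_free_add: "eval_free v (f + g) = eval_free v f + eval_free v g"
proof -
  let ?K = "Poly_Mapping.keys (poly_of f) \<union> Poly_Mapping.keys (poly_of g)"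
  have "Poly_Mapping.keys (poly_of (f + g)) \<subseteq> ?K"
    by (simp add: plus_free_star_algebra.rep_eq keys_add)
  then show ?thesis
    by (subst (1 2 3) eval_free_superset[where K = ?K])
      (auto simp: plus_free_star_algebra.rep_eq lookup_add scaleC_add_left sum.distrib)
qed

lemma eval_free_zero [simp]: "eval_free v 0 = 0"
  by (simp add: eval_free_def zero_free_star_algebra.rep_eq)

lemma eval_free_single: "eval_free v (of_poly (Poly_Mapping.single w c)) = c *\<^sub>C word_val v w"
  by (subst eval_free_superset[where K = "{w}"]) (auto simp: of_poly_inverse)

lemma eval_free_one [simp]: "eval_free v 1 = 1"
  for v :: "'x \<Rightarrow> 'a::star_algebra"
proof -
  have "(1 :: 'x free_star_algebra) = of_poly (Poly_Mapping.single 0 1)"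
    by (simp add: one_free_star_algebra_def)
  then show ?thesis by (metis eval_free_single scaleC_one word_val_0)
qed

lemma eval_free_gen [simp]: "eval_free v (gen x) = v x"
  by (simp add: gen_def eval_free_single scaleC_one word_val_def)

lemma free_star_single_induct [case_names zero add]:
  assumes "P 0" and "\<And>w c f. P f \<Longrightarrow> P (of_poly (Poly_Mapping.single w c) + f)"
  shows "P f"
proof -
  have "P (of_poly p)" for p
  proof (induction p rule: poly_mapping_single_induct)
    case zero then show ?case using assms(1) by (simp add: zero_free_star_algebra_def)
  next
    case (add k c q)
    then show ?case using assms(2)[of "of_poly q" k c]
      by (simp add: plus_free_star_algebra_def of_poly_inverse)
  qed
  then show ?thesis by (metis poly_of_inverse)
qed

lemma eval_free_scaleC: "eval_free v (c *\<^sub>C f) = c *\<^sub>C eval_free v f"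
proof (induction f rule: free_star_single_induct)
  case (add w d f)
  have "c *\<^sub>C of_poly (Poly_Mapping.single w d) = of_poly (Poly_Mapping.single w (c * d))"
    by (simp add: scaleC_free_star_algebra_def of_poly_inverse mult_single)
  with add show ?case
    by (simp add: scaleC_add_right eval_free_add eval_free_single scaleC_scaleC)
qed (simp add: scaleC_zero_right)

lemma eval_free_star: "eval_free v (star f) = star (eval_free v f)"
proof (induction f rule: free_star_single_induct)
  case (add w d f)
  have "star (of_poly (Poly_Mapping.single w d)) = of_poly (Poly_Mapping.single (adj_word w) (cnj d))"
    by (simp add: star_free_star_algebra_def of_poly_inverse adj_poly_single)
  with add show ?case
    by (simp add: star_add eval_free_add eval_free_single star_scaleC word_val_adj)
qed (simp add: star_zero)

lemma eval_free_mult: "eval_free v (f * g) = eval_free v f * eval_free v g"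
proof (induction f rule: free_star_single_induct)
  case (add w d f)
  have "eval_free v (of_poly (Poly_Mapping.single w d) * g) =
      eval_free v (of_poly (Poly_Mapping.single w d)) * eval_free v g"
  proof (induction g rule: free_star_single_induct)
    case (add w' e g)
    have "of_poly (Poly_Mapping.single w d) * of_poly (Poly_Mapping.single w' e) =
        of_poly (Poly_Mapping.single (w + w') (d * e))"
      by (simp add: times_free_star_algebra_def of_poly_inverse mult_single)
    with add show ?case
      by (simp add: distrib_left eval_free_add eval_free_single word_val_plus
          mult_scaleC_left mult_scaleC_right scaleC_scaleC mult.commute[of d e])
  qed simp
  with add show ?case by (simp add: distrib_right eval_free_add)
qed simp

lemma eval_free_diff: "eval_free v (f + (-1) *\<^sub>C g) = eval_free v f - eval_free v g"
  for v :: "'x \<Rightarrow> 'a::star_algebra"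
proof -
  have "(-1) *\<^sub>C x = - x" for x :: 'a
    using scaleC_add_left[of 1 "-1" x] by (simp add: scaleC_one eq_neg_iff_add_eq_0 add.commute)
  then show ?thesis by (simp add: eval_free_add eval_free_scaleC)
qed

lemma star_hom_eval_free: "star_hom (eval_free v)"
  by (simp add: star_hom_def clinear_def eval_free_add eval_free_scaleC eval_free_mult eval_free_star)

lemma free_star_on_add: "f \<in> free_star_on X \<Longrightarrow> g \<in> free_star_on X \<Longrightarrow> f + g \<in> free_star_on X"
  using keys_add[of "poly_of f" "poly_of g"]
  by (auto simp: free_star_on_def plus_free_star_algebra.rep_eq)

lemma free_star_on_mult: "f \<in> free_star_on X \<Longrightarrow> g \<in> free_star_on X \<Longrightarrow> f * g \<in> free_star_on X"
  using keys_mult[of "poly_of f" "poly_of g"]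
  by (fastforce simp: free_star_on_def times_free_star_algebra.rep_eq)

lemma free_star_on_scaleC: "f \<in> free_star_on X \<Longrightarrow> c *\<^sub>C f \<in> free_star_on X"
  using keys_mult[of "Poly_Mapping.single 0 c" "poly_of f"]
  by (fastforce simp: free_star_on_def scaleC_free_star_algebra.rep_eq split: if_splits)

lemma free_star_on_star: "f \<in> free_star_on X \<Longrightarrow> star f \<in> free_star_on X"
proof -
  have "fst ` set (letters (adj_word w)) = fst ` set (letters w)" for w :: "'a star_word"
    by (force simp: adj_word_def image_iff)
  moreover have "w \<in> Poly_Mapping.keys (adj_poly p) \<longleftrightarrow> adj_word w \<in> Poly_Mapping.keys p"
    for w and p :: "'a star_word \<Rightarrow>\<^sub>0 complex"
    by (simp add: in_keys_iff lookup_adj_poly)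
  ultimately show "f \<in> free_star_on X \<Longrightarrow> star f \<in> free_star_on X"
    unfolding free_star_on_def star_free_star_algebra.rep_eq mem_Collect_eq by metis
qed

lemma free_star_on_one: "1 \<in> free_star_on X"
  by (simp add: free_star_on_def one_free_star_algebra.rep_eq)

lemma free_star_on_gen: "x \<in> X \<Longrightarrow> gen x \<in> free_star_on X"
  by (simp add: free_star_on_def gen.rep_eq)

lemma star_hom_eval_free_comp:
  fixes u :: "'x \<Rightarrow> 'a::star_algebra" and v :: "'x \<Rightarrow> 'b::star_algebra"
  assumes "star_hom \<phi>" "f \<in> free_star_on X" "\<And>x. x \<in> X \<Longrightarrow> \<phi> (u x) = v x"
  shows "\<phi> (eval_free u f) = eval_free v f"
proof -
  have zero: "\<phi> 0 = 0"
    using assms(1) unfolding star_hom_def clinear_def by (metis add_cancel_right_left)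
  have sum: "\<phi> (sum g K) = (\<Sum>k\<in>K. \<phi> (g k))" for g :: "'x star_word \<Rightarrow> 'a" and K
    using assms(1)
    by (induction K rule: infinite_finite_induct) (auto simp: zero star_hom_def clinear_def)
  have "\<phi> (prod_list (map (\<lambda>(x, b). if b then star (u x) else u x) l)) =
      prod_list (map (\<lambda>(x, b). if b then star (v x) else v x) l)" if "fst ` set l \<subseteq> X" for l
    using that by (induction l) (use assms(1,3) in \<open>auto simp: star_hom_def\<close>)
  then have "\<phi> (word_val u w) = word_val v w" if "w \<in> Poly_Mapping.keys (poly_of f)" for w
    using assms(2) that unfolding free_star_on_def word_val_def by blast
  then show ?thesis
    using assms(1) unfolding eval_free_def sum star_hom_def clinear_def
    by (intro sum.cong) auto
qed


section \<open>Universal C*-algebras\<close>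

text \<open>
  \<open>(A, u)\<close> is the universal C*-algebra with generators \<open>X\<close> and relations \<open>r = 0\<close> for \<open>r \<in> R\<close>:
  \<open>A\<close> is the completion of the free star-algebra on \<open>X\<close> for the largest C*-seminorm that vanishes
  on \<open>R\<close>. (The first clause says that the norm of \<open>A\<close> gives such a seminorm, the third that it is
  the largest one.) Since the C*-seminorms vanishing on \<open>R\<close> correspond to the C*-algebras
  generated by a solution of the relations, this is the usual universal property, which cannot be
  used as a definition because it quantifies over C*-algebras of all types. It is derived
  below as \<open>universal_cstar_property\<close>.
\<close>

definition universal_cstar ::
    "'x set \<Rightarrow> 'x free_star_algebra set \<Rightarrow> ('x \<Rightarrow> 'a::cstar_algebra) \<Rightarrow> bool" where
  "universal_cstar X R u \<longleftrightarrow>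
     (\<forall>r\<in>R. eval_free u r = 0) \<and>
     closure (eval_free u ` free_star_on X) = UNIV \<and>
     (\<forall>p. cstar_seminorm_on (free_star_on X) p \<and> (\<forall>r\<in>R. p r = 0) \<longrightarrow>
        (\<forall>f\<in>free_star_on X. p f \<le> norm (eval_free u f)))"


lemma norm_eval_free_cstar_seminorm:
  fixes v :: "'x \<Rightarrow> 'a::cstar_algebra"
  shows "cstar_seminorm_on S (\<lambda>f. norm (eval_free v f))"
  by (simp add: cstar_seminorm_on_def eval_free_add eval_free_scaleC eval_free_mult eval_free_star
      norm_triangle_ineq norm_scaleC norm_mult_ineq norm_star_mult)

lemma norm_star_le: "norm x \<le> norm (star x)" for x :: "'a::cstar_algebra"
  by (metis mult_right_le_imp_le norm_ge_zero norm_mult_ineq norm_star_mult norm_zero not_less_iff_gr_or_eq power2_eq_square order.order_iff_strict zero_less_norm_iff)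

lemma norm_star [simp]: "norm (star x) = norm x" for x :: "'a::cstar_algebra"
  using norm_star_le[of x] norm_star_le[of "star x"] by (simp add: star_star)

lemma star_diff: "star (x - y) = star x - star (y :: 'a::star_algebra)"
  by (metis add_diff_cancel_right' diff_add_cancel star_add)

lemma continuous_on_star: "continuous_on UNIV (star :: 'a::cstar_algebra \<Rightarrow> 'a)"
  unfolding continuous_on_iff dist_norm by (metis norm_star star_diff)

lemma scaleC_diff: "c *\<^sub>C (x - y) = c *\<^sub>C x - c *\<^sub>C y"
  by (metis add_diff_cancel_right' diff_add_cancel scaleC_add_right)

lemma continuous_scaleC: "continuous_on UNIV ((*\<^sub>C) c :: 'a::cstar_algebra \<Rightarrow> 'a)"
proof -
  have "bounded_linear ((*\<^sub>C) c :: 'a \<Rightarrow> 'a)"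
    by (rule bounded_linear_intro[where K = "cmod c"])
      (simp_all add: scaleC_add_right scaleR_scaleC scaleC_scaleC norm_scaleC mult.commute)
  then show ?thesis by (simp add: linear_continuous_on)
qed

theorem universal_cstar_property:
  fixes u :: "'x \<Rightarrow> 'a::cstar_algebra" and v :: "'x \<Rightarrow> 'b::cstar_algebra"
  assumes univ: "universal_cstar X R u" and v: "\<forall>r\<in>R. eval_free v r = 0"
  shows "\<exists>!\<phi>. star_hom \<phi> \<and> continuous_on UNIV \<phi> \<and> (\<forall>x\<in>X. \<phi> (u x) = v x)"
proof -
  let ?S = "free_star_on X"
  let ?A = "eval_free u ` ?S"
  have le: "norm (eval_free v f) \<le> norm (eval_free u f)" if "f \<in> ?S" for f
    using univ norm_eval_free_cstar_seminorm[of ?S v] v that unfolding universal_cstar_def by fastforce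
  have dense: "closure ?A = UNIV" using univ by (simp add: universal_cstar_def)
  have le_diff: "norm (eval_free v f - eval_free v g) \<le> norm (eval_free u f - eval_free u g)"
    if "f \<in> ?S" "g \<in> ?S" for f g
    using le[of "f + (-1) *\<^sub>C g"] that by (simp add: eval_free_diff free_star_on_add free_star_on_scaleC)
  define g where "g a = eval_free v (SOME f. f \<in> ?S \<and> eval_free u f = a)" for a
  have g: "g (eval_free u f) = eval_free v f" if "f \<in> ?S" for f
  proof -
    let ?f = "SOME f'. f' \<in> ?S \<and> eval_free u f' = eval_free u f"
    have "?f \<in> ?S \<and> eval_free u ?f = eval_free u f"
      by (rule someI[where x = f]) (use that in simp)
    with le_diff[of ?f f] that show ?thesis by (simp add: g_def)
  qed
  have "uniformly_continuous_on ?A g"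
    unfolding uniformly_continuous_on_def
  proof (intro allI impI)
    fix e :: real assume "e > 0"
    then show "\<exists>d>0. \<forall>x\<in>?A. \<forall>x'\<in>?A. dist x' x < d \<longrightarrow> dist (g x') (g x) < e"
      by (intro exI[of _ e]) (auto simp: g dist_norm intro: le_less_trans[OF le_diff])
  qed
  then obtain \<phi> where "uniformly_continuous_on (closure ?A) \<phi>" and ext: "\<And>x. x \<in> ?A \<Longrightarrow> g x = \<phi> x"
    by (rule uniformly_continuous_on_extension_on_closure) blast
  then have cont: "continuous_on UNIV \<phi>"
    by (simp add: dense uniformly_continuous_imp_continuous)
  have \<phi>: "\<phi> (eval_free u f) = eval_free v f" if "f \<in> ?S" for f
    using ext[of "eval_free u f"] g[OF that] that by simp
  have agree: "F = G" if "continuous_on UNIV F" "continuous_on UNIV G"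
      "\<And>f. f \<in> ?S \<Longrightarrow> F (eval_free u f) = G (eval_free u f)" for F G :: "'a \<Rightarrow> 'b"
  proof
    fix x
    have "closed {x. F x = G x}"
      using that(1,2) by (intro closed_Collect_eq)
    moreover have "?A \<subseteq> {x. F x = G x}" using that(3) by auto
    ultimately have "closure ?A \<subseteq> {x. F x = G x}" by (rule closure_minimal[rotated])
    then show "F x = G x" using dense by auto
  qed
  have c: "continuous_on UNIV (\<lambda>x. \<phi> (h x))" if "continuous_on UNIV h" for h :: "'a \<Rightarrow> 'a"
    using continuous_on_compose2[OF cont that] by simp
  have star: "\<phi> (star x) = star (\<phi> x)" for x
    using agree[of "\<lambda>x. \<phi> (star x)" "\<lambda>x. star (\<phi> x)"]
      continuous_on_compose2[OF continuous_on_star cont]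
    by (auto simp: c continuous_on_star free_star_on_star \<phi> dest!: fun_cong
        simp flip: eval_free_star)
  have scale: "\<phi> (k *\<^sub>C x) = k *\<^sub>C \<phi> x" for k x
    using agree[of "\<lambda>x. \<phi> (k *\<^sub>C x)" "\<lambda>x. k *\<^sub>C \<phi> x"]
      continuous_on_compose2[OF continuous_scaleC cont]
    by (auto simp: c continuous_scaleC free_star_on_scaleC \<phi> dest!: fun_cong
        simp flip: eval_free_scaleC)
  have add1: "\<phi> (x + eval_free u f) = \<phi> x + eval_free v f" if "f \<in> ?S" for x f
  proof -
    have "(\<lambda>x. \<phi> (x + eval_free u f)) = (\<lambda>x. \<phi> x + eval_free v f)"
      by (rule agree) (auto simp: that \<phi> free_star_on_add intro!: c continuous_intros cont
          simp flip: eval_free_add)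
    then show ?thesis by meson
  qed
  have add: "\<phi> (x + y) = \<phi> x + \<phi> y" for x y
  proof -
    have "(\<lambda>y. \<phi> (x + y)) = (\<lambda>y. \<phi> x + \<phi> y)"
      by (rule agree) (auto simp: add1 \<phi> intro!: c continuous_intros cont)
    then show ?thesis by meson
  qed
  have mult1: "\<phi> (x * eval_free u f) = \<phi> x * eval_free v f" if "f \<in> ?S" for x f
  proof -
    have "(\<lambda>x. \<phi> (x * eval_free u f)) = (\<lambda>x. \<phi> x * eval_free v f)"
      by (rule agree) (auto simp: that \<phi> free_star_on_mult intro!: c continuous_intros cont
          simp flip: eval_free_mult)
    then show ?thesis by meson
  qed
  have mult: "\<phi> (x * y) = \<phi> x * \<phi> y" for x y
  proof -
    have "(\<lambda>y. \<phi> (x * y)) = (\<lambda>y. \<phi> x * \<phi> y)"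
      by (rule agree) (auto simp: mult1 \<phi> intro!: c continuous_intros cont)
    then show ?thesis by meson
  qed
  have one: "\<phi> 1 = 1" using \<phi>[OF free_star_on_one] by simp
  have gens: "\<forall>x\<in>X. \<phi> (u x) = v x"
  proof
    fix x assume "x \<in> X"
    from \<phi>[OF free_star_on_gen[OF this]] show "\<phi> (u x) = v x" by simp
  qed
  have hom: "star_hom \<phi>"
    by (simp add: star_hom_def clinear_def star scale add mult one)
  show ?thesis
  proof (rule ex1I[of _ \<phi>])
    show "star_hom \<phi> \<and> continuous_on UNIV \<phi> \<and> (\<forall>x\<in>X. \<phi> (u x) = v x)"
      using hom cont gens by blast
  next
    fix \<psi> :: "'a \<Rightarrow> 'b"
    assume "star_hom \<psi> \<and> continuous_on UNIV \<psi> \<and> (\<forall>x\<in>X. \<psi> (u x) = v x)"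
    then show "\<psi> = \<phi>"
      by (intro agree) (auto simp: cont \<phi> star_hom_eval_free_comp[of \<psi> _ X u v])
  qed
qed


section \<open>The Hopf C*-algebra of the free orthogonal quantum group\<close>

definition orthogonality_relations :: "nat \<Rightarrow> (nat \<times> nat) free_star_algebra set" where
  "orthogonality_relations n =
     {gen (i, j) - star (gen (i, j)) | i j. i \<in> {1..n} \<and> j \<in> {1..n}} \<union>
     {(\<Sum>k=1..n. gen (i, k) * gen (j, k)) - of_bool (i = j) | i j. i \<in> {1..n} \<and> j \<in> {1..n}} \<union>
     {(\<Sum>k=1..n. gen (k, i) * gen (k, j)) - of_bool (i = j) | i j. i \<in> {1..n} \<and> j \<in> {1..n}}"

text \<open>\<open>'a\<close> is (a model of) \<open>A\<^sub>o(n)\<close> with standard generators \<open>u i j\<close> for \<open>1 \<le> i, j \<le> n\<close>.\<close>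

definition is_A_o :: "nat \<Rightarrow> (nat \<Rightarrow> nat \<Rightarrow> 'a::cstar_algebra) \<Rightarrow> bool" where
  "is_A_o n u \<longleftrightarrow>
     universal_cstar ({1..n} \<times> {1..n}) (orthogonality_relations n) (\<lambda>(i, j). u i j)"

definition elementary_span :: "('a \<Rightarrow> 'b \<Rightarrow> 't::star_algebra) \<Rightarrow> 't set" where
  "elementary_span tens = {x. \<exists>(m::nat) a b. x = (\<Sum>i<m. tens (a i) (b i))}"

text \<open>
  \<open>'t\<close> with \<open>tens a b = a \<otimes> b\<close> is the minimal C*-tensor product of \<open>'a\<close> and \<open>'b\<close>: a completion of
  the algebraic tensor product for its smallest C*-norm. The clause about linearly independent
  \<open>b 0, \<dots>, b (m - 1)\<close> says that the algebraic tensor product is embedded.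
\<close>

definition is_min_tensor ::
    "('a::cstar_algebra \<Rightarrow> 'b::cstar_algebra \<Rightarrow> 't::cstar_algebra) \<Rightarrow> bool" where
  "is_min_tensor tens \<longleftrightarrow>
     (\<forall>b. clinear (\<lambda>a. tens a b)) \<and> (\<forall>a. clinear (tens a)) \<and>
     tens 1 1 = 1 \<and>
     (\<forall>a b c d. tens a b * tens c d = tens (a * c) (b * d)) \<and>
     (\<forall>a b. star (tens a b) = tens (star a) (star b)) \<and>
     (\<forall>(m::nat) a b. (\<Sum>i<m. tens (a i) (b i)) = 0 \<and>
        (\<forall>c::nat \<Rightarrow> complex. (\<Sum>i<m. c i *\<^sub>C b i) = 0 \<longrightarrow> (\<forall>i<m. c i = 0)) \<longrightarrow>
        (\<forall>i<m. a i = 0)) \<and>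
     closure (elementary_span tens) = UNIV \<and>
     (\<forall>p. cstar_seminorm_on (elementary_span tens) p \<and>
        (\<forall>x\<in>elementary_span tens. p x = 0 \<longrightarrow> x = 0) \<longrightarrow>
        (\<forall>x\<in>elementary_span tens. norm x \<le> p x))"

definition is_comultiplication ::
    "nat \<Rightarrow> (nat \<Rightarrow> nat \<Rightarrow> 'a::cstar_algebra) \<Rightarrow> ('a \<Rightarrow> 'a \<Rightarrow> 't::cstar_algebra) \<Rightarrow>
      ('a \<Rightarrow> 't) \<Rightarrow> bool" where
  "is_comultiplication n u tens \<Delta> \<longleftrightarrow>
     star_hom \<Delta> \<and>
     (\<forall>i\<in>{1..n}. \<forall>j\<in>{1..n}. \<Delta> (u i j) = (\<Sum>k=1..n. tens (u i k) (u k j)))"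

text \<open>\<open>L\<close> is \<open>id \<otimes> h\<close>, resp. \<open>h \<otimes> id\<close>. It is unique because the elementary tensors span a
  dense subspace.\<close>

definition is_id_tensor ::
    "('a::cstar_algebra \<Rightarrow> 'a \<Rightarrow> 't::cstar_algebra) \<Rightarrow> ('a \<Rightarrow> complex) \<Rightarrow> ('t \<Rightarrow> 'a) \<Rightarrow> bool" where
  "is_id_tensor tens h L \<longleftrightarrow> bounded_clinear L \<and> (\<forall>a b. L (tens a b) = h b *\<^sub>C a)"

definition is_tensor_id ::
    "('a::cstar_algebra \<Rightarrow> 'a \<Rightarrow> 't::cstar_algebra) \<Rightarrow> ('a \<Rightarrow> complex) \<Rightarrow> ('t \<Rightarrow> 'a) \<Rightarrow> bool" where
  "is_tensor_id tens h L \<longleftrightarrow> bounded_clinear L \<and> (\<forall>a b. L (tens a b) = h a *\<^sub>C b)"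

definition is_haar_functional ::
    "('a::cstar_algebra \<Rightarrow> 'a \<Rightarrow> 't::cstar_algebra) \<Rightarrow> ('a \<Rightarrow> 't) \<Rightarrow> ('a \<Rightarrow> complex) \<Rightarrow> bool" where
  "is_haar_functional tens \<Delta> h \<longleftrightarrow>
     clinear h \<and> h 1 = 1 \<and> (\<forall>a. h (star a * a) \<in> \<real>\<^sub>\<ge>\<^sub>0) \<and>
     (\<exists>L. is_id_tensor tens h L \<and> (\<forall>a. L (\<Delta> a) = h a *\<^sub>C 1)) \<and>
     (\<exists>L. is_tensor_id tens h L \<and> (\<forall>a. L (\<Delta> a) = h a *\<^sub>C 1))"


section \<open>Temperley-Lieb diagrams and Gram matrices\<close>

text \<open>\<open>D(k)\<close>, as the non-crossing pair partitions of \<open>{1..2 * k}\<close>.\<close>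

definition TL_diagrams :: "nat \<Rightarrow> nat set set set" where
  "TL_diagrams k = {p. partition_on {1..2 * k} p \<and> (\<forall>b\<in>p. card b = 2) \<and>
     \<not> (\<exists>a b c d. a < b \<and> b < c \<and> c < d \<and> {a, c} \<in> p \<and> {b, d} \<in> p)}"

text \<open>The number of connected components of the graph on \<open>{1..2 * k}\<close> with edge set \<open>p \<union> q\<close>.\<close>

definition loops :: "nat \<Rightarrow> nat set set \<Rightarrow> nat set set \<Rightarrow> nat" where
  "loops k p q = card ({1..2 * k} // {(x, y). {x, y} \<in> p \<union> q}\<^sup>*)"

text \<open>Matrices indexed by a set \<open>D\<close> are functions of two arguments of which only the values on
  \<open>D \<times> D\<close> matter.\<close>

definition gram :: "nat \<Rightarrow> nat \<Rightarrow> nat set set \<Rightarrow> nat set set \<Rightarrow> real" where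
  "gram k m p q = real m ^ loops k p q"

definition mat_mult_on ::
    "'i set \<Rightarrow> ('i \<Rightarrow> 'i \<Rightarrow> real) \<Rightarrow> ('i \<Rightarrow> 'i \<Rightarrow> real) \<Rightarrow> 'i \<Rightarrow> 'i \<Rightarrow> real" where
  "mat_mult_on D A B p q = (\<Sum>r\<in>D. A p r * B r q)"

text \<open>As for \<open>matrix_inv\<close>, the value is only meaningful for an invertible matrix.\<close>

definition mat_inv_on :: "'i set \<Rightarrow> ('i \<Rightarrow> 'i \<Rightarrow> real) \<Rightarrow> 'i \<Rightarrow> 'i \<Rightarrow> real" where
  "mat_inv_on D A = (SOME B. \<forall>p\<in>D. \<forall>q\<in>D.
     mat_mult_on D A B p q = of_bool (p = q) \<and> mat_mult_on D B A p q = of_bool (p = q))"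

definition trace_on :: "'i set \<Rightarrow> ('i \<Rightarrow> 'i \<Rightarrow> real) \<Rightarrow> real" where
  "trace_on D A = (\<Sum>p\<in>D. A p p)"

end

(* The integrals of the products of m generators form the matrix of the orthogonal projection onto the
   fixed vectors of the m-th tensor power of u. If these are spanned by the vectors of the
   Temperley-Lieb diagrams, the projection is the Weingarten matrix sum W(p,q) xi_p xi_q^T, where W is
   the inverse of the Gram matrix, and summing its diagonal over words in 1..s gives the trace.

   That no further vectors are fixed is obtained without Tannaka-Krein duality. The Weingarten formula
   defines a functional on the free star-algebra which vanishes on the ideal of the orthogonality
   relations. It is positive, because the Hilbert-Schmidt projection onto the star-algebra of
   Temperley-Lieb operators is completely positive. Its GNS representation is bounded, so the universal
   C*-norm dominates it: the functional respects all identities valid in A_o(n). Comparing the two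
   invariant functionals shows that they agree on products of generators.

   The Gram matrix is invertible for n >= 2 because the diagram vectors are triangular with respect to
   the sum of the openers of a pairing. *)

theory Submission
  imports Defs
begin

section \<open>Positivity of conditional expectations\<close>

text \<open>Positivity of the state is the real obstacle. For f = sum of c_w w, the value at
  \<open>star f * f\<close> is a quadratic form in c with entries \<open>proj (rev (row_word w) @
  row_word w') (rev (col_word w) @ col_word w')\<close>, since the adjoint reverses words.
  Semidefiniteness of \<open>proj\<close> does not give this, because w and w' share each argument
  instead of occupying one each. After bending, however, rows and columns of one word index a matrix
  entry, and the form becomes the Choi matrix of the projection onto an operator algebra. That
  algebra contains the identity and is closed under products and transposes, so the Choi matrix can
  be compared with the projection onto its commutant. An element of the free algebra involves
  finitely many words, so tensor powers up to a bounded order suffice and all operators are finite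
  matrices. They may be taken real, because \<open>proj\<close> is real.\<close>

lemma sum_rotate3:
  "(\<Sum>a\<in>A. \<Sum>b\<in>B. \<Sum>c\<in>C. f a b c) = (\<Sum>b\<in>B. \<Sum>c\<in>C. \<Sum>a\<in>A. f a b c)"
  by (subst sum.swap, intro sum.cong refl, rule sum.swap)

lemma sum_swap_pairs:
  "(\<Sum>a\<in>A. \<Sum>b\<in>B. \<Sum>c\<in>C. \<Sum>d\<in>D. f a b c d) = (\<Sum>c\<in>C. \<Sum>d\<in>D. \<Sum>a\<in>A. \<Sum>b\<in>B. f a b c d)"
proof -
  have "(\<Sum>a\<in>A. \<Sum>b\<in>B. \<Sum>c\<in>C. \<Sum>d\<in>D. f a b c d) = (\<Sum>a\<in>A. \<Sum>c\<in>C. \<Sum>d\<in>D. \<Sum>b\<in>B. f a b c d)"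
    by (intro sum.cong refl sum_rotate3)
  also have "\<dots> = (\<Sum>c\<in>C. \<Sum>d\<in>D. \<Sum>a\<in>A. \<Sum>b\<in>B. f a b c d)"
    by (rule sum_rotate3)
  finally show ?thesis .
qed

text \<open>Elimination of one index at a time: positivity at the unit vector of \<open>d\<close>
  gives a positive pivot, and the Schur complement is again positive.\<close>

lemma positive_definite_solvable:
  fixes A :: "'i \<Rightarrow> 'i \<Rightarrow> real"
  assumes "finite D"
    and "\<And>x. \<exists>p\<in>D. x p \<noteq> 0 \<Longrightarrow> 0 < (\<Sum>p\<in>D. x p * (\<Sum>q\<in>D. A p q * x q))"
  shows "\<exists>x. \<forall>p\<in>D. (\<Sum>q\<in>D. A p q * x q) = b p"
  using assms
proof (induction D arbitrary: A b rule: finite_induct)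
  case empty
  then show ?case by simp
next
  case (insert d D)
  have pos: "A d d > 0"
  proof -
    have "(\<Sum>q\<in>D. A d q * of_bool (q = d)) = 0" "(\<Sum>p\<in>D. of_bool (p = d) * (\<Sum>q\<in>insert d D. A p q * of_bool (q = d))) = 0"
      using insert.hyps by (auto intro!: sum.neutral)
    then show ?thesis
      using insert.prems[of "\<lambda>i. of_bool (i = d)"] insert.hyps by simp
  qed
  \<comment> \<open>\<open>A'\<close> is the Schur complement of the pivot. \<open>ext x c\<close>
    completes \<open>x\<close> at \<open>d\<close> so that row \<open>d\<close> takes the value
    \<open>c\<close>; for \<open>c = 0\<close> the form of \<open>A\<close> at the extension is the
    form of \<open>A'\<close> at \<open>x\<close>.\<close>
  define A' where "A' p q = A p q - A p d * A d q / A d d" for p q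
  define ext where "ext x c = x(d := (c - (\<Sum>q\<in>D. A d q * x q)) / A d d)" for x :: "'i \<Rightarrow> real" and c
  have ext_D: "ext x c p = x p" if "p \<in> D" for x c p
    using that insert.hyps by (auto simp: ext_def)
  have row_d: "(\<Sum>q\<in>insert d D. A d q * ext x c q) = c" for x c
  proof -
    have "(\<Sum>q\<in>D. A d q * ext x c q) = (\<Sum>q\<in>D. A d q * x q)"
      by (rule sum.cong) (simp_all add: ext_D)
    with pos insert.hyps show ?thesis by (simp add: ext_def)
  qed
  have row: "(\<Sum>q\<in>insert d D. A p q * ext x c q) = (\<Sum>q\<in>D. A' p q * x q) + A p d * c / A d d" for x c p
  proof -
    have "(\<Sum>q\<in>D. A p q * ext x c q) = (\<Sum>q\<in>D. A p q * x q)"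
      by (rule sum.cong) (simp_all add: ext_D)
    moreover have "(\<Sum>q\<in>D. A' p q * x q) = (\<Sum>q\<in>D. A p q * x q) - A p d / A d d * (\<Sum>q\<in>D. A d q * x q)"
      by (simp add: A'_def algebra_simps sum_subtractf sum_distrib_left)
    ultimately show ?thesis
      using insert.hyps by (simp add: ext_def diff_divide_distrib right_diff_distrib)
  qed
  have "\<exists>x. \<forall>p\<in>D. (\<Sum>q\<in>D. A' p q * x q) = b p - A p d * b d / A d d"
  proof (rule insert.IH)
    fix x :: "'i \<Rightarrow> real" assume "\<exists>p\<in>D. x p \<noteq> 0"
    then have "\<exists>p\<in>insert d D. ext x 0 p \<noteq> 0" using ext_D by auto
    from insert.prems[OF this] have "0 < (\<Sum>p\<in>D. ext x 0 p * (\<Sum>q\<in>D. A' p q * x q))"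
      using insert.hyps row_d[of x 0] row[of _ x 0] by simp
    also have "\<dots> = (\<Sum>p\<in>D. x p * (\<Sum>q\<in>D. A' p q * x q))"
      by (rule sum.cong) (simp_all add: ext_D)
    finally show "0 < \<dots>" .
  qed
  then obtain x where x: "\<And>p. p \<in> D \<Longrightarrow> (\<Sum>q\<in>D. A' p q * x q) = b p - A p d * b d / A d d"
    by blast
  have "\<forall>p\<in>insert d D. (\<Sum>q\<in>insert d D. A p q * ext x (b d) q) = b p"
    using row_d[of x "b d"] row[of _ x "b d"] x by (metis add.commute diff_add_cancel insert_iff)
  then show ?case by blast
qed

text \<open>\<open>mat_inv_on\<close> is a choice, so a two-sided inverse has to be exhibited.
  Solving for the columns gives a right inverse \<open>B\<close>; then A (B A - 1) = 0, and
  definiteness makes \<open>A\<close> injective.\<close>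

lemma positive_definite_mat_inv_on:
  fixes A :: "'i \<Rightarrow> 'i \<Rightarrow> real"
  assumes "finite D"
    and pd: "\<And>x. \<exists>p\<in>D. x p \<noteq> 0 \<Longrightarrow> 0 < (\<Sum>p\<in>D. x p * (\<Sum>q\<in>D. A p q * x q))"
    and "p \<in> D" "q \<in> D"
  shows "mat_mult_on D A (mat_inv_on D A) p q = of_bool (p = q)"
    and "mat_mult_on D (mat_inv_on D A) A p q = of_bool (p = q)"
proof -
  have "\<forall>q. \<exists>x. \<forall>p\<in>D. (\<Sum>r\<in>D. A p r * x r) = of_bool (p = q)"
    by (intro allI positive_definite_solvable[OF assms(1)]) (rule pd)
  then obtain X where X: "\<And>p q. p \<in> D \<Longrightarrow> (\<Sum>r\<in>D. A p r * X q r) = of_bool (p = q)" by metis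
  define B where "B r q = X q r" for r q
  have AB: "mat_mult_on D A B p q = of_bool (p = q)" if "p \<in> D" for p q
    using X[OF that] by (simp add: mat_mult_on_def B_def)
  have inj: "x p = 0" if "\<And>p. p \<in> D \<Longrightarrow> (\<Sum>q\<in>D. A p q * x q) = 0" "p \<in> D" for x p
    using pd[of x] that by force
  have BA: "mat_mult_on D B A p q = of_bool (p = q)" if "p \<in> D" "q \<in> D" for p q
  proof -
    have "mat_mult_on D B A p q - of_bool (p = q) = 0"
    proof (rule inj[where x = "\<lambda>p. mat_mult_on D B A p q - of_bool (p = q)"])
      fix p assume "p \<in> D"
      have "(\<Sum>r\<in>D. A p r * mat_mult_on D B A r q) = (\<Sum>t\<in>D. mat_mult_on D A B p t * A t q)"
        unfolding mat_mult_on_def sum_distrib_left sum_distrib_right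
        by (subst sum.swap) (simp add: mult_ac)
      also have "\<dots> = A p q"
        using \<open>p \<in> D\<close> assms(1) by (simp add: AB)
      finally show "(\<Sum>r\<in>D. A p r * (mat_mult_on D B A r q - of_bool (r = q))) = 0"
        using that assms(1) by (simp add: right_diff_distrib sum_subtractf)
    qed (use that in simp)
    then show ?thesis by simp
  qed
  have "\<exists>B. \<forall>p\<in>D. \<forall>q\<in>D. mat_mult_on D A B p q = of_bool (p = q) \<and> mat_mult_on D B A p q = of_bool (p = q)"
    using AB BA by blast
  from someI_ex[OF this] show "mat_mult_on D A (mat_inv_on D A) p q = of_bool (p = q)"
    and "mat_mult_on D (mat_inv_on D A) A p q = of_bool (p = q)"
    using assms(3,4) by (auto simp: mat_inv_on_def)
qed

text \<open>\<open>P i i' j j'\<close> is the \<open>((i, i'), (j, j'))\<close> entry of the Hilbert-Schmidt orthogonal projection \<open>E\<close> onto a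
  unital *-algebra \<open>M\<close> of \<open>K \<times> K\<close> matrices. Reading the same entries at \<open>((i, j), (i', j'))\<close> gives the
  Choi matrix of \<open>E\<close>, whose positivity is the aim.\<close>

locale hilbert_schmidt_projection =
  fixes K :: "'k set" and M :: "('k \<Rightarrow> 'k \<Rightarrow> real) set" and P :: "'k \<Rightarrow> 'k \<Rightarrow> 'k \<Rightarrow> 'k \<Rightarrow> real"
  assumes finite_K: "finite K"
    and mult_closed: "S \<in> M \<Longrightarrow> T \<in> M \<Longrightarrow> mat_mult_on K S T \<in> M"
    and transpose_closed: "S \<in> M \<Longrightarrow> (\<lambda>i j. S j i) \<in> M"
    and one_closed: "(\<lambda>i j. of_bool (i = j)) \<in> M"
    and kernel_sym: "P i i' j j' = P j j' i i'"
    and range_M: "j \<in> K \<Longrightarrow> j' \<in> K \<Longrightarrow> (\<lambda>i i'. P i i' j j') \<in> M"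
    and proj_id: "S \<in> M \<Longrightarrow> i \<in> K \<Longrightarrow> i' \<in> K \<Longrightarrow> (\<Sum>j\<in>K. \<Sum>j'\<in>K. P i i' j j' * S j j') = S i i'"
begin

text \<open>The Choi matrix as an operator on matrices. With an orthonormal basis b of the span of
  \<open>M\<close>, \<open>\<Phi> C\<close> is the sum of b C b^T and \<open>D0\<close> the sum of b
  b^T. Up to the factor \<open>D0\<close> this is the projection onto the commutant of
  \<open>M\<close>.\<close>

definition \<Phi> :: "('k \<Rightarrow> 'k \<Rightarrow> real) \<Rightarrow> 'k \<Rightarrow> 'k \<Rightarrow> real" where
  "\<Phi> C i j = (\<Sum>i'\<in>K. \<Sum>j'\<in>K. P i i' j j' * C i' j')"

definition D0 :: "'k \<Rightarrow> 'k \<Rightarrow> real" where "D0 i j = (\<Sum>k\<in>K. P i k j k)"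

lemma range_M': "i \<in> K \<Longrightarrow> i' \<in> K \<Longrightarrow> P i i' \<in> M"
  using range_M[of i i'] by (subst (asm) kernel_sym)

text \<open>The sum of \<open>P i i' k k' * P k' k j' j\<close> can be evaluated by reproducing
  either factor, since transposes of matrices of \<open>M\<close> stay in \<open>M\<close>; the two
  results are the two sides.\<close>

lemma kernel_transpose:
  assumes "i \<in> K" "i' \<in> K" "j \<in> K" "j' \<in> K"
  shows "P i' i j' j = P i i' j j'"
proof -
  have 1: "(\<Sum>k\<in>K. \<Sum>k'\<in>K. P i i' k k' * P k' k j' j) = P i' i j' j"
    using proj_id[OF transpose_closed[OF range_M[of j' j]]] assms by simp
  have "(\<Sum>k\<in>K. \<Sum>k'\<in>K. P i i' k k' * P k' k j' j) = (\<Sum>k'\<in>K. \<Sum>k\<in>K. P j' j k' k * P i i' k k')"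
    by (subst sum.swap) (simp add: mult.commute kernel_sym[of _ _ j' j])
  also have "\<dots> = P i i' j j'"
    using proj_id[OF transpose_closed[OF range_M'[of i i']]] assms by simp
  finally show ?thesis using 1 by simp
qed

text \<open>Both sides are the Hilbert-Schmidt product of \<open>P i i'\<close> with
  \<open>S\<close> times the kernel matrix at \<open>(k, j')\<close>. Moving \<open>S\<close> to the
  other factor as its transpose stays inside \<open>M\<close>, where \<open>P\<close>
  reproduces.\<close>

lemma left_module:
  assumes S: "S \<in> M" and K: "i \<in> K" "i' \<in> K" "k \<in> K" "j' \<in> K"
  shows "(\<Sum>j\<in>K. P i i' j j' * S j k) = (\<Sum>m\<in>K. S i m * P m i' k j')"
proof -
  have 1: "mat_mult_on K (\<lambda>i j. S j i) (P i i') \<in> M"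
    by (rule mult_closed[OF transpose_closed[OF S] range_M'[OF K(1,2)]])
  have 2: "mat_mult_on K S (\<lambda>m i'. P m i' k j') \<in> M"
    by (rule mult_closed[OF S range_M[OF K(3,4)]])
  have "(\<Sum>m\<in>K. S i m * P m i' k j') = (\<Sum>y\<in>K. \<Sum>y'\<in>K. P i i' y y' * (\<Sum>m\<in>K. S y m * P m y' k j'))"
    using proj_id[OF 2 K(1,2)] by (simp add: mat_mult_on_def)
  also have "\<dots> = (\<Sum>y\<in>K. \<Sum>m\<in>K. \<Sum>y'\<in>K. P i i' y y' * (S y m * P m y' k j'))"
    by (simp add: sum_distrib_left) (intro sum.cong refl sum.swap)
  also have "\<dots> = (\<Sum>m\<in>K. \<Sum>y'\<in>K. \<Sum>y\<in>K. P i i' y y' * (S y m * P m y' k j'))"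
    by (rule sum_rotate3)
  also have "\<dots> = (\<Sum>m\<in>K. \<Sum>y'\<in>K. P k j' m y' * mat_mult_on K (\<lambda>i j. S j i) (P i i') m y')"
    by (simp add: mat_mult_on_def sum_distrib_left mult_ac kernel_sym[of _ _ k j'])
  also have "\<dots> = (\<Sum>j\<in>K. P i i' j j' * S j k)"
    using proj_id[OF 1 K(3,4)] by (simp add: mat_mult_on_def mult.commute)
  finally show ?thesis by simp
qed

lemma \<Phi>_commutes:
  assumes "S \<in> M" "i \<in> K" "k \<in> K"
  shows "mat_mult_on K (\<Phi> C) S i k = mat_mult_on K S (\<Phi> C) i k"
proof -
  have "mat_mult_on K (\<Phi> C) S i k = (\<Sum>j\<in>K. \<Sum>i'\<in>K. \<Sum>j'\<in>K. P i i' j j' * S j k * C i' j')"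
    by (simp add: mat_mult_on_def \<Phi>_def sum_distrib_left mult_ac)
  also have "\<dots> = (\<Sum>i'\<in>K. \<Sum>j'\<in>K. (\<Sum>j\<in>K. P i i' j j' * S j k) * C i' j')"
    by (subst sum_rotate3) (simp add: sum_distrib_right)
  also have "\<dots> = (\<Sum>i'\<in>K. \<Sum>j'\<in>K. (\<Sum>m\<in>K. S i m * P m i' k j') * C i' j')"
    by (intro sum.cong refl) (use assms in \<open>simp add: left_module\<close>)
  also have "\<dots> = (\<Sum>m\<in>K. \<Sum>i'\<in>K. \<Sum>j'\<in>K. S i m * (P m i' k j' * C i' j'))"
    by (subst sum_rotate3) (simp add: sum_distrib_left sum_distrib_right mult_ac)
  also have "\<dots> = mat_mult_on K S (\<Phi> C) i k"
    by (simp add: mat_mult_on_def \<Phi>_def sum_distrib_left)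
  finally show ?thesis .
qed

lemma D0_eq: "j \<in> K \<Longrightarrow> D0 i j = \<Phi> (\<lambda>i j. of_bool (i = j)) i j"
  using finite_K by (simp add: D0_def \<Phi>_def)

lemma D0_commutes:
  assumes "S \<in> M" "i \<in> K" "k \<in> K"
  shows "mat_mult_on K D0 S i k = mat_mult_on K S D0 i k"
  using \<Phi>_commutes[OF assms, of "\<lambda>i j. of_bool (i = j)"] assms
  by (simp add: mat_mult_on_def D0_eq)

text \<open>\<open>\<Phi> C\<close> commutes with \<open>M\<close>, so in the sum of b
  (\<open>\<Phi> C\<close>) b^T it moves past b^T and leaves the factor \<open>D0\<close>.\<close>

lemma \<Phi>_\<Phi>:
  assumes "i \<in> K" "j \<in> K"
  shows "\<Phi> (\<Phi> C) i j = mat_mult_on K D0 (\<Phi> C) i j"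
proof -
  have "(\<Sum>j'\<in>K. P i i' j j' * \<Phi> C i' j') = (\<Sum>j'\<in>K. P i i' j' i' * \<Phi> C j' j)" if "i' \<in> K" for i'
    using \<Phi>_commutes[OF transpose_closed[OF range_M'[OF assms(1) that]] that assms(2), of C]
    by (simp add: mat_mult_on_def mult.commute)
  then have "\<Phi> (\<Phi> C) i j = (\<Sum>i'\<in>K. \<Sum>j'\<in>K. P i i' j' i' * \<Phi> C j' j)"
    by (subst \<Phi>_def) simp
  also have "\<dots> = mat_mult_on K D0 (\<Phi> C) i j"
    unfolding mat_mult_on_def D0_def sum_distrib_right by (rule sum.swap)
  finally show ?thesis .
qed

text \<open>\<open>D0\<close> is a value of \<open>\<Phi>\<close> and therefore commutes with the
  matrices of \<open>M\<close> that make up the kernel.\<close>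

lemma \<Phi>_D0:
  assumes "i \<in> K" "j \<in> K"
  shows "\<Phi> (mat_mult_on K D0 C) i j = mat_mult_on K D0 (\<Phi> C) i j"
proof -
  have "\<Phi> (mat_mult_on K D0 C) i j = (\<Sum>j'\<in>K. \<Sum>i'\<in>K. \<Sum>m\<in>K. P i i' j j' * D0 i' m * C m j')"
    unfolding \<Phi>_def mat_mult_on_def sum_distrib_left by (subst sum.swap) (simp add: mult_ac)
  also have "\<dots> = (\<Sum>j'\<in>K. \<Sum>m\<in>K. mat_mult_on K (\<lambda>i i'. P i i' j j') D0 i m * C m j')"
    unfolding mat_mult_on_def sum_distrib_right by (intro sum.cong refl sum.swap)
  also have "\<dots> = (\<Sum>j'\<in>K. \<Sum>m\<in>K. mat_mult_on K D0 (\<lambda>i i'. P i i' j j') i m * C m j')"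
    by (intro sum.cong refl) (use assms in \<open>simp add: D0_commutes range_M\<close>)
  also have "\<dots> = (\<Sum>i'\<in>K. \<Sum>m\<in>K. \<Sum>j'\<in>K. D0 i i' * (P i' m j j' * C m j'))"
    unfolding mat_mult_on_def sum_distrib_right
    by (subst sum.swap, subst (2) sum.swap, subst sum.swap) (simp add: mult_ac)
  also have "\<dots> = mat_mult_on K D0 (\<Phi> C) i j"
    by (simp add: mat_mult_on_def \<Phi>_def sum_distrib_left)
  finally show ?thesis .
qed

lemma \<Phi>_self_adjoint:
  "(\<Sum>i\<in>K. \<Sum>j\<in>K. X i j * \<Phi> Y i j) = (\<Sum>i\<in>K. \<Sum>j\<in>K. \<Phi> X i j * Y i j)"
proof -
  have "(\<Sum>i\<in>K. \<Sum>j\<in>K. X i j * \<Phi> Y i j) =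
      (\<Sum>i\<in>K. \<Sum>j\<in>K. \<Sum>i'\<in>K. \<Sum>j'\<in>K. P i i' j j' * X i j * Y i' j')"
    by (simp add: \<Phi>_def sum_distrib_left mult_ac)
  also have "\<dots> = (\<Sum>i'\<in>K. \<Sum>j'\<in>K. \<Sum>i\<in>K. \<Sum>j\<in>K. P i' i j' j * X i j * Y i' j')"
    by (subst sum_swap_pairs) (intro sum.cong refl, simp add: kernel_transpose)
  also have "\<dots> = (\<Sum>i\<in>K. \<Sum>j\<in>K. \<Phi> X i j * Y i j)"
    by (simp add: \<Phi>_def sum_distrib_right)
  finally show ?thesis .
qed

text \<open>The kernel of a projection is idempotent, so each \<open>P j k j' k\<close> is itself a
  sum of products of kernel entries, which yields squares.\<close>

lemma D0_quadratic_form: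
  "(\<Sum>i\<in>K. x i * (\<Sum>j\<in>K. D0 i j * x j)) = (\<Sum>k\<in>K. \<Sum>i\<in>K. \<Sum>i'\<in>K. (\<Sum>j\<in>K. P i i' j k * x j)\<^sup>2)"
proof -
  have idem: "(\<Sum>i\<in>K. \<Sum>i'\<in>K. P i i' j k * P i i' j' k') = P j k j' k'"
    if "j \<in> K" "k \<in> K" "j' \<in> K" "k' \<in> K" for j k j' k'
    using proj_id[OF range_M[OF that(3,4)] that(1,2)] by (simp add: kernel_sym[of j k])
  have "(\<Sum>i\<in>K. \<Sum>i'\<in>K. (\<Sum>j\<in>K. P i i' j k * x j)\<^sup>2) = (\<Sum>j\<in>K. \<Sum>j'\<in>K. P j k j' k * x j * x j')"
    if "k \<in> K" for k
  proof -
    have "(\<Sum>i\<in>K. \<Sum>i'\<in>K. (\<Sum>j\<in>K. P i i' j k * x j)\<^sup>2) =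
        (\<Sum>i\<in>K. \<Sum>i'\<in>K. \<Sum>j\<in>K. \<Sum>j'\<in>K. P i i' j k * P i i' j' k * x j * x j')"
      by (simp add: power2_eq_square sum_product mult_ac)
    also have "\<dots> = (\<Sum>j\<in>K. \<Sum>j'\<in>K. (\<Sum>i\<in>K. \<Sum>i'\<in>K. P i i' j k * P i i' j' k) * x j * x j')"
      by (subst sum_swap_pairs) (simp add: sum_distrib_right)
    also have "\<dots> = (\<Sum>j\<in>K. \<Sum>j'\<in>K. P j k j' k * x j * x j')"
      by (intro sum.cong refl) (use that in \<open>simp add: idem\<close>)
    finally show ?thesis .
  qed
  then have "(\<Sum>k\<in>K. \<Sum>i\<in>K. \<Sum>i'\<in>K. (\<Sum>j\<in>K. P i i' j k * x j)\<^sup>2) =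
      (\<Sum>k\<in>K. \<Sum>j\<in>K. \<Sum>j'\<in>K. P j k j' k * x j * x j')" by simp
  also have "\<dots> = (\<Sum>j\<in>K. \<Sum>j'\<in>K. \<Sum>k\<in>K. P j k j' k * x j * x j')"
    by (rule sum_rotate3)
  also have "\<dots> = (\<Sum>i\<in>K. x i * (\<Sum>j\<in>K. D0 i j * x j))"
    by (simp add: D0_def sum_distrib_left sum_distrib_right mult_ac)
  finally show ?thesis by simp
qed

lemma D0_nonneg: "0 \<le> (\<Sum>i\<in>K. x i * (\<Sum>j\<in>K. D0 i j * x j))"
  unfolding D0_quadratic_form by (intro sum_nonneg) simp

text \<open>If all squares vanish, every sum of \<open>P i i' j k * x j\<close> over
  \<open>j\<close> is 0. The identity matrix lies in \<open>M\<close>, and reproducing it by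
  \<open>P\<close> recovers \<open>x\<close> from these sums.\<close>

lemma D0_positive:
  assumes "\<exists>i\<in>K. x i \<noteq> 0"
  shows "0 < (\<Sum>i\<in>K. x i * (\<Sum>j\<in>K. D0 i j * x j))"
proof (rule ccontr)
  assume "\<not> ?thesis"
  then have "(\<Sum>k\<in>K. \<Sum>i\<in>K. \<Sum>i'\<in>K. (\<Sum>j\<in>K. P i i' j k * x j)\<^sup>2) = 0"
    using D0_nonneg[of x] unfolding D0_quadratic_form by linarith
  then have "(\<Sum>i\<in>K. \<Sum>i'\<in>K. (\<Sum>j\<in>K. P i i' j k * x j)\<^sup>2) = 0" if "k \<in> K" for k
    using that finite_K by (simp add: sum_nonneg_eq_0_iff sum_nonneg)
  then have "(\<Sum>i'\<in>K. (\<Sum>j\<in>K. P i i' j k * x j)\<^sup>2) = 0" if "i \<in> K" "k \<in> K" for i k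
    using that finite_K by (simp add: sum_nonneg_eq_0_iff sum_nonneg)
  then have 0: "(\<Sum>j\<in>K. P i i' j k * x j) = 0" if "i \<in> K" "i' \<in> K" "k \<in> K" for i i' k
    using that finite_K by (simp add: sum_nonneg_eq_0_iff)
  have "x k = 0" if "k \<in> K" for k
  proof -
    have "x k = (\<Sum>j\<in>K. of_bool (j = k) * x j)"
      using that finite_K by simp
    also have "\<dots> = (\<Sum>j\<in>K. (\<Sum>i\<in>K. \<Sum>i'\<in>K. P j k i i' * of_bool (i = i')) * x j)"
      using that by (intro sum.cong refl) (simp only: proj_id[OF one_closed])
    also have "\<dots> = (\<Sum>j\<in>K. \<Sum>i\<in>K. P i i j k * x j)"
      using finite_K by (simp add: sum_distrib_right kernel_sym[of _ k])
    also have "\<dots> = (\<Sum>i\<in>K. \<Sum>j\<in>K. P i i j k * x j)"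
      by (rule sum.swap)
    also have "\<dots> = 0" using 0 that by simp
    finally show ?thesis .
  qed
  with assms show False by blast
qed

text \<open>Since \<open>\<Phi>\<close> is self-adjoint with \<open>\<Phi> \<circ> \<Phi> = D0 \<Phi>\<close>, writing \<open>C = D0 Y\<close> turns the form into
  the value of \<open>D0\<close> at \<open>\<Phi> Y\<close>.\<close>

theorem kernel_positive: "0 \<le> (\<Sum>i\<in>K. \<Sum>j\<in>K. C i j * \<Phi> C i j)"
proof -
  have "\<forall>j. \<exists>y. \<forall>i\<in>K. (\<Sum>m\<in>K. D0 i m * y m) = C i j"
    by (intro allI positive_definite_solvable[OF finite_K]) (rule D0_positive)
  then obtain Y' where Y': "\<And>i j. i \<in> K \<Longrightarrow> (\<Sum>m\<in>K. D0 i m * Y' j m) = C i j" by metis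
  define Y where "Y m j = Y' j m" for m j
  have C: "mat_mult_on K D0 Y i j = C i j" if "i \<in> K" for i j
    using Y'[OF that] by (simp add: mat_mult_on_def Y_def)
  have cong: "\<Phi> C i j = \<Phi> (mat_mult_on K D0 Y) i j" for i j
    by (simp add: \<Phi>_def C)
  have "(\<Sum>i\<in>K. \<Sum>j\<in>K. C i j * \<Phi> C i j) = (\<Sum>i\<in>K. \<Sum>j\<in>K. C i j * \<Phi> (\<Phi> Y) i j)"
    by (intro sum.cong refl) (simp add: cong \<Phi>_D0 \<Phi>_\<Phi>)
  also have "\<dots> = (\<Sum>i\<in>K. \<Sum>j\<in>K. mat_mult_on K D0 (\<Phi> Y) i j * \<Phi> Y i j)"
    by (subst \<Phi>_self_adjoint) (simp add: cong \<Phi>_D0)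
  also have "\<dots> = (\<Sum>j\<in>K. \<Sum>i\<in>K. \<Phi> Y i j * (\<Sum>m\<in>K. D0 i m * \<Phi> Y m j))"
    by (subst sum.swap) (simp add: mat_mult_on_def mult.commute)
  also have "\<dots> \<ge> 0" by (intro sum_nonneg D0_nonneg)
  finally show ?thesis .
qed

end

section \<open>The C*-seminorm of a bounded positive functional\<close>

text \<open>The last assumption bounds left multiplication by each \<open>f\<close> on the GNS
  space. Null vectors are kept: all estimates use the semi-inner product on the algebra
  itself.\<close>

locale bounded_positive_functional =
  fixes \<phi> :: "'a::star_algebra \<Rightarrow> complex"
  assumes linear: "clinear \<phi>"
    and positive: "\<phi> (star a * a) \<in> \<real>\<^sub>\<ge>\<^sub>0"
    and bounded: "\<exists>C. \<forall>g. Re (\<phi> (star (f * g) * (f * g))) \<le> C * Re (\<phi> (star g * g))"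
begin

definition ip :: "'a \<Rightarrow> 'a \<Rightarrow> complex" where "ip a b = \<phi> (star a * b)"

definition nrm :: "'a \<Rightarrow> real" where "nrm a = sqrt (Re (ip a a))"

lemma ip_add_left: "ip (a + b) c = ip a c + ip b c"
  and ip_add_right: "ip c (a + b) = ip c a + ip c b"
  and ip_scaleC_left: "ip (z *\<^sub>C a) b = cnj z * ip a b"
  and ip_scaleC_right: "ip a (z *\<^sub>C b) = z * ip a b"
proof -
  have "\<phi> (x + y) = \<phi> x + \<phi> y" "\<phi> (z *\<^sub>C x) = z * \<phi> x" for x y z
    using linear by (auto simp: clinear_def scaleC_complex_def)
  then show "ip (a + b) c = ip a c + ip b c" "ip c (a + b) = ip c a + ip c b"
    "ip (z *\<^sub>C a) b = cnj z * ip a b" "ip a (z *\<^sub>C b) = z * ip a b"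
    by (simp_all add: ip_def star_add star_scaleC distrib_left distrib_right
      mult_scaleC_left mult_scaleC_right)
qed

lemma ip_mult_left: "ip (f * a) b = ip a (star f * b)"
  by (simp add: ip_def star_mult mult.assoc)

lemma ip_self_real: "ip a a = complex_of_real (Re (ip a a))"
  and ip_self_nonneg: "0 \<le> Re (ip a a)"
proof -
  obtain r where "ip a a = complex_of_real r" "0 \<le> r"
    using positive[of a] unfolding ip_def by (auto elim: nonneg_Reals_cases)
  then show "ip a a = complex_of_real (Re (ip a a))" "0 \<le> Re (ip a a)" by simp_all
qed

lemma Im_ip_self: "Im (ip a a) = 0"
  by (subst ip_self_real) simp

lemma nrm_nonneg [simp]: "0 \<le> nrm a"
  by (simp add: nrm_def ip_self_nonneg)

lemma nrm_power2: "(nrm a)\<^sup>2 = Re (ip a a)"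
  by (simp add: nrm_def ip_self_nonneg)

text \<open>Hermitian symmetry comes from positivity alone: the form is real at \<open>a + b\<close>
  and at \<open>a + \<i> *\<^sub>C b\<close>, which fixes the imaginary and the real part.\<close>

lemma ip_cnj: "ip b a = cnj (ip a b)"
proof -
  have "Im (ip (a + b) (a + b)) = Im (ip a b) + Im (ip b a)"
    by (simp add: ip_add_left ip_add_right Im_ip_self)
  moreover have "Im (ip (a + \<i> *\<^sub>C b) (a + \<i> *\<^sub>C b)) = Re (ip a b) - Re (ip b a)"
    by (simp add: ip_add_left ip_add_right ip_scaleC_left ip_scaleC_right Im_ip_self)
  ultimately show ?thesis
    by (simp add: Im_ip_self complex_eq_iff)
qed

lemma cauchy_schwarz: "cmod (ip a b) \<le> nrm a * nrm b"
proof -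
  define z where "z = ip a b"
  have ineq: "0 \<le> Re (ip a a) + 2 * Re (c * z) + (cmod c)\<^sup>2 * Re (ip b b)" for c
  proof -
    have "ip (a + c *\<^sub>C b) (a + c *\<^sub>C b) = ip a a + (c * z + cnj (c * z)) + (c * cnj c) * ip b b"
      by (simp add: ip_add_left ip_add_right ip_scaleC_left ip_scaleC_right ip_cnj[of b a] z_def algebra_simps)
    also have "\<dots> = ip a a + (c * z + cnj (c * z)) + complex_of_real ((cmod c)\<^sup>2) * ip b b"
      by (simp only: complex_norm_square)
    finally have "Re (ip (a + c *\<^sub>C b) (a + c *\<^sub>C b)) =
        Re (ip a a) + 2 * Re (c * z) + (cmod c)\<^sup>2 * Re (ip b b)" by simp
    then show ?thesis by (metis ip_self_nonneg)
  qed
  have cz: "Re (complex_of_real r * cnj z * z) = r * (cmod z)\<^sup>2" for r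
    by (subst mult.assoc, subst mult.commute[of "cnj z"], subst complex_norm_square[symmetric]) simp
  have "(cmod z)\<^sup>2 \<le> Re (ip a a) * Re (ip b b)"
  proof (cases "Re (ip b b) = 0")
    case True
    have "(cmod z)\<^sup>2 = 0"
    proof (rule ccontr)
      assume nz: "(cmod z)\<^sup>2 \<noteq> 0"
      \<comment> \<open>If \<open>b\<close> is a null vector, the bound \<open>ineq\<close> is
        affine in r; this value makes it negative unless z = 0.\<close>
      define r where "r = - (Re (ip a a) + 1) / (cmod z)\<^sup>2"
      have "0 \<le> Re (ip a a) + 2 * (r * (cmod z)\<^sup>2)"
        using ineq[of "complex_of_real r * cnj z"] cz[of r] True by simp
      also have "r * (cmod z)\<^sup>2 = - (Re (ip a a) + 1)"
        using nz by (simp add: r_def)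
      finally show False using ip_self_nonneg[of a] by simp
    qed
    with True show ?thesis by simp
  next
    case False
    then have pos: "Re (ip b b) > 0" using ip_self_nonneg[of b] by simp
    \<comment> \<open>The minimiser of the quadratic polynomial in r given by
      \<open>ineq\<close>.\<close>
    define r where "r = - 1 / Re (ip b b)"
    have "0 \<le> Re (ip a a) + 2 * (r * (cmod z)\<^sup>2) + r\<^sup>2 * (cmod z)\<^sup>2 * Re (ip b b)"
      using ineq[of "complex_of_real r * cnj z"] cz[of r] by (simp add: norm_mult power_mult_distrib)
    also have "\<dots> = Re (ip a a) - (cmod z)\<^sup>2 / Re (ip b b)"
      using pos by (simp add: r_def power2_eq_square field_simps)
    finally show ?thesis using pos by (simp add: field_simps)
  qed
  then have "(cmod z)\<^sup>2 \<le> (nrm a * nrm b)\<^sup>2"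
    by (simp add: power_mult_distrib nrm_power2)
  then show ?thesis unfolding z_def by (rule power2_le_imp_le) simp
qed

lemma nrm_triangle: "nrm (a + b) \<le> nrm a + nrm b"
proof -
  have "(nrm (a + b))\<^sup>2 = (nrm a)\<^sup>2 + 2 * Re (ip a b) + (nrm b)\<^sup>2"
    by (simp add: nrm_power2 ip_add_left ip_add_right ip_cnj[of b a])
  also have "\<dots> \<le> (nrm a + nrm b)\<^sup>2"
    using cauchy_schwarz[of a b] complex_Re_le_cmod[of "ip a b"] by (simp add: power2_sum)
  finally show ?thesis by (rule power2_le_imp_le) simp
qed

lemma nrm_scaleC: "nrm (c *\<^sub>C a) = cmod c * nrm a"
proof -
  have "ip (c *\<^sub>C a) (c *\<^sub>C a) = c * cnj c * ip a a"
    by (simp add: ip_scaleC_left ip_scaleC_right)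
  also have "\<dots> = complex_of_real ((cmod c)\<^sup>2) * ip a a"
    by (simp only: complex_norm_square)
  finally show ?thesis by (simp add: nrm_def real_sqrt_mult)
qed

text \<open>The norm of \<open>f\<close> in the GNS representation, written as the least bound so
  that null vectors \<open>g\<close> need no separate treatment.\<close>

definition opnorm :: "'a \<Rightarrow> real" where
  "opnorm f = Inf {C. 0 \<le> C \<and> (\<forall>g. nrm (f * g) \<le> C * nrm g)}"

lemma bounds_nonempty: "{C. 0 \<le> C \<and> (\<forall>g. nrm (f * g) \<le> C * nrm g)} \<noteq> {}"
proof -
  obtain C where C: "\<And>g. Re (\<phi> (star (f * g) * (f * g))) \<le> C * Re (\<phi> (star g * g))"
    using bounded by blast
  have "nrm (f * g) \<le> sqrt \<bar>C\<bar> * nrm g" for g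
  proof -
    have "Re (ip (f * g) (f * g)) \<le> \<bar>C\<bar> * Re (ip g g)"
      using C[of g] mult_right_mono[OF abs_ge_self[of C] ip_self_nonneg[of g]] by (simp add: ip_def)
    then show ?thesis by (simp add: nrm_def flip: real_sqrt_mult)
  qed
  then have "sqrt \<bar>C\<bar> \<in> {C. 0 \<le> C \<and> (\<forall>g. nrm (f * g) \<le> C * nrm g)}" by simp
  then show ?thesis by blast
qed

lemma opnorm_le: "0 \<le> C \<Longrightarrow> (\<And>g. nrm (f * g) \<le> C * nrm g) \<Longrightarrow> opnorm f \<le> C"
  unfolding opnorm_def by (intro cInf_lower bdd_belowI[of _ 0]) auto

lemma opnorm_nonneg [simp]: "0 \<le> opnorm f"
  unfolding opnorm_def using bounds_nonempty by (intro cInf_greatest) auto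

lemma nrm_mult_le: "nrm (f * g) \<le> opnorm f * nrm g"
proof (cases "nrm g = 0")
  case True
  from bounds_nonempty[of f] obtain C where "\<And>g. nrm (f * g) \<le> C * nrm g" by blast
  from this[of g] True show ?thesis by simp
next
  case False
  then have g: "nrm g > 0" using nrm_nonneg[of g] by linarith
  have "nrm (f * g) / nrm g \<le> opnorm f"
    unfolding opnorm_def using bounds_nonempty g by (intro cInf_greatest) (auto simp: field_simps)
  with g show ?thesis by (simp add: field_simps)
qed

lemma opnorm_mult: "opnorm (f * g) \<le> opnorm f * opnorm g"
proof (rule opnorm_le)
  fix a
  have "nrm (f * (g * a)) \<le> opnorm f * (opnorm g * nrm a)"
    by (rule order_trans[OF nrm_mult_le mult_left_mono[OF nrm_mult_le]]) simp
  then show "nrm (f * g * a) \<le> opnorm f * opnorm g * nrm a" by (simp add: mult.assoc)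
qed simp

lemma opnorm_add: "opnorm (f + g) \<le> opnorm f + opnorm g"
proof (rule opnorm_le)
  fix a
  have "nrm (f * a + g * a) \<le> opnorm f * nrm a + opnorm g * nrm a"
    by (rule order_trans[OF nrm_triangle add_mono[OF nrm_mult_le nrm_mult_le]])
  then show "nrm ((f + g) * a) \<le> (opnorm f + opnorm g) * nrm a" by (simp add: distrib_right)
qed simp

lemma opnorm_scaleC_le: "opnorm (c *\<^sub>C f) \<le> cmod c * opnorm f"
proof (rule opnorm_le)
  fix a
  show "nrm ((c *\<^sub>C f) * a) \<le> cmod c * opnorm f * nrm a"
    by (simp add: mult_scaleC_left nrm_scaleC mult.assoc mult_left_mono nrm_mult_le)
qed simp

lemma opnorm_scaleC: "opnorm (c *\<^sub>C f) = cmod c * opnorm f"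
proof (cases "c = 0")
  case True
  then have "opnorm (c *\<^sub>C f) \<le> 0" using opnorm_scaleC_le[of c f] by simp
  then have "opnorm (c *\<^sub>C f) = 0" using opnorm_nonneg by (rule antisym)
  with True show ?thesis by simp
next
  case False
  have "opnorm f \<le> cmod (inverse c) * opnorm (c *\<^sub>C f)"
    using opnorm_scaleC_le[of "inverse c" "c *\<^sub>C f"] False by (simp add: scaleC_scaleC scaleC_one)
  then have "cmod c * opnorm f \<le> opnorm (c *\<^sub>C f)"
    using False by (simp add: norm_divide field_simps)
  then show ?thesis using opnorm_scaleC_le[of c f] by simp
qed

text \<open>The nontrivial half of the C*-identity: Cauchy-Schwarz applied to \<open>g\<close> and
  \<open>star f * f * g\<close>.\<close>

lemma opnorm_power2_le: "(opnorm f)\<^sup>2 \<le> opnorm (star f * f)"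
proof -
  have "opnorm f \<le> sqrt (opnorm (star f * f))"
  proof (rule opnorm_le)
    fix g
    have "(nrm (f * g))\<^sup>2 = Re (ip g (star f * f * g))"
      by (simp add: nrm_power2 ip_mult_left mult.assoc)
    also have "\<dots> \<le> nrm g * nrm (star f * f * g)"
      using cauchy_schwarz complex_Re_le_cmod order_trans by blast
    also have "\<dots> \<le> nrm g * (opnorm (star f * f) * nrm g)"
      by (intro mult_left_mono nrm_mult_le) simp
    also have "\<dots> = (sqrt (opnorm (star f * f)) * nrm g)\<^sup>2"
      by (simp add: power_mult_distrib power2_eq_square mult_ac)
    finally show "nrm (f * g) \<le> sqrt (opnorm (star f * f)) * nrm g"
      by (rule power2_le_imp_le) simp
  qed simp
  from power_mono[OF this opnorm_nonneg, of 2] show ?thesis by simp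
qed

lemma opnorm_star_le: "opnorm f \<le> opnorm (star f)"
proof (cases "opnorm f = 0")
  case False
  have "opnorm f * opnorm f \<le> opnorm (star f) * opnorm f"
    using opnorm_power2_le[of f] opnorm_mult[of "star f" f] by (simp add: power2_eq_square)
  then show ?thesis using False opnorm_nonneg[of f] by (simp add: mult_le_cancel_right)
qed simp

theorem cstar_seminorm_opnorm: "cstar_seminorm_on S opnorm"
proof -
  have "opnorm (star f * f) = (opnorm f)\<^sup>2" for f
  proof (rule antisym)
    have "opnorm (star f) = opnorm f"
      using opnorm_star_le[of f] opnorm_star_le[of "star f"] by (simp add: star_star)
    then show "opnorm (star f * f) \<le> (opnorm f)\<^sup>2"
      using opnorm_mult[of "star f" f] by (simp add: power2_eq_square)
  qed (rule opnorm_power2_le)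
  then show ?thesis
    by (simp add: cstar_seminorm_on_def opnorm_add opnorm_mult opnorm_scaleC)
qed

text \<open>The unit is the cyclic vector: \<open>\<phi> f\<close> equals
  \<open>ip 1 f\<close>.\<close>

lemma functional_eq_zero:
  assumes "opnorm f = 0"
  shows "\<phi> f = 0"
proof -
  have "nrm f = 0" using nrm_mult_le[of f 1] nrm_nonneg[of f] assms by simp
  then show ?thesis using cauchy_schwarz[of 1 f] by (simp add: ip_def)
qed

lemma opnorm_eq_zero:
  assumes "\<And>g. \<phi> (star (f * g) * (f * g)) = 0"
  shows "opnorm f = 0"
proof -
  have "opnorm f \<le> 0"
    by (rule opnorm_le) (simp_all add: nrm_def ip_def assms)
  then show ?thesis using opnorm_nonneg[of f] by linarith
qed

end

section \<open>Spaces of Temperley-Lieb vectors\<close>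

definition words :: "nat \<Rightarrow> nat \<Rightarrow> nat list set" where
  "words n l = {x. set x \<subseteq> {1..n} \<and> length x = l}"

text \<open>The test for the range \<open>{1..n}\<close> keeps supports inside
  \<open>words n\<close>, so that \<open>cup\<close> is adjoint to the contraction
  \<open>cap\<close>, whose sum runs over these letters.\<close>

definition cup :: "nat \<Rightarrow> nat \<Rightarrow> (nat list \<Rightarrow> real) \<Rightarrow> nat list \<Rightarrow> real" where
  "cup n t \<xi> x =
    (if t + 2 \<le> length x \<and> x ! t = x ! Suc t \<and> x ! t \<in> {1..n} then \<xi> (take t x @ drop (t + 2) x) else 0)"

definition cap :: "nat \<Rightarrow> nat \<Rightarrow> (nat list \<Rightarrow> real) \<Rightarrow> nat list \<Rightarrow> real" where
  "cap n t \<xi> x = (if t \<le> length x then \<Sum>a=1..n. \<xi> (take t x @ a # a # drop t x) else 0)"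

text \<open>Vectors of the \<open>l\<close>-th tensor power of \<open>\<real>\<^sup>n\<close> are functions on words of length \<open>l\<close>. Every non-crossing
  pairing arises from the empty one by inserting adjacent pairs, hence this span description.\<close>

inductive TL :: "nat \<Rightarrow> nat \<Rightarrow> (nat list \<Rightarrow> real) \<Rightarrow> bool" for n where
  unit: "TL n 0 (\<lambda>x. of_bool (x = []))"
| zero: "TL n l (\<lambda>_. 0)"
| add: "TL n l \<xi> \<Longrightarrow> TL n l \<eta> \<Longrightarrow> TL n l (\<lambda>x. \<xi> x + \<eta> x)"
| scale: "TL n l \<xi> \<Longrightarrow> TL n l (\<lambda>x. c * \<xi> x)"
| cup: "TL n l \<xi> \<Longrightarrow> t \<le> l \<Longrightarrow> TL n (Suc (Suc l)) (cup n t \<xi>)"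

lemma finite_words [simp]: "finite (words n l)"
  unfolding words_def by (rule finite_lists_length_eq) simp

lemma words_0 [simp]: "words n 0 = {[]}"
  by (auto simp: words_def)

lemma rev_words_iff [simp]: "rev x \<in> words n l \<longleftrightarrow> x \<in> words n l"
  by (simp add: words_def)

lemma sum_words_rev: "(\<Sum>x\<in>words n l. f (rev x)) = (\<Sum>x\<in>words n l. f x)"
  by (rule sum.reindex_bij_witness[of _ rev rev]) auto

lemma sum_words_insert:
  assumes "t \<le> l"
  shows "(\<Sum>x\<in>words n (Suc l). f x) = (\<Sum>x\<in>words n l. \<Sum>a=1..n. f (take t x @ a # drop t x))"
proof -
  have "(\<Sum>x\<in>words n l. \<Sum>a=1..n. f (take t x @ a # drop t x)) =
      (\<Sum>(x, a)\<in>words n l \<times> {1..n}. f (take t x @ a # drop t x))"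
    by (simp add: sum.cartesian_product)
  also have "\<dots> = (\<Sum>x\<in>words n (Suc l). f x)"
  proof (rule sum.reindex_bij_witness[of _ "\<lambda>x. (take t x @ drop (Suc t) x, x ! t)"
        "\<lambda>(x, a). take t x @ a # drop t x"])
    fix x assume "x \<in> words n (Suc l)"
    then have x: "length x = Suc l" "set x \<subseteq> {1..n}" by (auto simp: words_def)
    then show "(case (take t x @ drop (Suc t) x, x ! t) of (x, a) \<Rightarrow> take t x @ a # drop t x) = x"
      using assms by (simp add: id_take_nth_drop[symmetric])
    show "(take t x @ drop (Suc t) x, x ! t) \<in> words n l \<times> {1..n}"
      using x assms set_take_subset[of t x] set_drop_subset[of "Suc t" x] subsetD[OF x(2) nth_mem[of t x]]
      by (auto simp: words_def)
  next
    fix xa assume "xa \<in> words n l \<times> {1..n}"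
    then obtain x a where xa: "xa = (x, a)" "set x \<subseteq> {1..n}" "length x = l" "a \<in> {1..n}"
      by (auto simp: words_def)
    then show "(\<lambda>x. (take t x @ drop (Suc t) x, x ! t)) (case xa of (x, a) \<Rightarrow> take t x @ a # drop t x) = xa"
      using assms by (auto simp: nth_append)
    show "(case xa of (x, a) \<Rightarrow> take t x @ a # drop t x) \<in> words n (Suc l)"
      using xa assms set_take_subset[of t x] set_drop_subset[of t x] by (auto simp: words_def)
  qed auto
  finally show ?thesis by simp
qed

lemma sum_words_snoc: "(\<Sum>x\<in>words n (Suc l). f x) = (\<Sum>x\<in>words n l. \<Sum>a=1..n. f (x @ [a]))"
proof -
  have "take l x = x" "drop l x = []" if "x \<in> words n l" for x using that by (auto simp: words_def)
  then show ?thesis by (subst sum_words_insert[of l]) simp_all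
qed

lemma cup_short: "length x < t + 2 \<Longrightarrow> cup n t \<xi> x = 0"
  by (simp add: cup_def)

lemma cup_append:
  "length u = t \<Longrightarrow> cup n t \<xi> (u @ a # b # v) = (if a = b \<and> a \<in> {1..n} then \<xi> (u @ v) else 0)"
  by (auto simp: cup_def nth_append)

lemma cap_short: "length x < t \<Longrightarrow> cap n t \<xi> x = 0"
  by (simp add: cap_def)

lemma cap_append: "length u = t \<Longrightarrow> cap n t \<xi> (u @ v) = (\<Sum>a=1..n. \<xi> (u @ a # a # v))"
  by (simp add: cap_def)

lemma length_ge_append:
  assumes "t \<le> length x"
  obtains u v where "x = u @ v" "length u = t"
  using assms by (metis append_take_drop_id length_take min.absorb2)

lemma length_ge_append2:
  assumes "t + 2 \<le> length x"
  obtains u a b v where "x = u @ a # b # v" "length u = t"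
proof -
  obtain u w where "x = u @ w" "length u = t"
    using assms by (elim length_ge_append[of t x, rotated]) simp_all
  moreover from this assms obtain a b v where "w = a # b # v"
    by (cases w; cases "tl w") auto
  ultimately show thesis using that by blast
qed

lemma cup_cases:
  obtains (short) "length x < t + 2" | (append) u a b v where "x = u @ a # b # v" "length u = t"
  by (meson length_ge_append2 not_le_imp_less)

lemma cap_cases:
  obtains (short) "length x < t" | (append) u v where "x = u @ v" "length u = t"
  by (meson length_ge_append not_le_imp_less)

lemma TL_support: "TL n l \<xi> \<Longrightarrow> \<xi> x \<noteq> 0 \<Longrightarrow> x \<in> words n l"
proof (induction arbitrary: x rule: TL.induct)
  case (add l \<xi> \<eta>)
  then show ?case by (metis add_0)
next
  case (cup l \<xi> t)
  show ?case
  proof (cases x t rule: cup_cases)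
    case (append u a b v)
    then have "a = b" "a \<in> {1..n}" "\<xi> (u @ v) \<noteq> 0"
      using cup.prems by (auto simp: cup_append split: if_splits)
    with cup.IH[of "u @ v"] append show ?thesis by (auto simp: words_def)
  qed (use cup.prems in \<open>simp add: cup_short\<close>)
qed (auto split: if_splits)

lemma TL_length: "TL n l \<xi> \<Longrightarrow> length x \<noteq> l \<Longrightarrow> \<xi> x = 0"
  using TL_support by (fastforce simp: words_def)

lemma TL_sum: "finite A \<Longrightarrow> (\<And>a. a \<in> A \<Longrightarrow> TL n l (f a)) \<Longrightarrow> TL n l (\<lambda>x. \<Sum>a\<in>A. f a x)"
  by (induction A rule: finite_induct) (auto intro: TL.zero TL.add)

lemma TL_odd: "TL n l \<xi> \<Longrightarrow> odd l \<Longrightarrow> \<xi> x = 0"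
proof (induction arbitrary: x rule: TL.induct)
  case (cup l \<xi> t)
  then show ?case by (cases x t rule: cup_cases) (auto simp: cup_short cup_append)
qed auto

section \<open>Temperley-Lieb relations between cups and caps\<close>

lemma cap_cup_same: "TL n l \<xi> \<Longrightarrow> t \<le> l \<Longrightarrow> cap n t (cup n t \<xi>) x = real n * \<xi> x"
  by (cases x t rule: cap_cases) (auto simp: cap_short cap_append cup_append TL_length)

text \<open>A cup and a cap sharing exactly one leg form a zigzag, which straightens to the
  identity; the next lemma is its mirror image.\<close>

lemma cap_cup_Suc:
  assumes "TL n l \<xi>" "Suc t \<le> l"
  shows "cap n t (cup n (Suc t) \<xi>) x = \<xi> x"
proof (cases x t rule: cap_cases)
  case (append u v)
  show ?thesis
  proof (cases v)
    case Nil
    with append assms show ?thesis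
      by (simp add: cap_append[of u t n _ "[]", simplified] cup_short TL_length)
  next
    case (Cons b v')
    have "cup n (Suc t) \<xi> (u @ a # a # b # v') = (if a = b \<and> a \<in> {1..n} then \<xi> (u @ a # v') else 0)" for a
      using cup_append[of "u @ [a]" "Suc t" n \<xi> a b v'] append by simp
    moreover have "b \<notin> {1..n} \<Longrightarrow> \<xi> (u @ b # v') = 0"
      using TL_support[OF assms(1), of "u @ b # v'"] by (auto simp: words_def)
    ultimately show ?thesis
      using append Cons by (auto simp: cap_append sum.If_cases Int_def conj_commute cong: conj_cong)
  qed
qed (use assms in \<open>simp add: cap_short TL_length\<close>)

lemma cap_Suc_cup:
  assumes "TL n l \<xi>" "Suc t \<le> l"
  shows "cap n (Suc t) (cup n t \<xi>) x = \<xi> x"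
proof (cases x "Suc t" rule: cap_cases)
  case (append u v)
  then obtain u' b where u: "u = u' @ [b]" "length u' = t"
    by (metis length_Suc_conv_rev)
  have "cup n t \<xi> (u @ a # a # v) = (if a = b \<and> a \<in> {1..n} then \<xi> (u' @ a # v) else 0)" for a
    using cup_append[of u' t n \<xi> b a "a # v"] u by auto
  moreover have "b \<notin> {1..n} \<Longrightarrow> \<xi> (u' @ b # v) = 0"
    using TL_support[OF assms(1), of "u' @ b # v"] by (auto simp: words_def)
  ultimately show ?thesis
    using append u cap_append[of u "Suc t" n "cup n t \<xi>" v]
    by (auto simp: sum.If_cases Int_def conj_commute cong: conj_cong)
qed (use assms in \<open>simp add: cap_short TL_length\<close>)

lemma cap_cup_right: "t \<le> s \<Longrightarrow> cap n t (cup n (Suc (Suc s)) \<xi>) x = cup n s (cap n t \<xi>) x"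
proof (cases x s rule: cup_cases)
  case short
  then show ?thesis
    by (cases x t rule: cap_cases) (auto simp: cup_short cap_short cap_append)
next
  case (append u a b v)
  assume "t \<le> s"
  with append obtain w z where u: "u = w @ z" "length w = t"
    by (metis length_ge_append)
  have "cup n (Suc (Suc s)) \<xi> (w @ c # c # z @ a # b # v) =
      (if a = b \<and> a \<in> {1..n} then \<xi> (w @ c # c # z @ v) else 0)" for c
    using cup_append[of "w @ c # c # z" "Suc (Suc s)" n \<xi> a b v] append u by simp
  moreover have "cap n t \<xi> (w @ z @ v) = (\<Sum>c=1..n. \<xi> (w @ c # c # z @ v))"
    and "cap n t (cup n (Suc (Suc s)) \<xi>) (w @ z @ a # b # v) =
      (\<Sum>c=1..n. cup n (Suc (Suc s)) \<xi> (w @ c # c # z @ a # b # v))"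
    using u by (simp_all add: cap_append)
  ultimately show ?thesis
    using append u cup_append[of "w @ z" s n "cap n t \<xi>" a b v]
    by (cases "a = b \<and> a \<in> {1..n}") (auto intro!: sum.neutral)
qed

lemma cap_cup_left: "s \<le> t \<Longrightarrow> cap n (Suc (Suc t)) (cup n s \<xi>) x = cup n s (cap n t \<xi>) x"
proof (cases x s rule: cup_cases)
  case short
  assume "s \<le> t"
  with short show ?thesis by (simp add: cup_short cap_short)
next
  case (append u a b v)
  assume "s \<le> t"
  show ?thesis
  proof (cases "t - s \<le> length v")
    case True
    then obtain w z where v: "v = w @ z" "length w = t - s"
      by (metis length_ge_append)
    have "cap n (Suc (Suc t)) (cup n s \<xi>) ((u @ a # b # w) @ z) =
        (\<Sum>c=1..n. cup n s \<xi> (u @ a # b # w @ c # c # z))"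
      using \<open>s \<le> t\<close> append v by (subst cap_append) simp_all
    moreover have "cap n t \<xi> ((u @ w) @ z) = (\<Sum>c=1..n. \<xi> (u @ w @ c # c # z))"
      using \<open>s \<le> t\<close> append v by (subst cap_append) simp_all
    ultimately show ?thesis using append v
      by (cases "a = b \<and> a \<in> {1..n}") (auto simp: cup_append intro!: sum.neutral)
  next
    case False
    then show ?thesis using append by (simp add: cap_short cup_append)
  qed
qed

text \<open>Against the last inserted cup, a cap closes a loop (both legs shared), straightens a
  zigzag (one leg shared) or slides past it (disjoint legs). Only the last case needs the induction
  hypothesis.\<close>

lemma TL_cap: "TL n l \<xi> \<Longrightarrow> l = Suc (Suc m) \<Longrightarrow> t \<le> m \<Longrightarrow> TL n m (cap n t \<xi>)"
proof (induction arbitrary: m t rule: TL.induct)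
  case (zero l)
  have "cap n t (\<lambda>_. 0) = (\<lambda>_. 0)" by (auto simp: cap_def)
  then show ?case by (simp add: TL.zero)
next
  case (add l \<xi> \<eta>)
  have "cap n t (\<lambda>x. \<xi> x + \<eta> x) = (\<lambda>x. cap n t \<xi> x + cap n t \<eta> x)"
    by (auto simp: cap_def sum.distrib)
  with add show ?case by (simp add: TL.add)
next
  case (scale l \<xi> c)
  have "cap n t (\<lambda>x. c * \<xi> x) = (\<lambda>x. c * cap n t \<xi> x)"
    by (auto simp: cap_def sum_distrib_left)
  with scale show ?case by (simp add: TL.scale)
next
  case (cup l \<xi> s)
  then have l: "l = m" by simp
  consider "s = t" | "s = Suc t" | "t = Suc s" | s' where "s = Suc (Suc s')" "t \<le> s'"
    | t' where "t = Suc (Suc t')" "s \<le> t'"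
  proof -
    have "s = t \<or> s = Suc t \<or> t = Suc s \<or> s = Suc (Suc (s - 2)) \<and> t \<le> s - 2 \<or>
        t = Suc (Suc (t - 2)) \<and> s \<le> t - 2"
      by arith
    then show thesis using that by blast
  qed
  then show ?case
  proof cases
    case 1
    have "cap n t (cup n s \<xi>) = (\<lambda>x. real n * \<xi> x)"
      using cap_cup_same[OF cup.hyps(1)] cup.hyps(2) 1 by blast
    then show ?thesis using cup.hyps(1) l by (simp add: TL.scale)
  next
    case 2
    have "cap n t (cup n s \<xi>) = \<xi>"
      using cap_cup_Suc[OF cup.hyps(1)] cup.hyps(2) 2 by blast
    then show ?thesis using cup.hyps(1) l by simp
  next
    case 3
    have "cap n t (cup n s \<xi>) = \<xi>"
      using cap_Suc_cup[OF cup.hyps(1)] cup.prems 3 l by blast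
    then show ?thesis using cup.hyps(1) l by simp
  next
    case (4 s')
    then obtain m' where m': "l = Suc (Suc m')" "s' \<le> m'"
      using cup.hyps(2) by (metis Suc_le_D Suc_le_mono)
    have "cap n t (cup n s \<xi>) = cup n s' (cap n t \<xi>)"
      using cap_cup_right 4 by blast
    moreover have "TL n m' (cap n t \<xi>)" using cup.IH[OF m'(1)] 4 m' by simp
    ultimately show ?thesis using m' l TL.cup[of n m' "cap n t \<xi>" s'] by simp
  next
    case (5 t')
    then obtain m' where m': "l = Suc (Suc m')" "t' \<le> m'"
      using cup.prems(2) l by (metis Suc_le_D Suc_le_mono)
    have "cap n t (cup n s \<xi>) = cup n s (cap n t' \<xi>)"
      using cap_cup_left 5 by blast
    moreover have "TL n m' (cap n t' \<xi>)" using cup.IH[OF m'(1)] m' by simp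
    ultimately show ?thesis using m' l 5 TL.cup[of n m' "cap n t' \<xi>" s] by simp
  qed
qed simp

section \<open>Tensor products, reflection and composition of Temperley-Lieb vectors\<close>

lemma TL_tensor: "TL n m \<eta> \<Longrightarrow> TL n l \<xi> \<Longrightarrow> TL n (l + m) (\<lambda>x. \<xi> (take l x) * \<eta> (drop l x))"
proof (induction rule: TL.induct)
  case unit
  have "(\<lambda>x. \<xi> (take l x) * of_bool (drop l x = [])) = \<xi>"
    using TL_length[OF unit] by (auto simp: fun_eq_iff)
  then show ?case using unit by simp
next
  case (add m \<eta> \<eta>')
  then show ?case by (simp add: distrib_left TL.add)
next
  case (scale m \<eta> c)
  then have "TL n (l + m) (\<lambda>x. c * (\<xi> (take l x) * \<eta> (drop l x)))" by (simp add: TL.scale)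
  then show ?case by (simp add: mult_ac)
next
  case (cup m \<eta> t)
  have "(\<lambda>x. \<xi> (take l x) * cup n t \<eta> (drop l x)) = cup n (l + t) (\<lambda>x. \<xi> (take l x) * \<eta> (drop l x))"
  proof
    fix x
    show "\<xi> (take l x) * cup n t \<eta> (drop l x) = cup n (l + t) (\<lambda>x. \<xi> (take l x) * \<eta> (drop l x)) x"
    proof (cases x "l + t" rule: cup_cases)
      case short
      then show ?thesis by (simp add: cup_short)
    next
      case (append u a b v)
      then show ?thesis by (simp add: cup_append)
    qed
  qed
  with cup show ?case using TL.cup[of n "l + m" "\<lambda>x. \<xi> (take l x) * \<eta> (drop l x)" "l + t"] by simp
qed (simp add: TL.zero)

lemma TL_rev: "TL n l \<xi> \<Longrightarrow> TL n l (\<lambda>x. \<xi> (rev x))"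
proof (induction rule: TL.induct)
  case (cup l \<xi> t)
  \<comment> \<open>Of the \<open>l\<close> remaining letters \<open>t\<close> precede the inserted
    pair, so \<open>l - t\<close> precede it after reversal.\<close>
  have "(\<lambda>x. cup n t \<xi> (rev x)) = cup n (l - t) (\<lambda>x. \<xi> (rev x))"
  proof
    fix x
    show "cup n t \<xi> (rev x) = cup n (l - t) (\<lambda>x. \<xi> (rev x)) x"
    proof (cases "length x = Suc (Suc l)")
      case True
      then obtain u a b v where x: "x = u @ a # b # v" "length u = l - t"
        by (metis add_2_eq_Suc' diff_le_self length_ge_append2 not_less_eq_eq)
      with True cup.hyps have "length v = t" by simp
      with x cup_append[of "rev v" t n \<xi> b a "rev u"] show ?thesis by (auto simp: cup_append)
    next
      case False
      then show ?thesis
        using TL_length[OF TL.cup[OF cup.hyps]] TL_length[OF TL.cup[OF cup.IH diff_le_self]] by simp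
    qed
  qed
  then show ?case using TL.cup[OF cup.IH, of "l - t"] by simp
qed (auto intro: TL.intros simp: TL.unit)

text \<open>The vector of \<open>m\<close> nested pairs, built by inserting each new pair in the
  centre. Bending turns it into the identity operator, see \<open>TL_matrices_one\<close>.\<close>

lemma TL_palindrome: "TL n (2 * m) (\<lambda>x. of_bool (x \<in> words n (2 * m) \<and> rev x = x))"
proof (induction m)
  case 0
  have "(\<lambda>x. of_bool (x \<in> words n 0 \<and> rev x = x)) = (\<lambda>x. of_bool (x = []) :: real)"
    by (auto simp: fun_eq_iff)
  then show ?case using TL.unit by simp
next
  case (Suc m)
  let ?f = "\<lambda>m x. of_bool (x \<in> words n (2 * m) \<and> rev x = x) :: real"
  have "cup n m (?f m) = ?f (Suc m)"
  proof
    fix x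
    show "cup n m (?f m) x = ?f (Suc m) x"
    proof (cases "length x = Suc (Suc (2 * m))")
      case True
      then obtain u a b v where x: "x = u @ a # b # v" "length u = m"
        by (metis add_2_eq_Suc' le_add1 length_ge_append2 mult_2 not_less_eq_eq)
      with True have "length v = m" by simp
      then show ?thesis using x by (auto simp: cup_append words_def)
    next
      case False
      then show ?thesis
        using TL_length[OF TL.cup[OF Suc, of m]] by (simp add: words_def)
    qed
  qed
  then show ?case using TL.cup[OF Suc, of m] by simp
qed

text \<open>Nested contraction from the inside out: the last letter of \<open>j\<close> and the
  first of \<open>rev j\<close> are adjacent, and capping them at \<open>l + m\<close> leaves the
  same situation for a shorter \<open>j\<close>.\<close>

lemma TL_contract:
  "TL n (l + 2 * m + r) \<zeta> \<Longrightarrow>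
    \<exists>\<eta>. TL n (l + r) \<eta> \<and> (\<forall>u v. length u = l \<longrightarrow> length v = r \<longrightarrow>
      \<eta> (u @ v) = (\<Sum>j\<in>words n m. \<zeta> (u @ j @ rev j @ v)))"
proof (induction m arbitrary: \<zeta>)
  case 0
  then show ?case by auto
next
  case (Suc m)
  have "TL n (l + 2 * m + r) (cap n (l + m) \<zeta>)"
    using TL_cap[OF Suc.prems] by simp
  then obtain \<eta> where \<eta>: "TL n (l + r) \<eta>" "\<And>u v. length u = l \<Longrightarrow> length v = r \<Longrightarrow>
      \<eta> (u @ v) = (\<Sum>j\<in>words n m. cap n (l + m) \<zeta> (u @ j @ rev j @ v))"
    using Suc.IH by blast
  have "\<eta> (u @ v) = (\<Sum>j\<in>words n (Suc m). \<zeta> (u @ j @ rev j @ v))" if "length u = l" "length v = r" for u v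
  proof -
    have "cap n (l + m) \<zeta> (u @ j @ rev j @ v) = (\<Sum>a=1..n. \<zeta> (u @ (j @ [a]) @ rev (j @ [a]) @ v))"
      if "j \<in> words n m" for j
      using cap_append[of "u @ j" "l + m" n \<zeta> "rev j @ v"] that \<open>length u = l\<close>
      by (simp add: words_def)
    then show ?thesis by (simp add: \<eta>(2) that sum_words_snoc del: rev_append)
  qed
  with \<eta>(1) show ?case by blast
qed

text \<open>Composition of operators in bent form: tensor the two vectors and contract the middle
  legs. The reversal of \<open>j\<close> in the second factor is due to the bending.\<close>

lemma TL_compose:
  assumes "TL n (l + m) \<xi>" "TL n (m + r) \<eta>"
  shows "\<exists>\<zeta>. TL n (l + r) \<zeta> \<and> (\<forall>u v. length u = l \<longrightarrow> length v = r \<longrightarrow>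
      \<zeta> (u @ v) = (\<Sum>j\<in>words n m. \<xi> (u @ j) * \<eta> (rev j @ v)))"
proof -
  have "TL n (l + 2 * m + r) (\<lambda>x. \<xi> (take (l + m) x) * \<eta> (drop (l + m) x))"
    using TL_tensor[OF assms(2,1)] by (simp add: mult_2 add_ac)
  from TL_contract[OF this] obtain \<zeta> where \<zeta>: "TL n (l + r) \<zeta>"
    "\<And>u v. length u = l \<Longrightarrow> length v = r \<Longrightarrow> \<zeta> (u @ v) =
      (\<Sum>j\<in>words n m. \<xi> (take (l + m) (u @ j @ rev j @ v)) * \<eta> (drop (l + m) (u @ j @ rev j @ v)))"
    by blast
  have "\<zeta> (u @ v) = (\<Sum>j\<in>words n m. \<xi> (u @ j) * \<eta> (rev j @ v))" if "length u = l" "length v = r" for u v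
    unfolding \<zeta>(2)[OF that] using that by (intro sum.cong refl) (simp add: words_def)
  with \<zeta>(1) show ?thesis by blast
qed

text \<open>Adjointness of \<open>cup\<close> and contraction. Values in a real vector space cover
  both the real kernels of \<open>cap_proj\<close> and the products of generators in
  \<open>TL_invariant\<close>.\<close>

lemma sum_cup_scaleR:
  fixes F :: "nat list \<Rightarrow> 'b::real_vector"
  assumes "t \<le> l"
  shows "(\<Sum>x\<in>words n (Suc (Suc l)). cup n t \<xi> x *\<^sub>R F x) =
    (\<Sum>x\<in>words n l. \<xi> x *\<^sub>R (\<Sum>a=1..n. F (take t x @ a # a # drop t x)))"
proof -
  have *: "(\<Sum>b=1..n. cup n t \<xi> (u @ b # a # v) *\<^sub>R F (u @ b # a # v)) = \<xi> (u @ v) *\<^sub>R F (u @ a # a # v)"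
    if "length u = t" "a \<in> {1..n}" for u a v
  proof -
    have "(\<Sum>b=1..n. cup n t \<xi> (u @ b # a # v) *\<^sub>R F (u @ b # a # v)) =
        (\<Sum>b=1..n. if b = a then \<xi> (u @ v) *\<^sub>R F (u @ a # a # v) else 0)"
      by (intro sum.cong refl) (use that in \<open>simp add: cup_append\<close>)
    then show ?thesis using that by simp
  qed
  have "(\<Sum>x\<in>words n (Suc (Suc l)). cup n t \<xi> x *\<^sub>R F x) =
      (\<Sum>x\<in>words n l. \<Sum>a=1..n. \<Sum>b=1..n.
        cup n t \<xi> (take t x @ b # a # drop t x) *\<^sub>R F (take t x @ b # a # drop t x))"
    unfolding sum_words_insert[OF le_SucI[OF assms]] sum_words_insert[OF assms]
    using assms by (intro sum.cong refl) (simp add: words_def)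
  also have "\<dots> = (\<Sum>x\<in>words n l. \<Sum>a=1..n. \<xi> x *\<^sub>R F (take t x @ a # a # drop t x))"
    using assms * by (intro sum.cong refl) (simp add: words_def)
  finally show ?thesis by (simp add: scaleR_sum_right)
qed

lemma sum_words_append:
  "(\<Sum>x\<in>words n (l + m). f x) = (\<Sum>u\<in>words n l. \<Sum>v\<in>words n m. f (u @ v))"
proof -
  have "(\<Sum>u\<in>words n l. \<Sum>v\<in>words n m. f (u @ v)) = (\<Sum>(u, v)\<in>words n l \<times> words n m. f (u @ v))"
    by (simp add: sum.cartesian_product)
  also have "\<dots> = (\<Sum>x\<in>words n (l + m). f x)"
    by (rule sum.reindex_bij_witness[of _ "\<lambda>x. (take l x, drop l x)" "\<lambda>(u, v). u @ v"])
      (auto simp: words_def dest: in_set_takeD in_set_dropD)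
  finally show ?thesis by simp
qed

section \<open>Operators on tensor powers of bounded order\<close>

definition words_upto :: "nat \<Rightarrow> nat \<Rightarrow> nat list set" where
  "words_upto n L = (\<Union>l\<le>L. words n l)"

lemma finite_words_upto [simp]: "finite (words_upto n L)"
  by (simp add: words_upto_def)

lemma words_upto_cases:
  assumes "x \<in> words_upto n L"
  obtains l where "l \<le> L" "x \<in> words n l" "length x = l"
  using assms by (auto simp: words_upto_def words_def)

lemma sum_words_upto: "(\<Sum>x\<in>words_upto n L. f x) = (\<Sum>l\<le>L. \<Sum>x\<in>words n l. f x)"
proof -
  have "\<forall>l\<in>{..L}. \<forall>m\<in>{..L}. l \<noteq> m \<longrightarrow> words n l \<inter> words n m = {}" by (auto simp: words_def)
  then show ?thesis unfolding words_upto_def by (intro sum.UNION_disjoint) auto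
qed

lemma sum_words_upto_length:
  assumes "l \<le> L"
  shows "(\<Sum>x\<in>words_upto n L. if length x = l then f x else 0) = (\<Sum>x\<in>words n l. f x)"
proof -
  have "(\<Sum>x\<in>words_upto n L. if length x = l then f x else 0) =
      (\<Sum>x\<in>words n l. if length x = l then f x else 0)"
    by (intro sum.mono_neutral_right finite_words_upto)
      (use assms in \<open>auto simp: words_upto_def words_def\<close>)
  also have "\<dots> = (\<Sum>x\<in>words n l. f x)"
    by (rule sum.cong) (auto simp: words_def)
  finally show ?thesis .
qed

text \<open>Temperley-Lieb operators between the tensor powers of order at most \<open>L\<close>, as block matrices. Bending
  the input legs of an operator around reverses their order.\<close>

definition TL_matrices :: "nat \<Rightarrow> nat \<Rightarrow> (nat list \<Rightarrow> nat list \<Rightarrow> real) set" where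
  "TL_matrices n L = {T. \<forall>l\<le>L. \<forall>m\<le>L. \<exists>\<xi>. TL n (l + m) \<xi> \<and>
     (\<forall>i\<in>words n l. \<forall>j\<in>words n m. T i j = \<xi> (rev i @ j))}"

lemma TL_matricesI:
  assumes "\<And>l m. l \<le> L \<Longrightarrow> m \<le> L \<Longrightarrow> \<exists>\<xi>. TL n (l + m) \<xi> \<and>
     (\<forall>i\<in>words n l. \<forall>j\<in>words n m. T i j = \<xi> (rev i @ j))"
  shows "T \<in> TL_matrices n L"
  using assms by (simp add: TL_matrices_def)

lemma TL_matricesE:
  assumes "T \<in> TL_matrices n L" "l \<le> L" "m \<le> L"
  obtains \<xi> where "TL n (l + m) \<xi>"
    "\<And>i j. i \<in> words n l \<Longrightarrow> j \<in> words n m \<Longrightarrow> T i j = \<xi> (rev i @ j)"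
  using assms unfolding TL_matrices_def by blast

lemma TL_matrices_transpose:
  assumes "S \<in> TL_matrices n L"
  shows "(\<lambda>i j. S j i) \<in> TL_matrices n L"
proof (rule TL_matricesI)
  fix l m assume "l \<le> L" "m \<le> L"
  then obtain \<xi> where \<xi>: "TL n (m + l) \<xi>"
    "\<And>i j. i \<in> words n m \<Longrightarrow> j \<in> words n l \<Longrightarrow> S i j = \<xi> (rev i @ j)"
    using TL_matricesE[OF assms] by metis
  show "\<exists>\<xi>. TL n (l + m) \<xi> \<and> (\<forall>i\<in>words n l. \<forall>j\<in>words n m. S j i = \<xi> (rev i @ j))"
    using TL_rev[OF \<xi>(1)] \<xi>(2) by (intro exI[of _ "\<lambda>x. \<xi> (rev x)"]) (simp add: add.commute)
qed

lemma TL_matrices_one: "(\<lambda>i j. of_bool (i = j)) \<in> TL_matrices n L"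
proof (rule TL_matricesI)
  fix l m :: nat
  show "\<exists>\<xi>. TL n (l + m) \<xi> \<and> (\<forall>i\<in>words n l. \<forall>j\<in>words n m. of_bool (i = j) = \<xi> (rev i @ j))"
  proof (cases "l = m")
    case True
    have "rev i @ j \<in> words n (2 * l) \<and> rev (rev i @ j) = rev i @ j \<longleftrightarrow> i = j"
      if "i \<in> words n l" "j \<in> words n l" for i j
      using that by (auto simp: words_def mult_2)
    then have "\<forall>i\<in>words n l. \<forall>j\<in>words n m. of_bool (i = j) =
        (of_bool (rev i @ j \<in> words n (2 * l) \<and> rev (rev i @ j) = rev i @ j) :: real)"
      using True by simp
    then show ?thesis using TL_palindrome[of n l] True
      by (intro exI[of _ "\<lambda>x. of_bool (x \<in> words n (2 * l) \<and> rev x = x)"]) (simp add: mult_2)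
  next
    case False
    then show ?thesis by (intro exI[of _ "\<lambda>_. 0"]) (auto simp: TL.zero words_def)
  qed
qed

lemma TL_matrices_mult:
  assumes "S \<in> TL_matrices n L" "T \<in> TL_matrices n L"
  shows "mat_mult_on (words_upto n L) S T \<in> TL_matrices n L"
proof (rule TL_matricesI)
  fix l m assume lm: "l \<le> L" "m \<le> L"
  have "\<exists>\<zeta>. TL n (l + m) \<zeta> \<and> (\<forall>i\<in>words n l. \<forall>j\<in>words n m.
      \<zeta> (rev i @ j) = (\<Sum>k\<in>words n r. S i k * T k j))" if r: "r \<le> L" for r
  proof -
    obtain \<xi> where \<xi>: "TL n (l + r) \<xi>"
      "\<And>i j. i \<in> words n l \<Longrightarrow> j \<in> words n r \<Longrightarrow> S i j = \<xi> (rev i @ j)"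
      using TL_matricesE[OF assms(1) lm(1) r] by metis
    obtain \<eta> where \<eta>: "TL n (r + m) \<eta>"
      "\<And>i j. i \<in> words n r \<Longrightarrow> j \<in> words n m \<Longrightarrow> T i j = \<eta> (rev i @ j)"
      using TL_matricesE[OF assms(2) r lm(2)] by metis
    obtain \<zeta> where \<zeta>: "TL n (l + m) \<zeta>" "\<And>u v. length u = l \<Longrightarrow> length v = m \<Longrightarrow>
      \<zeta> (u @ v) = (\<Sum>k\<in>words n r. \<xi> (u @ k) * \<eta> (rev k @ v))"
      using TL_compose[OF \<xi>(1) \<eta>(1)] by blast
    have "\<zeta> (rev i @ j) = (\<Sum>k\<in>words n r. S i k * T k j)" if "i \<in> words n l" "j \<in> words n m" for i j
      using that by (subst \<zeta>(2)) (auto simp: \<xi>(2) \<eta>(2), auto simp: words_def)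
    with \<zeta>(1) show ?thesis by blast
  qed
  then have "\<forall>r. \<exists>\<zeta>. r \<le> L \<longrightarrow> TL n (l + m) \<zeta> \<and> (\<forall>i\<in>words n l. \<forall>j\<in>words n m.
      \<zeta> (rev i @ j) = (\<Sum>k\<in>words n r. S i k * T k j))" by blast
  then obtain \<zeta> where \<zeta>: "\<And>r. r \<le> L \<Longrightarrow> TL n (l + m) (\<zeta> r)"
    "\<And>r i j. r \<le> L \<Longrightarrow> i \<in> words n l \<Longrightarrow> j \<in> words n m \<Longrightarrow>
      \<zeta> r (rev i @ j) = (\<Sum>k\<in>words n r. S i k * T k j)" by metis
  show "\<exists>\<xi>. TL n (l + m) \<xi> \<and>
      (\<forall>i\<in>words n l. \<forall>j\<in>words n m. mat_mult_on (words_upto n L) S T i j = \<xi> (rev i @ j))"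
  proof (intro exI conjI ballI)
    show "TL n (l + m) (\<lambda>x. \<Sum>r\<le>L. \<zeta> r x)"
      by (intro TL_sum) (simp_all add: \<zeta>(1))
  next
    fix i j assume "i \<in> words n l" "j \<in> words n m"
    then show "mat_mult_on (words_upto n L) S T i j = (\<Sum>r\<le>L. \<zeta> r (rev i @ j))"
      by (simp add: mat_mult_on_def sum_words_upto \<zeta>(2))
  qed
qed

text \<open>The axioms of the orthogonal projection onto the Temperley-Lieb vectors: symmetric
  kernel, range in the space, identity on the space. Positivity and the Haar comparison are derived
  from these alone; the Weingarten formula later supplies an instance.\<close>

locale TL_projection =
  fixes n :: nat and proj :: "nat list \<Rightarrow> nat list \<Rightarrow> real"
  assumes proj_sym: "proj x y = proj y x"
    and proj_TL: "TL n (length y) (\<lambda>x. proj x y)"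
    and proj_id: "TL n l \<xi> \<Longrightarrow> (\<Sum>y\<in>words n l. proj x y * \<xi> y) = \<xi> x"
begin

lemma proj_TL': "TL n (length x) (proj x)"
  using proj_TL[of x] by (subst (asm) proj_sym)

lemma proj_id_left: "TL n l \<xi> \<Longrightarrow> (\<Sum>y\<in>words n l. \<xi> y * proj y x) = \<xi> x"
  using proj_id[of l \<xi> x] by (simp add: mult.commute proj_sym[of x])

lemma proj_length: "length x \<noteq> length y \<Longrightarrow> proj x y = 0"
  using TL_length[OF proj_TL] by blast

lemma proj_outside: "\<not> set x \<subseteq> {1..n} \<Longrightarrow> proj x y = 0"
  using TL_support[OF proj_TL, of x y] unfolding words_def by blast

lemma proj_outside': "\<not> set y \<subseteq> {1..n} \<Longrightarrow> proj x y = 0"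
  using proj_outside proj_sym by metis

lemma proj_Nil: "proj [] [] = 1"
  using proj_id[OF TL.unit, of "[]"] by simp

text \<open>The Temperley-Lieb space is stable under reversal of words, so its orthogonal projection
  commutes with reversal.\<close>

lemma proj_rev: "proj (rev x) (rev y) = proj x y"
proof (cases "length x = length y")
  case True
  have 1: "TL n (length y) (\<lambda>z. proj (rev z) (rev y))"
    using TL_rev[OF proj_TL[of "rev y"]] by simp
  have "proj (rev x) (rev y) = (\<Sum>z\<in>words n (length y). proj x z * proj (rev z) (rev y))"
    using proj_id[OF 1] by simp
  also have "\<dots> = (\<Sum>z\<in>words n (length y). proj (rev y) z * proj x (rev z))"
    by (subst sum_words_rev[symmetric]) (simp add: proj_sym[of "rev y"] mult.commute)
  also have "\<dots> = proj x y"
    using proj_id[OF TL_rev[OF proj_TL'[of x]], of "rev y"] True by simp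
  finally show ?thesis .
qed (simp add: proj_length)

text \<open>Pairing \<open>proj x\<close> with the cup of \<open>proj _ w\<close> can be evaluated
  in two ways: the projection fixes that cup, or the cup moves across as a cap.\<close>

lemma cap_proj:
  assumes "length w = l" "length x = Suc (Suc l)" "t \<le> l"
  shows "cap n t (proj x) w = cup n t (\<lambda>z. proj z w) x"
proof -
  have tl: "TL n (Suc (Suc l)) (cup n t (\<lambda>z. proj z w))" "TL n l (cap n t (proj x))"
    using assms proj_TL[of w] proj_TL'[of x] by (auto intro: TL.cup TL_cap)
  have "cup n t (\<lambda>z. proj z w) x = (\<Sum>y\<in>words n (Suc (Suc l)). cup n t (\<lambda>z. proj z w) y *\<^sub>R proj x y)"
    using proj_id[OF tl(1), of x] by (simp add: mult.commute)
  also have "\<dots> = (\<Sum>y\<in>words n l. cap n t (proj x) y * proj y w)"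
    unfolding sum_cup_scaleR[OF assms(3)]
    by (intro sum.cong refl) (use assms in \<open>auto simp: cap_def words_def mult.commute\<close>)
  also have "\<dots> = cap n t (proj x) w"
    by (rule proj_id_left[OF tl(2)])
  finally show ?thesis by simp
qed

text \<open>The orthogonality relations on the level of the kernel: contracting two adjacent letters
  on one side forces the opposite letters to agree and deletes them.\<close>

lemma proj_contract:
  assumes "length u = length u'" "length v = length v'"
  shows "(\<Sum>a=1..n. proj (u @ i # j # v) (u' @ a # a # v')) =
    (if i = j \<and> i \<in> {1..n} then proj (u @ v) (u' @ v') else 0)"
  using cap_proj[of "u' @ v'" "length u + length v" "u @ i # j # v" "length u"] assms
  by (simp add: cap_append cup_append)

text \<open>The projection acts on each block of matrices separately. The test on lengths is not
  redundant: \<open>proj\<close> compares only the total lengths of the bent words.\<close>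

definition kernel :: "nat list \<Rightarrow> nat list \<Rightarrow> nat list \<Rightarrow> nat list \<Rightarrow> real" where
  "kernel i i' j j' =
    (if length i = length j \<and> length i' = length j' then proj (rev i @ i') (rev j @ j') else 0)"

lemma hilbert_schmidt_projection_kernel:
  "hilbert_schmidt_projection (words_upto n L) (TL_matrices n L) kernel"
proof
  show "kernel i i' j j' = kernel j j' i i'" for i i' j j'
    using proj_sym[of "rev i @ i'"] by (auto simp: kernel_def)
next
  fix j j' assume "j \<in> words_upto n L" "j' \<in> words_upto n L"
  show "(\<lambda>i i'. kernel i i' j j') \<in> TL_matrices n L"
  proof (rule TL_matricesI)
    fix l m
    show "\<exists>\<xi>. TL n (l + m) \<xi> \<and> (\<forall>i\<in>words n l. \<forall>i'\<in>words n m. kernel i i' j j' = \<xi> (rev i @ i'))"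
    proof (cases "l = length j \<and> m = length j'")
      case True
      then show ?thesis using proj_TL[of "rev j @ j'"]
        by (intro exI[of _ "\<lambda>x. proj x (rev j @ j')"]) (auto simp: kernel_def words_def)
    next
      case False
      then show ?thesis by (intro exI[of _ "\<lambda>_. 0"]) (auto simp: kernel_def words_def TL.zero)
    qed
  qed
next
  fix S i i' assume S: "S \<in> TL_matrices n L" and i: "i \<in> words_upto n L" "i' \<in> words_upto n L"
  obtain l m where l: "l \<le> L" "i \<in> words n l" "length i = l" and m: "m \<le> L" "i' \<in> words n m" "length i' = m"
    using i by (meson words_upto_cases)
  obtain \<xi> where \<xi>: "TL n (l + m) \<xi>"
    "\<And>i j. i \<in> words n l \<Longrightarrow> j \<in> words n m \<Longrightarrow> S i j = \<xi> (rev i @ j)"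
    using TL_matricesE[OF S l(1) m(1)] by metis
  have "(\<Sum>j\<in>words_upto n L. \<Sum>j'\<in>words_upto n L. kernel i i' j j' * S j j') =
      (\<Sum>j\<in>words_upto n L. if length j = l then
        \<Sum>j'\<in>words_upto n L. if length j' = m then proj (rev i @ i') (rev j @ j') * S j j' else 0 else 0)"
    using l m by (intro sum.cong refl) (auto simp: kernel_def intro!: sum.cong sum.neutral)
  also have "\<dots> = (\<Sum>j\<in>words n l. \<Sum>j'\<in>words n m. proj (rev i @ i') (rev j @ j') * \<xi> (rev j @ j'))"
    by (simp add: sum_words_upto_length l m \<xi>(2))
  also have "\<dots> = (\<Sum>y\<in>words n (l + m). proj (rev i @ i') y * \<xi> y)"
    by (subst sum_words_append, subst sum_words_rev[symmetric]) simp
  also have "\<dots> = S i i'"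
    using proj_id[OF \<xi>(1)] l m by (simp add: \<xi>(2))
  finally show "(\<Sum>j\<in>words_upto n L. \<Sum>j'\<in>words_upto n L. kernel i i' j j' * S j j') = S i i'" .
qed (simp_all add: TL_matrices_mult TL_matrices_transpose TL_matrices_one)

text \<open>This is \<open>kernel_positive\<close> for the matrix \<open>C\<close> that collects the
  coefficients \<open>c w\<close> at the entries \<open>(a w, b w)\<close>.\<close>

lemma proj_positive_real:
  fixes a b :: "'w \<Rightarrow> nat list" and c :: "'w \<Rightarrow> real"
  assumes "finite F" and len: "\<And>w. length (a w) = length (b w)"
  shows "0 \<le> (\<Sum>w\<in>F. \<Sum>w'\<in>F. c w * (c w' * proj (rev (a w) @ a w') (rev (b w) @ b w')))"
proof -
  \<comment> \<open>Words with a letter outside \<open>{1..n}\<close> contribute 0 to the form; the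
    others fit into \<open>words_upto n L\<close>, with \<open>L\<close> their maximal
    length.\<close>
  define G where "G = {w\<in>F. set (a w) \<subseteq> {1..n} \<and> set (b w) \<subseteq> {1..n}}"
  have "finite G" using assms(1) by (simp add: G_def)
  define L where "L = Max (insert 0 ((\<lambda>w. length (a w)) ` G))"
  let ?K = "words_upto n L"
  have mem: "a w \<in> ?K" "b w \<in> ?K" if "w \<in> G" for w
  proof -
    have "length (a w) \<le> L" unfolding L_def using that \<open>finite G\<close> by (intro Max_ge) auto
    then show "a w \<in> ?K" "b w \<in> ?K" using that by (auto simp: G_def words_upto_def words_def len)
  qed
  interpret hilbert_schmidt_projection ?K "TL_matrices n L" kernel
    by (rule hilbert_schmidt_projection_kernel)
  define C where "C i j = (\<Sum>w\<in>G. of_bool (a w = i) * (of_bool (b w = j) * c w))" for i j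
  have C: "(\<Sum>i\<in>?K. \<Sum>j\<in>?K. C i j * g i j) = (\<Sum>w\<in>G. c w * g (a w) (b w))" for g
  proof -
    have "(\<Sum>i\<in>?K. \<Sum>j\<in>?K. C i j * g i j) =
        (\<Sum>i\<in>?K. \<Sum>j\<in>?K. \<Sum>w\<in>G. of_bool (a w = i) * (of_bool (b w = j) * (c w * g i j)))"
      by (simp add: C_def sum_distrib_right mult.assoc del: sum_mult_of_bool_eq sum_of_bool_mult_eq)
    also have "\<dots> = (\<Sum>w\<in>G. \<Sum>i\<in>?K. of_bool (a w = i) * (\<Sum>j\<in>?K. of_bool (b w = j) * (c w * g i j)))"
      by (simp only: sum_distrib_left) (rule sum_rotate3[symmetric])
    also have "\<dots> = (\<Sum>w\<in>G. c w * g (a w) (b w))"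
      using mem finite_words_upto[of n L] by (intro sum.cong refl) simp
    finally show ?thesis .
  qed
  have \<Phi>: "\<Phi> C i j = (\<Sum>w'\<in>G. c w' * kernel i (a w') j (b w'))" for i j
    unfolding \<Phi>_def using C[of "\<lambda>i' j'. kernel i i' j j'"] by (simp add: mult.commute)
  define \<kappa> where "\<kappa> w w' = proj (rev (a w) @ a w') (rev (b w) @ b w')" for w w'
  have \<kappa>: "\<kappa> w w' = 0" "\<kappa> w' w = 0" if "w \<in> F - G" for w w'
  proof -
    have "\<not> set (a w) \<subseteq> {1..n} \<or> \<not> set (b w) \<subseteq> {1..n}"
      using that unfolding G_def by blast
    then show "\<kappa> w w' = 0" "\<kappa> w' w = 0"
      by (elim disjE; simp add: \<kappa>_def proj_outside proj_outside')+
  qed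
  have "0 \<le> (\<Sum>w\<in>G. c w * \<Phi> C (a w) (b w))"
    using kernel_positive[of C] by (simp add: C)
  also have "\<dots> = (\<Sum>w\<in>G. \<Sum>w'\<in>G. c w * (c w' * \<kappa> w w'))"
    by (simp add: \<Phi> kernel_def len sum_distrib_left \<kappa>_def)
  also have "\<dots> = (\<Sum>w\<in>F. \<Sum>w'\<in>G. c w * (c w' * \<kappa> w w'))"
    using assms(1) by (intro sum.mono_neutral_left) (auto simp: \<kappa> G_def)
  also have "\<dots> = (\<Sum>w\<in>F. \<Sum>w'\<in>F. c w * (c w' * \<kappa> w w'))"
    using assms(1) by (intro sum.cong refl sum.mono_neutral_left) (auto simp: \<kappa> G_def)
  also have "\<dots> = (\<Sum>w\<in>F. \<Sum>w'\<in>F. c w * (c w' * proj (rev (a w) @ a w') (rev (b w) @ b w')))"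
    by (simp add: \<kappa>_def)
  finally show ?thesis .
qed

end

section \<open>The Weingarten state on the free star-algebra\<close>

definition mon :: "complex \<Rightarrow> 'x star_word \<Rightarrow> 'x free_star_algebra" where
  "mon c w = of_poly (Poly_Mapping.single w c)"

lemma mon_mult: "mon c w * mon d w' = mon (c * d) (w + w')"
  by (simp add: mon_def times_free_star_algebra_def of_poly_inverse mult_single)

lemma star_mon: "star (mon c w) = mon (cnj c) (adj_word w)"
  by (simp add: mon_def star_free_star_algebra_def of_poly_inverse adj_poly_single)

lemma scaleC_mon: "d *\<^sub>C mon c w = mon (d * c) w"
  by (simp add: mon_def scaleC_free_star_algebra_def of_poly_inverse mult_single)

lemma one_eq_mon: "1 = mon 1 0"
  by (simp add: mon_def one_free_star_algebra_def)

lemma gen_eq_mon: "gen x = mon 1 (Star_Word [(x, False)])"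
  by (simp add: mon_def gen_def)

lemma star_gen_eq_mon: "star (gen x) = mon 1 (Star_Word [(x, True)])"
  by (simp add: gen_eq_mon star_mon adj_word_def)

lemma free_star_mon_induct [case_names zero add]:
  assumes "P 0" and "\<And>w c f. P f \<Longrightarrow> P (mon c w + f)"
  shows "P f"
  using assms unfolding mon_def by (rule free_star_single_induct)

lemma eval_free_mon: "eval_free v (mon c w) = c *\<^sub>C word_val v w"
  by (simp add: mon_def eval_free_single)

lemma eval_free_sum: "eval_free v (\<Sum>a\<in>A. f a) = (\<Sum>a\<in>A. eval_free v (f a))"
  by (induction A rule: infinite_finite_induct) (simp_all add: eval_free_add)

lemma free_star_eq_sum_mon:
  "f = (\<Sum>w\<in>Poly_Mapping.keys (poly_of f). mon (Poly_Mapping.lookup (poly_of f) w) w)"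
proof -
  have add: "of_poly (p + q) = of_poly p + of_poly q" for p q :: "'a star_word \<Rightarrow>\<^sub>0 complex"
    by (simp add: plus_free_star_algebra_def of_poly_inverse)
  have "of_poly (sum g A) = (\<Sum>a\<in>A. of_poly (g a))" for g :: "'a star_word \<Rightarrow> 'a star_word \<Rightarrow>\<^sub>0 complex" and A
    by (induction A rule: infinite_finite_induct) (simp_all add: add flip: zero_free_star_algebra_def)
  from this[of _ "Poly_Mapping.keys (poly_of f)", symmetric] show ?thesis
    unfolding mon_def by (simp add: poly_of_inverse flip: poly_mapping_eq_sum_single)
qed

lemma mon_in_free_star_on: "fst ` set (letters w) \<subseteq> X \<Longrightarrow> mon c w \<in> free_star_on X"
  by (auto simp: free_star_on_def mon_def of_poly_inverse)

text \<open>The adjoint flags are dropped because the generators are to become self-adjoint.\<close>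

definition row_word :: "((nat \<times> nat) star_word) \<Rightarrow> nat list" where
  "row_word w = map (fst \<circ> fst) (letters w)"

definition col_word :: "((nat \<times> nat) star_word) \<Rightarrow> nat list" where
  "col_word w = map (snd \<circ> fst) (letters w)"

lemma row_word_simps [simp]:
  "row_word 0 = []" "row_word (v + w) = row_word v @ row_word w"
  "row_word (Star_Word l) = map (fst \<circ> fst) l" "row_word (adj_word w) = rev (row_word w)"
  by (simp_all add: row_word_def adj_word_def rev_map case_prod_unfold o_def)

lemma col_word_simps [simp]:
  "col_word 0 = []" "col_word (v + w) = col_word v @ col_word w"
  "col_word (Star_Word l) = map (snd \<circ> fst) l" "col_word (adj_word w) = rev (col_word w)"
  by (simp_all add: col_word_def adj_word_def rev_map case_prod_unfold o_def)

lemma length_row_col_word: "length (row_word w) = length (col_word w)"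
  by (simp add: row_word_def col_word_def)

context TL_projection
begin

text \<open>Each word is sent to the integral predicted by the Weingarten formula, here an entry of
  \<open>proj\<close>. The indices range over all naturals; a word using one outside
  \<open>{1..n}\<close> gets the value 0.\<close>

definition state :: "(nat \<times> nat) free_star_algebra \<Rightarrow> complex" where
  "state f = (\<Sum>w\<in>Poly_Mapping.keys (poly_of f).
     Poly_Mapping.lookup (poly_of f) w * complex_of_real (proj (row_word w) (col_word w)))"

lemma state_superset:
  assumes "finite K" "Poly_Mapping.keys (poly_of f) \<subseteq> K"
  shows "state f = (\<Sum>w\<in>K. Poly_Mapping.lookup (poly_of f) w * complex_of_real (proj (row_word w) (col_word w)))"
  unfolding state_def by (rule sum.mono_neutral_left) (use assms in \<open>auto simp: in_keys_iff\<close>)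

lemma state_add: "state (f + g) = state f + state g"
proof -
  let ?K = "Poly_Mapping.keys (poly_of f) \<union> Poly_Mapping.keys (poly_of g)"
  have "Poly_Mapping.keys (poly_of (f + g)) \<subseteq> ?K"
    by (simp add: plus_free_star_algebra.rep_eq keys_add)
  then show ?thesis
    by (subst (1 2 3) state_superset[where K = ?K])
      (auto simp: plus_free_star_algebra.rep_eq lookup_add distrib_right sum.distrib)
qed

lemma state_zero [simp]: "state 0 = 0"
  by (simp add: state_def zero_free_star_algebra.rep_eq)

lemma state_mon: "state (mon c w) = c * complex_of_real (proj (row_word w) (col_word w))"
  unfolding mon_def by (subst state_superset[where K = "{w}"]) (auto simp: of_poly_inverse)

lemma state_scaleC: "state (c *\<^sub>C f) = c * state f"
  by (induction f rule: free_star_mon_induct)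
    (simp_all add: scaleC_add_right state_add state_mon scaleC_mon distrib_left)

lemma state_diff: "state (f - g) = state f - state g"
  using state_add[of "f - g" g] by simp

lemma state_sum: "state (\<Sum>a\<in>A. f a) = (\<Sum>a\<in>A. state (f a))"
  by (induction A rule: infinite_finite_induct) (simp_all add: state_add)

lemma state_positive: "state (star f * f) \<in> \<real>\<^sub>\<ge>\<^sub>0"
proof -
  define F where "F = Poly_Mapping.keys (poly_of f)"
  define c where "c = Poly_Mapping.lookup (poly_of f)"
  define \<kappa> where "\<kappa> w w' = proj (rev (row_word w) @ row_word w') (rev (col_word w) @ col_word w')" for w w'
  have star_sum: "star (\<Sum>w\<in>A. g w) = (\<Sum>w\<in>A. star (g w))" for A and g :: "_ \<Rightarrow> (nat \<times> nat) free_star_algebra"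
    by (induction A rule: infinite_finite_induct) (simp_all add: star_add)
  have f: "f = (\<Sum>w\<in>F. mon (c w) w)"
    unfolding F_def c_def by (rule free_star_eq_sum_mon)
  have "star f * f = (\<Sum>w\<in>F. \<Sum>w'\<in>F. mon (cnj (c w) * c w') (adj_word w + w'))"
    by (subst (1 2) f) (simp add: star_sum star_mon sum_product mon_mult)
  then have eq: "state (star f * f) = (\<Sum>w\<in>F. \<Sum>w'\<in>F. cnj (c w) * c w' * complex_of_real (\<kappa> w w'))"
    by (simp add: state_sum state_mon \<kappa>_def)
  \<comment> \<open>The form is real and symmetric, so real and imaginary parts of the coefficients
    contribute separately and the cross terms cancel.\<close>
  have \<kappa>_sym: "\<kappa> w' w = \<kappa> w w'" for w w'
    using proj_rev[of "rev (row_word w) @ row_word w'" "rev (col_word w) @ col_word w'"] by (simp add: \<kappa>_def)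
  have pos: "0 \<le> (\<Sum>w\<in>F. \<Sum>w'\<in>F. x w * (x w' * \<kappa> w w'))" for x
    unfolding \<kappa>_def F_def by (rule proj_positive_real) (simp_all add: length_row_col_word)
  have "Re (state (star f * f)) = (\<Sum>w\<in>F. \<Sum>w'\<in>F. Re (c w) * (Re (c w') * \<kappa> w w')) +
      (\<Sum>w\<in>F. \<Sum>w'\<in>F. Im (c w) * (Im (c w') * \<kappa> w w'))"
    by (simp add: eq algebra_simps sum.distrib)
  then have "0 \<le> Re (state (star f * f))"
    using pos[of "\<lambda>w. Re (c w)"] pos[of "\<lambda>w. Im (c w)"] by simp
  moreover have "Im (state (star f * f)) = 0"
  proof -
    have "(\<Sum>w\<in>F. \<Sum>w'\<in>F. Im (c w) * (Re (c w') * \<kappa> w w')) = (\<Sum>w\<in>F. \<Sum>w'\<in>F. Re (c w) * (Im (c w') * \<kappa> w w'))"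
      by (subst sum.swap) (simp add: \<kappa>_sym mult_ac)
    then show ?thesis by (simp add: eq algebra_simps sum_subtractf sum.distrib)
  qed
  ultimately show ?thesis by (simp add: complex_nonneg_Reals_iff)
qed

lemma state_mult_eqI:
  assumes "\<And>w w'. state (mon 1 w * r * mon 1 w') = state (mon 1 w * r' * mon 1 w')"
  shows "state (f * r * g) = state (f * r' * g)"
proof -
  have mono1: "mon d w = d *\<^sub>C mon 1 w" for d and w :: "(nat \<times> nat) star_word" by (simp add: scaleC_mon)
  have 1: "state (mon d w * r * g) = state (mon d w * r' * g)" for d w
  proof (induction g rule: free_star_mon_induct)
    case (add w' e g)
    have "state (mon d w * s * mon e w') = d * (e * state (mon 1 w * s * mon 1 w'))" for s
      by (subst (1 2) mono1) (simp add: mult_scaleC_left mult_scaleC_right state_scaleC)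
    with add assms show ?case by (simp add: distrib_left state_add)
  qed simp
  show ?thesis
    by (induction f rule: free_star_mon_induct) (simp_all add: distrib_right state_add 1)
qed

lemma state_mult_eq_0I:
  assumes "\<And>w w'. state (mon 1 w * r * mon 1 w') = 0"
  shows "state (f * r * g) = 0"
  using state_mult_eqI[of r 0 f g] assms by simp

text \<open>Arbitrary flags are allowed so that, besides the defining relations, the sum of the
  products \<open>star (gen (k, j)) * gen (k, j)\<close> is covered; that case bounds the
  generators.\<close>

lemma state_contract_rows:
  "(\<Sum>k=1..n. state (f * mon 1 (Star_Word [((k, i), b), ((k, j), b')]) * g)) =
    (if i = j \<and> i \<in> {1..n} then state (f * g) else 0)"
proof -
  have "state (f * (\<Sum>k=1..n. mon 1 (Star_Word [((k, i), b), ((k, j), b')])) * g) =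
      state (f * (of_bool (i = j \<and> i \<in> {1..n}) *\<^sub>C 1) * g)"
  proof (rule state_mult_eqI)
    fix w w'
    have "state (mon 1 w * (\<Sum>k=1..n. mon 1 (Star_Word [((k, i), b), ((k, j), b')])) * mon 1 w') =
       complex_of_real (\<Sum>k=1..n. proj (col_word w @ i # j # col_word w') (row_word w @ k # k # row_word w'))"
      by (simp add: sum_distrib_left sum_distrib_right state_sum mon_mult state_mon proj_sym)
    also have "\<dots> = state (mon 1 w * (of_bool (i = j \<and> i \<in> {1..n}) *\<^sub>C 1) * mon 1 w')"
      by (subst proj_contract)
        (auto simp: length_row_col_word mult_scaleC_left mult_scaleC_right state_scaleC mon_mult state_mon proj_sym)
    finally show "state (mon 1 w * (\<Sum>k=1..n. mon 1 (Star_Word [((k, i), b), ((k, j), b')])) * mon 1 w') = \<dots>" .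
  qed
  then show ?thesis
    by (simp add: sum_distrib_left sum_distrib_right state_sum mult_scaleC_left mult_scaleC_right state_scaleC)
qed

lemma state_contract_cols:
  "(\<Sum>k=1..n. state (f * mon 1 (Star_Word [((i, k), b), ((j, k), b')]) * g)) =
    (if i = j \<and> i \<in> {1..n} then state (f * g) else 0)"
proof -
  have "state (f * (\<Sum>k=1..n. mon 1 (Star_Word [((i, k), b), ((j, k), b')])) * g) =
      state (f * (of_bool (i = j \<and> i \<in> {1..n}) *\<^sub>C 1) * g)"
  proof (rule state_mult_eqI)
    fix w w'
    have "state (mon 1 w * (\<Sum>k=1..n. mon 1 (Star_Word [((i, k), b), ((j, k), b')])) * mon 1 w') =
       complex_of_real (\<Sum>k=1..n. proj (row_word w @ i # j # row_word w') (col_word w @ k # k # col_word w'))"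
      by (simp add: sum_distrib_left sum_distrib_right state_sum mon_mult state_mon)
    also have "\<dots> = state (mon 1 w * (of_bool (i = j \<and> i \<in> {1..n}) *\<^sub>C 1) * mon 1 w')"
      by (subst proj_contract)
        (auto simp: length_row_col_word mult_scaleC_left mult_scaleC_right state_scaleC mon_mult state_mon)
    finally show "state (mon 1 w * (\<Sum>k=1..n. mon 1 (Star_Word [((i, k), b), ((j, k), b')])) * mon 1 w') = \<dots>" .
  qed
  then show ?thesis
    by (simp add: sum_distrib_left sum_distrib_right state_sum mult_scaleC_left mult_scaleC_right state_scaleC)
qed

lemma state_orthogonality_relation:
  assumes "r \<in> orthogonality_relations n"
  shows "state (f * r * g) = 0"
proof -
  have diff: "state (f * (x - y) * g) = state (f * x * g) - state (f * y * g)" for x y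
    by (simp add: right_diff_distrib left_diff_distrib state_diff)
  have of_bool: "state (f * of_bool b * g) = (if b then state (f * g) else 0)" for b
    by simp
  consider (adj) i j where "r = gen (i, j) - star (gen (i, j))"
    | (cols) i j where "i \<in> {1..n}" "r = (\<Sum>k=1..n. gen (i, k) * gen (j, k)) - of_bool (i = j)"
    | (rows) i j where "i \<in> {1..n}" "r = (\<Sum>k=1..n. gen (k, i) * gen (k, j)) - of_bool (i = j)"
    using assms unfolding orthogonality_relations_def by blast
  then show ?thesis
  proof cases
    case adj
    have "state (f * gen (i, j) * g) = state (f * star (gen (i, j)) * g)"
      unfolding star_gen_eq_mon unfolding gen_eq_mon
      by (rule state_mult_eqI) (simp add: mon_mult state_mon)
    then show ?thesis by (simp add: adj diff)
  next
    case cols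
    have "state (f * (\<Sum>k=1..n. gen (i, k) * gen (j, k)) * g) = (if i = j then state (f * g) else 0)"
      using state_contract_cols[of f i False j False g] cols(1)
      by (simp add: sum_distrib_left sum_distrib_right state_sum gen_eq_mon mon_mult plus_star_word_def)
    then show ?thesis by (simp add: cols(2) diff of_bool)
  next
    case rows
    have "state (f * (\<Sum>k=1..n. gen (k, i) * gen (k, j)) * g) = (if i = j then state (f * g) else 0)"
      using state_contract_rows[of f i False j False g] rows(1)
      by (simp add: sum_distrib_left sum_distrib_right state_sum gen_eq_mon mon_mult plus_star_word_def)
    then show ?thesis by (simp add: rows(2) diff of_bool)
  qed
qed

section \<open>Boundedness of left multiplication for the state\<close>

definition N :: "(nat \<times> nat) free_star_algebra \<Rightarrow> real" where "N f = Re (state (star f * f))"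

lemma N_nonneg: "0 \<le> N f"
  using state_positive[of f] by (simp add: N_def complex_nonneg_Reals_iff)

lemma N_scaleC: "N (c *\<^sub>C f) = (cmod c)\<^sup>2 * N f"
proof -
  have "state (star (c *\<^sub>C f) * (c *\<^sub>C f)) = c * cnj c * state (star f * f)"
    by (simp add: star_scaleC mult_scaleC_left mult_scaleC_right state_scaleC)
  also have "\<dots> = complex_of_real ((cmod c)\<^sup>2) * state (star f * f)"
    by (simp only: complex_norm_square)
  finally show ?thesis by (simp add: N_def)
qed

text \<open>The parallelogram identity. It precedes the Cauchy-Schwarz inequality here, which
  belongs to the locale whose boundedness axiom is still being established.\<close>

lemma N_add_le: "N (f + g) \<le> 2 * N f + 2 * N g"
proof -
  have "N (f + g) + N (f - g) = 2 * N f + 2 * N g"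
    by (simp add: N_def star_add star_diff algebra_simps state_add state_diff)
  then show ?thesis using N_nonneg[of "f - g"] by simp
qed

text \<open>The products X_k^* X_k over a column sum to the identity, or to 0 if \<open>j\<close>
  lies outside \<open>{1..n}\<close>, in the sense of the state; hence each X_k is a contraction. A
  row index outside \<open>{1..n}\<close> makes the letter act as 0.\<close>

lemma N_letter_le: "N (mon 1 (Star_Word [((i, j), b)]) * g) \<le> N g"
proof (cases "i \<in> {1..n}")
  case True
  let ?X = "\<lambda>k. mon 1 (Star_Word [((k, j), b)])"
  have *: "star (?X k * g) * (?X k * g) = star g * mon 1 (Star_Word [((k, j), \<not> b), ((k, j), b)]) * g" for k
  proof -
    have "star (?X k) * ?X k = mon 1 (Star_Word [((k, j), \<not> b), ((k, j), b)])"
      by (simp add: star_mon mon_mult adj_word_def plus_star_word_def)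
    then have "star g * (star (?X k) * ?X k) * g = star g * mon 1 (Star_Word [((k, j), \<not> b), ((k, j), b)]) * g"
      by (rule arg_cong)
    then show ?thesis by (simp only: star_mult mult.assoc)
  qed
  have "N (?X i * g) \<le> (\<Sum>k=1..n. N (?X k * g))"
    using True by (intro member_le_sum) (simp_all add: N_nonneg)
  also have "\<dots> = Re (\<Sum>k=1..n. state (star g * mon 1 (Star_Word [((k, j), \<not> b), ((k, j), b)]) * g))"
    unfolding N_def * Re_sum ..
  also have "\<dots> \<le> N g"
    using N_nonneg[of g] by (subst state_contract_rows) (simp add: N_def)
  finally show ?thesis .
next
  case False
  let ?X = "mon 1 (Star_Word [((i, j), b)])"
  have "state (star g * star ?X * ?X * g) = 0"
  proof -
    have "state (star g * (star ?X * ?X) * g) = 0"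
    proof (rule state_mult_eq_0I)
      fix w w'
      show "state (mon 1 w * (star ?X * ?X) * mon 1 w') = 0"
        using False proj_outside[of "row_word w @ i # i # row_word w'"]
        by (auto simp: star_mon mon_mult state_mon)
    qed
    then show ?thesis by (simp only: mult.assoc)
  qed
  then have "N (?X * g) = 0" unfolding N_def star_mult by (simp only: mult.assoc zero_complex.sel)
  then show ?thesis using N_nonneg[of g] by simp
qed

lemma N_mult_bounded: "\<exists>C\<ge>0. \<forall>g. N (f * g) \<le> C * N g"
proof (induction f rule: free_star_mon_induct)
  case zero
  have "N 0 = 0" by (simp add: N_def)
  then show ?case by (intro exI[of _ 0]) simp
next
  case (add w c f)
  have word: "N (mon 1 (Star_Word l) * g) \<le> N g" for l g
  proof (induction l)
    case Nil
    have "mon 1 (Star_Word []) = (1 :: (nat \<times> nat) free_star_algebra)"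
      by (simp add: one_eq_mon zero_star_word_def)
    then show ?case by simp
  next
    case (Cons x l)
    obtain i j b where x: "x = ((i, j), b)" by (metis prod.exhaust)
    have "mon 1 (Star_Word (x # l)) * g = mon 1 (Star_Word [((i, j), b)]) * (mon 1 (Star_Word l) * g)"
      by (simp add: mon_mult plus_star_word_def x flip: mult.assoc)
    then show ?case using N_letter_le[of i j b "mon 1 (Star_Word l) * g"] Cons.IH by simp
  qed
  obtain C where C: "C \<ge> 0" "\<And>g. N (f * g) \<le> C * N g" using add by blast
  have "N ((mon c w + f) * g) \<le> (2 * (cmod c)\<^sup>2 + 2 * C) * N g" for g
  proof -
    have "mon c w * g = c *\<^sub>C (mon 1 (Star_Word (letters w)) * g)"
      by (simp add: scaleC_mon flip: mult_scaleC_left)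
    then have "N (mon c w * g) \<le> (cmod c)\<^sup>2 * N g"
      using word[of "letters w" g] by (simp add: N_scaleC mult_left_mono)
    then show ?thesis
      using N_add_le[of "mon c w * g" "f * g"] C(2)[of g] by (simp add: distrib_right)
  qed
  moreover have "0 \<le> 2 * (cmod c)\<^sup>2 + 2 * C" using C(1) by simp
  ultimately show ?case by blast
qed

sublocale bounded_positive_functional state
proof
  show "clinear state"
    unfolding clinear_def scaleC_complex_def by (intro conjI allI state_add state_scaleC)
  show "\<exists>C. \<forall>g. Re (state (star (f * g) * (f * g))) \<le> C * Re (state (star g * g))" for f
  proof -
    obtain C where "\<And>g. N (f * g) \<le> C * N g" using N_mult_bounded[of f] by metis
    then show ?thesis unfolding N_def by (intro exI[of _ C] allI)
  qed
qed (rule state_positive)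

text \<open>The GNS seminorm is a C*-seminorm vanishing on the relations, so maximality of the
  universal norm bounds it.\<close>

theorem state_eq_0_if_eval_free_eq_0:
  fixes v :: "nat \<times> nat \<Rightarrow> 'a::cstar_algebra"
  assumes "universal_cstar X (orthogonality_relations n) v" "f \<in> free_star_on X" "eval_free v f = 0"
  shows "state f = 0"
proof -
  have "opnorm r = 0" if "r \<in> orthogonality_relations n" for r
  proof (rule opnorm_eq_zero)
    fix g
    show "state (star (r * g) * (r * g)) = 0"
      using state_orthogonality_relation[OF that, of "star (r * g)" g] by (simp add: mult.assoc)
  qed
  then have "opnorm f \<le> norm (eval_free v f)"
    using assms(1,2) cstar_seminorm_opnorm unfolding universal_cstar_def by blast
  then have "opnorm f = 0" using assms(3) opnorm_nonneg[of f] by simp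
  then show ?thesis by (rule functional_eq_zero)
qed

end

section \<open>Temperley-Lieb diagrams and their Gram matrices\<close>

lemma TL_diagramsI:
  assumes "\<And>X. X \<in> p \<Longrightarrow> \<exists>a b. X = {a, b} \<and> a < b \<and> a \<in> {1..2 * k} \<and> b \<in> {1..2 * k}"
    and "\<And>a b c. {a, b} \<in> p \<Longrightarrow> {a, c} \<in> p \<Longrightarrow> b = c"
    and "\<And>a. a \<in> {1..2 * k} \<Longrightarrow> \<exists>b. {a, b} \<in> p"
    and "\<And>a b c d. a < b \<Longrightarrow> b < c \<Longrightarrow> c < d \<Longrightarrow> {a, c} \<in> p \<Longrightarrow> {b, d} \<in> p \<Longrightarrow> False"
  shows "p \<in> TL_diagrams k"
proof -
  have "\<Union>p = {1..2 * k}"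
  proof (intro equalityI subsetI)
    fix a assume "a \<in> \<Union>p"
    then obtain X where "X \<in> p" "a \<in> X" by blast
    with assms(1)[OF this(1)] show "a \<in> {1..2 * k}" by blast
  next
    fix a assume "a \<in> {1..2 * k}"
    then show "a \<in> \<Union>p" using assms(3) by blast
  qed
  moreover have "disjoint p"
  proof (rule disjointI)
    have pair: "\<exists>f. X = {e, f}" if "X \<in> p" "e \<in> X" for X e
    proof -
      from assms(1)[OF that(1)] obtain a b where "X = {a, b}" by blast
      then have "X = {e, b} \<or> X = {e, a}" using that(2) by auto
      then show ?thesis by blast
    qed
    fix X Y assume XY: "X \<in> p" "Y \<in> p" "X \<noteq> Y"
    show "X \<inter> Y = {}"
    proof (rule ccontr)
      assume "X \<inter> Y \<noteq> {}"
      then obtain e where e: "e \<in> X" "e \<in> Y" by blast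
      obtain f g where "X = {e, f}" "Y = {e, g}" using pair[OF XY(1) e(1)] pair[OF XY(2) e(2)] by metis
      with XY assms(2)[of e f g] show False by simp
    qed
  qed
  moreover have "{} \<notin> p" using assms(1) by blast
  moreover have "card X = 2" if "X \<in> p" for X
  proof -
    from assms(1)[OF that] obtain a b where "X = {a, b}" "a < b" by blast
    then show ?thesis by simp
  qed
  moreover have "\<not> (\<exists>a b c d. a < b \<and> b < c \<and> c < d \<and> {a, c} \<in> p \<and> {b, d} \<in> p)"
    using assms(4) by blast
  ultimately show ?thesis
    by (simp add: TL_diagrams_def partition_on_def)
qed

context
  fixes k :: nat and p :: "nat set set"
  assumes p: "p \<in> TL_diagrams k"
begin

lemma TL_diagram_partition: "partition_on {1..2 * k} p"
  using p by (simp add: TL_diagrams_def)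

lemma TL_diagram_block: "X \<in> p \<Longrightarrow> \<exists>a b. X = {a, b} \<and> a < b"
proof -
  assume "X \<in> p"
  then have "card X = 2" using p by (simp add: TL_diagrams_def)
  then obtain a b where "X = {a, b}" "a \<noteq> b" by (auto simp: card_2_iff)
  then show ?thesis by (metis insert_commute linorder_neqE_nat)
qed

lemma TL_diagram_range: "{a, b} \<in> p \<Longrightarrow> a \<in> {1..2 * k} \<and> b \<in> {1..2 * k}"
  using partition_onD1[OF TL_diagram_partition] by blast

lemma TL_diagram_neq: "{a, b} \<in> p \<Longrightarrow> a \<noteq> b"
  using TL_diagram_block[of "{a, b}"] by (auto simp: doubleton_eq_iff)

lemma TL_diagram_unique: "{a, b} \<in> p \<Longrightarrow> {a, c} \<in> p \<Longrightarrow> b = c"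
proof -
  assume "{a, b} \<in> p" "{a, c} \<in> p"
  then have "{a, b} = {a, c}" using disjointD[OF partition_onD2[OF TL_diagram_partition]] by blast
  then show "b = c" by (auto simp: doubleton_eq_iff)
qed

lemma TL_diagram_partner: "a \<in> {1..2 * k} \<Longrightarrow> \<exists>b. {a, b} \<in> p"
proof -
  assume "a \<in> {1..2 * k}"
  then obtain X where "X \<in> p" "a \<in> X" using partition_onD1[OF TL_diagram_partition] by blast
  moreover from TL_diagram_block[OF this(1)] obtain u v where "X = {u, v}" by blast
  ultimately have "X = {a, v} \<or> X = {a, u}" by auto
  with \<open>X \<in> p\<close> show ?thesis by blast
qed

lemma TL_diagram_noncrossing: "a < b \<Longrightarrow> b < c \<Longrightarrow> c < d \<Longrightarrow> {a, c} \<in> p \<Longrightarrow> {b, d} \<in> p \<Longrightarrow> False"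
  using p unfolding TL_diagrams_def by blast

lemma TL_diagram_inside:
  assumes "{a, b} \<in> p" "a < c" "c < b" "{c, d} \<in> p"
  shows "a < d" "d < b"
proof -
  have swap: "{b, a} \<in> p" "{d, c} \<in> p" using assms(1,4) by (simp_all add: insert_commute)
  have "d \<noteq> a" using TL_diagram_unique[of a b c] assms(1,3) swap(2) by auto
  moreover have "d \<noteq> b" using TL_diagram_unique[of b a c] assms(2) swap by auto
  moreover have "\<not> d < a" using TL_diagram_noncrossing[OF _ assms(2,3) swap(2) assms(1)] by blast
  moreover have "\<not> b < d" using TL_diagram_noncrossing[OF assms(2,3) _ assms(1,4)] by blast
  ultimately show "a < d" "d < b" by linarith+
qed

end

lemma finite_TL_diagrams [simp]: "finite (TL_diagrams k)"
proof (rule finite_subset)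
  show "TL_diagrams k \<subseteq> Pow (Pow {1..2 * k})"
    using partition_onD1[OF TL_diagram_partition] by blast
qed simp

lemma TL_diagrams_0: "TL_diagrams 0 = {{}}"
proof -
  have "p = {}" if "p \<in> TL_diagrams 0" for p
    using TL_diagram_block[OF that] TL_diagram_range[OF that] by fastforce
  moreover have "{} \<in> TL_diagrams 0"
    by (rule TL_diagramsI) simp_all
  ultimately show ?thesis by blast
qed

section \<open>Building diagrams by inserting adjacent pairs\<close>

definition skip2 :: "nat \<Rightarrow> nat \<Rightarrow> nat" where "skip2 t i = (if i \<le> t then i else i + 2)"

definition insert_cup :: "nat \<Rightarrow> nat set set \<Rightarrow> nat set set" where
  "insert_cup t p = insert {t + 1, t + 2} ((`) (skip2 t) ` p)"

lemma skip2_less_iff [simp]: "skip2 t i < skip2 t j \<longleftrightarrow> i < j"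
  by (auto simp: skip2_def)

lemma skip2_eq_iff [simp]: "skip2 t i = skip2 t j \<longleftrightarrow> i = j"
  by (auto simp: skip2_def)

lemma skip2_neq [simp]: "skip2 t i \<noteq> Suc t" "skip2 t i \<noteq> Suc (Suc t)"
  by (auto simp: skip2_def)

lemma skip2_cases:
  obtains "j = t + 1" | "j = t + 2" | i where "j = skip2 t i"
proof -
  consider "j \<le> t" | "j = t + 1" | "j = t + 2" | "t + 2 < j" by linarith
  then show thesis
  proof cases
    case 1
    then show thesis using that(3)[of j] by (simp add: skip2_def)
  next
    case 4
    then have "j = skip2 t (j - 2)" by (auto simp: skip2_def)
    then show thesis by (rule that(3))
  qed (use that in blast)+
qed

lemma skip2_range: "skip2 t i \<in> {1..2 * Suc k} \<longleftrightarrow> i \<in> {1..2 * k}" if "t \<le> 2 * k"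
  using that by (auto simp: skip2_def)

lemma insert_cup_iff:
  assumes "p \<in> TL_diagrams k"
  shows "{a, b} \<in> insert_cup t p \<longleftrightarrow> {a, b} = {t + 1, t + 2} \<or>
    (\<exists>a' b'. a = skip2 t a' \<and> b = skip2 t b' \<and> {a', b'} \<in> p)"
proof
  assume "{a, b} \<in> insert_cup t p"
  then consider "{a, b} = {t + 1, t + 2}" | X where "X \<in> p" "{a, b} = skip2 t ` X"
    by (auto simp: insert_cup_def)
  then show "{a, b} = {t + 1, t + 2} \<or> (\<exists>a' b'. a = skip2 t a' \<and> b = skip2 t b' \<and> {a', b'} \<in> p)"
  proof cases
    case 2
    obtain a' b' where "X = {a', b'}" using TL_diagram_block[OF assms 2(1)] by blast
    with 2 have "a = skip2 t a' \<and> b = skip2 t b' \<or> a = skip2 t b' \<and> b = skip2 t a'" "{a', b'} \<in> p" "{b', a'} \<in> p"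
      by (auto simp: doubleton_eq_iff insert_commute)
    then show ?thesis by blast
  qed blast
next
  assume "{a, b} = {t + 1, t + 2} \<or> (\<exists>a' b'. a = skip2 t a' \<and> b = skip2 t b' \<and> {a', b'} \<in> p)"
  then show "{a, b} \<in> insert_cup t p"
  proof (elim disjE exE conjE)
    fix a' b' assume *: "a = skip2 t a'" "b = skip2 t b'" "{a', b'} \<in> p"
    then have "skip2 t ` {a', b'} \<in> insert_cup t p" unfolding insert_cup_def by blast
    with * show ?thesis by simp
  qed (simp add: insert_cup_def)
qed

lemma insert_cup_diagram:
  assumes "p \<in> TL_diagrams k" "t \<le> 2 * k"
  shows "insert_cup t p \<in> TL_diagrams (Suc k)"
proof (rule TL_diagramsI)
  fix X assume "X \<in> insert_cup t p"
  then consider "X = {t + 1, t + 2}" | Y where "Y \<in> p" "X = skip2 t ` Y"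
    by (auto simp: insert_cup_def)
  then show "\<exists>a b. X = {a, b} \<and> a < b \<and> a \<in> {1..2 * Suc k} \<and> b \<in> {1..2 * Suc k}"
  proof cases
    case 1
    then show ?thesis using assms(2) by (intro exI[of _ "t + 1"] exI[of _ "t + 2"]) auto
  next
    case 2
    obtain a b where Y: "Y = {a, b}" "a < b" using TL_diagram_block[OF assms(1) 2(1)] by blast
    then have "a \<in> {1..2 * k}" "b \<in> {1..2 * k}" using TL_diagram_range[OF assms(1)] 2 by blast+
    then show ?thesis using 2 Y skip2_range[OF assms(2)]
      by (intro exI[of _ "skip2 t a"] exI[of _ "skip2 t b"]) simp
  qed
next
  fix a b c assume "{a, b} \<in> insert_cup t p" "{a, c} \<in> insert_cup t p"
  then show "b = c"
    unfolding insert_cup_iff[OF assms(1)]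
  proof (elim disjE exE conjE)
    fix a1 b1 a2 c2 assume "a = skip2 t a1" "b = skip2 t b1" "{a1, b1} \<in> p"
      "a = skip2 t a2" "c = skip2 t c2" "{a2, c2} \<in> p"
    then show ?thesis using TL_diagram_unique[OF assms(1), of a1 b1 c2] by simp
  qed (auto simp: doubleton_eq_iff)
next
  fix j assume j: "j \<in> {1..2 * Suc k}"
  show "\<exists>b. {j, b} \<in> insert_cup t p"
  proof (cases j t rule: skip2_cases)
    case (3 i)
    then obtain i' where "{i, i'} \<in> p"
      using TL_diagram_partner[OF assms(1)] j skip2_range[OF assms(2)] by blast
    then show ?thesis unfolding insert_cup_iff[OF assms(1)] 3 by blast
  next
    case 1
    then show ?thesis unfolding insert_cup_def by blast
  next
    case 2
    then have "{j, t + 1} = {t + 1, t + 2}" by auto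
    then show ?thesis unfolding insert_cup_def by blast
  qed
next
  fix a b c d assume *: "a < b" "b < c" "c < d" "{a, c} \<in> insert_cup t p" "{b, d} \<in> insert_cup t p"
  then have ne: "{a, c} \<noteq> {t + 1, t + 2}" "{b, d} \<noteq> {t + 1, t + 2}"
    by (auto simp: doubleton_eq_iff)
  obtain a' c' where "a = skip2 t a'" "c = skip2 t c'" "{a', c'} \<in> p"
    using *(4) ne(1) unfolding insert_cup_iff[OF assms(1)] by blast
  moreover obtain b' d' where "b = skip2 t b'" "d = skip2 t d'" "{b', d'} \<in> p"
    using *(5) ne(2) unfolding insert_cup_iff[OF assms(1)] by blast
  ultimately show False using *(1-3) TL_diagram_noncrossing[OF assms(1), of a' b' c' d'] by simp
qed

text \<open>Descent on the width of a pair: if {a, b} is not adjacent, the partner of a + 1 lies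
  strictly inside, which gives a narrower pair.\<close>

lemma TL_diagram_adjacent:
  assumes p: "p \<in> TL_diagrams (Suc k)"
  obtains t where "t \<le> 2 * k" "{t + 1, t + 2} \<in> p"
proof -
  have "\<exists>t. {t + 1, t + 2} \<in> p" if "{a, b} \<in> p" "a < b" for a b
    using that
  proof (induction "b - a" arbitrary: a b rule: less_induct)
    case less
    show ?case
    proof (cases "b = a + 1")
      case True
      have "a \<ge> 1" using TL_diagram_range[OF p less.prems(1)] by simp
      then have "{a - 1 + 1, a - 1 + 2} = {a, b}" using True by simp
      with less.prems(1) show ?thesis by metis
    next
      case False
      with less.prems have c: "a < a + 1" "a + 1 < b" by auto
      moreover have "a + 1 \<in> {1..2 * Suc k}" using TL_diagram_range[OF p less.prems(1)] c by auto
      ultimately obtain d where d: "{a + 1, d} \<in> p" using TL_diagram_partner[OF p] by blast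
      then have "a < d" "d < b" using TL_diagram_inside[OF p less.prems(1) c] by blast+
      moreover have "d \<noteq> a + 1" using TL_diagram_neq[OF p d] by blast
      ultimately show ?thesis using less.hyps[of d "a + 1"] d by simp
    qed
  qed
  moreover obtain b where "{1, b} \<in> p" "1 < b"
  proof -
    obtain b where "{1, b} \<in> p" using TL_diagram_partner[OF p, of 1] by auto
    moreover from this have "1 < b" using TL_diagram_range[OF p, of 1 b] TL_diagram_neq[OF p, of 1 b] by force
    ultimately show thesis using that by blast
  qed
  ultimately obtain t where t: "{t + 1, t + 2} \<in> p" by blast
  from TL_diagram_range[OF p t] have "t \<le> 2 * k" by simp
  then show thesis using t by (rule that)
qed

lemma insert_cup_exists:
  assumes p: "p \<in> TL_diagrams (Suc k)" and t: "t \<le> 2 * k" "{t + 1, t + 2} \<in> p"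
  obtains q where "q \<in> TL_diagrams k" "p = insert_cup t q"
proof -
  define q where "q = {{a, b} | a b. {skip2 t a, skip2 t b} \<in> p}"
  have q_iff: "{a, b} \<in> q \<longleftrightarrow> {skip2 t a, skip2 t b} \<in> p" for a b
    unfolding q_def by (auto simp: doubleton_eq_iff insert_commute)
  \<comment> \<open>The only points missed by \<open>skip2 t\<close> are \<open>t + 1\<close> and
    \<open>t + 2\<close>, which are matched with each other.\<close>
  have partner: "\<exists>j. b = skip2 t j" if "{skip2 t i, b} \<in> p" for i b
  proof (cases b t rule: skip2_cases)
    case 1
    then have "{t + 1, skip2 t i} \<in> p" using that by (metis insert_commute)
    from TL_diagram_unique[OF p this t(2)] show ?thesis by simp
  next
    case 2
    then have "{t + 2, skip2 t i} \<in> p" "{t + 2, t + 1} \<in> p" using that t(2) by (metis insert_commute)+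
    from TL_diagram_unique[OF p this] show ?thesis by simp
  qed blast
  have q: "q \<in> TL_diagrams k"
  proof (rule TL_diagramsI)
    fix X assume "X \<in> q"
    then obtain a b where X: "X = {a, b}" "{skip2 t a, skip2 t b} \<in> p" by (auto simp: q_def)
    then have "a \<in> {1..2 * k}" "b \<in> {1..2 * k}" "a \<noteq> b"
      using TL_diagram_range[OF p X(2)] TL_diagram_neq[OF p X(2)] skip2_range[OF t(1)] by blast+
    then show "\<exists>a b. X = {a, b} \<and> a < b \<and> a \<in> {1..2 * k} \<and> b \<in> {1..2 * k}"
      using X(1) by (metis insert_commute linorder_neqE_nat)
  next
    fix a b c assume "{a, b} \<in> q" "{a, c} \<in> q"
    then show "b = c" unfolding q_iff using TL_diagram_unique[OF p] by fastforce
  next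
    fix a assume "a \<in> {1..2 * k}"
    then obtain b where "{skip2 t a, b} \<in> p"
      using TL_diagram_partner[OF p] skip2_range[OF t(1)] by blast
    then show "\<exists>b. {a, b} \<in> q" unfolding q_iff using partner by blast
  next
    fix a b c d assume "a < b" "b < c" "c < d" "{a, c} \<in> q" "{b, d} \<in> q"
    then show False unfolding q_iff
      using TL_diagram_noncrossing[OF p, of "skip2 t a" "skip2 t b" "skip2 t c" "skip2 t d"] by simp
  qed
  have mem_iff: "{a, b} \<in> p \<longleftrightarrow> {a, b} \<in> insert_cup t q" for a b
  proof
    assume ab: "{a, b} \<in> p"
    show "{a, b} \<in> insert_cup t q"
    proof (cases a t rule: skip2_cases)
      case 1
      then have "b = t + 2" using ab t(2) TL_diagram_unique[OF p] by blast
      with 1 show ?thesis by (simp add: insert_cup_def)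
    next
      case 2
      then have "b = t + 1" using ab t(2) TL_diagram_unique[OF p, of a] by (metis insert_commute)
      with 2 show ?thesis by (simp add: insert_cup_def insert_commute)
    next
      case (3 i)
      then obtain j where "b = skip2 t j" using partner ab by blast
      with 3 ab show ?thesis unfolding insert_cup_iff[OF q] q_iff by blast
    qed
  next
    assume "{a, b} \<in> insert_cup t q"
    then show "{a, b} \<in> p" unfolding insert_cup_iff[OF q] q_iff
    proof (elim disjE exE conjE)
      assume "{a, b} = {t + 1, t + 2}"
      with t(2) show ?thesis by metis
    qed simp
  qed
  have "p = insert_cup t q"
  proof (rule set_eqI)
    fix X
    show "X \<in> p \<longleftrightarrow> X \<in> insert_cup t q"
    proof (cases "\<exists>a b. X = {a, b}")
      case True
      then show ?thesis using mem_iff by blast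
    next
      case False
      then show ?thesis
        using TL_diagram_block[OF p] TL_diagram_block[OF insert_cup_diagram[OF q t(1)]] by blast
    qed
  qed
  with q show thesis using that by blast
qed

lemma TL_diagrams_induct [consumes 1, case_names empty insert]:
  assumes "p \<in> TL_diagrams k" and "P 0 {}"
    and "\<And>k p t. p \<in> TL_diagrams k \<Longrightarrow> P k p \<Longrightarrow> t \<le> 2 * k \<Longrightarrow> P (Suc k) (insert_cup t p)"
  shows "P k p"
  using assms(1)
proof (induction k arbitrary: p)
  case 0
  then show ?case using assms(2) by (simp add: TL_diagrams_0)
next
  case (Suc k)
  from TL_diagram_adjacent[OF Suc.prems] obtain t where t: "t \<le> 2 * k" "{t + 1, t + 2} \<in> p" .
  from insert_cup_exists[OF Suc.prems t] obtain q where "q \<in> TL_diagrams k" "p = insert_cup t q" .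
  with assms(3) Suc.IH t(1) show ?case by simp
qed

text \<open>The inserted pair is consecutive, and all other points move by 0 or 2.\<close>

lemma TL_diagram_parity: "p \<in> TL_diagrams k \<Longrightarrow> {a, b} \<in> p \<Longrightarrow> even a \<longleftrightarrow> odd b"
proof (induction arbitrary: a b rule: TL_diagrams_induct)
  case (insert k p t)
  from insert.prems[unfolded insert_cup_iff[OF insert.hyps(1)]] show ?case
  proof (elim disjE exE conjE)
    fix a' b' assume "a = skip2 t a'" "b = skip2 t b'" "{a', b'} \<in> p"
    with insert.IH[of a' b'] show ?thesis by (auto simp: skip2_def)
  qed (auto simp: doubleton_eq_iff)
qed simp

section \<open>Diagram vectors as a spanning family\<close>

definition diagram_vector :: "nat \<Rightarrow> nat \<Rightarrow> nat set set \<Rightarrow> nat list \<Rightarrow> real" where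
  "diagram_vector n k p x =
    of_bool (x \<in> words n (2 * k) \<and> (\<forall>a b. {a, b} \<in> p \<longrightarrow> x ! (a - 1) = x ! (b - 1)))"

lemma diagram_vector_outside: "x \<notin> words n (2 * k) \<Longrightarrow> diagram_vector n k p x = 0"
  by (simp add: diagram_vector_def)

lemma diagram_vector_insert_cup:
  assumes p: "p \<in> TL_diagrams k" and t: "t \<le> 2 * k"
  shows "diagram_vector n (Suc k) (insert_cup t p) = cup n t (diagram_vector n k p)"
proof
  fix x
  show "diagram_vector n (Suc k) (insert_cup t p) x = cup n t (diagram_vector n k p) x"
  proof (cases "length x = 2 * Suc k")
    case False
    then show ?thesis
      by (cases x t rule: cup_cases) (simp_all add: diagram_vector_def words_def cup_short cup_append)
  next
    case True
    then obtain u a b v where x: "x = u @ a # b # v" "length u = t"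
      using t by (metis add_mono1 length_ge_append2 mult_Suc_right add.commute add_le_cancel_right)
    \<comment> \<open>Diagram points count from 1 and list indices from 0, hence the subtraction and
      the restriction to positive \<open>i\<close>.\<close>
    have nth: "x ! (skip2 t i - 1) = (u @ v) ! (i - 1)" if "1 \<le> i" for i
      using that x by (auto simp: skip2_def nth_append nth_Cons' not_le) 
    have "(\<forall>i j. {i, j} \<in> insert_cup t p \<longrightarrow> x ! (i - 1) = x ! (j - 1)) \<longleftrightarrow>
        a = b \<and> (\<forall>i j. {i, j} \<in> p \<longrightarrow> (u @ v) ! (i - 1) = (u @ v) ! (j - 1))"
    proof (intro iffI conjI allI impI)
      assume *: "\<forall>i j. {i, j} \<in> insert_cup t p \<longrightarrow> x ! (i - 1) = x ! (j - 1)"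
      have "{t + 1, t + 2} \<in> insert_cup t p" by (simp add: insert_cup_def)
      with * have "x ! (t + 1 - 1) = x ! (t + 2 - 1)" by blast
      then show "a = b" using x by (simp add: nth_append)
      fix i j assume ij: "{i, j} \<in> p"
      then have "{skip2 t i, skip2 t j} \<in> insert_cup t p" unfolding insert_cup_iff[OF p] by blast
      with * have "x ! (skip2 t i - 1) = x ! (skip2 t j - 1)" by blast
      then show "(u @ v) ! (i - 1) = (u @ v) ! (j - 1)"
        using TL_diagram_range[OF p ij] nth[of i] nth[of j] by simp
    next
      assume *: "a = b \<and> (\<forall>i j. {i, j} \<in> p \<longrightarrow> (u @ v) ! (i - 1) = (u @ v) ! (j - 1))"
      fix i j assume "{i, j} \<in> insert_cup t p"
      then show "x ! (i - 1) = x ! (j - 1)" unfolding insert_cup_iff[OF p]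
      proof (elim disjE exE conjE)
        assume "{i, j} = {t + 1, t + 2}"
        moreover have "x ! (t + 1 - 1) = x ! (t + 2 - 1)" using * x by (simp add: nth_append)
        ultimately show ?thesis by (auto simp: doubleton_eq_iff)
      next
        fix i' j' assume ij: "i = skip2 t i'" "j = skip2 t j'" "{i', j'} \<in> p"
        with * have "(u @ v) ! (i' - 1) = (u @ v) ! (j' - 1)" by blast
        then show ?thesis
          using TL_diagram_range[OF p ij(3)] nth[of i'] nth[of j'] ij(1,2) by simp
      qed
    qed
    then show ?thesis using x True by (auto simp: diagram_vector_def cup_append words_def)
  qed
qed

lemma TL_diagram_vector: "p \<in> TL_diagrams k \<Longrightarrow> TL n (2 * k) (diagram_vector n k p)"
proof (induction rule: TL_diagrams_induct)
  case empty
  have "diagram_vector n 0 {} = (\<lambda>x. of_bool (x = []))"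
    by (auto simp: diagram_vector_def)
  then show ?case using TL.unit by simp
next
  case (insert k p t)
  then show ?case using TL.cup[of n "2 * k" _ t] by (simp add: diagram_vector_insert_cup)
qed

lemma TL_span:
  "TL n l \<xi> \<Longrightarrow> l = 2 * k \<Longrightarrow> \<exists>c. \<forall>x. \<xi> x = (\<Sum>p\<in>TL_diagrams k. c p * diagram_vector n k p x)"
proof (induction arbitrary: k rule: TL.induct)
  case unit
  then show ?case by (intro exI[of _ "\<lambda>_. 1"]) (auto simp: TL_diagrams_0 diagram_vector_def)
next
  case (zero l)
  show ?case by (intro exI[of _ "\<lambda>_. 0"]) simp
next
  case (add l \<xi> \<eta>)
  then obtain c d where "\<And>x. \<xi> x = (\<Sum>p\<in>TL_diagrams k. c p * diagram_vector n k p x)"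
    "\<And>x. \<eta> x = (\<Sum>p\<in>TL_diagrams k. d p * diagram_vector n k p x)" by metis
  then show ?case by (intro exI[of _ "\<lambda>p. c p + d p"]) (simp add: distrib_right sum.distrib)
next
  case (scale l \<xi> c)
  then obtain d where "\<And>x. \<xi> x = (\<Sum>p\<in>TL_diagrams k. d p * diagram_vector n k p x)" by metis
  then show ?case by (intro exI[of _ "\<lambda>p. c * d p"]) (simp add: sum_distrib_left mult.assoc)
next
  case (cup l \<xi> t)
  then obtain k' where k: "k = Suc k'" "l = 2 * k'" by (cases k) auto
  obtain d where d: "\<And>x. \<xi> x = (\<Sum>p\<in>TL_diagrams k'. d p * diagram_vector n k' p x)"
    using cup.IH[OF k(2)] by blast
  have t: "t \<le> 2 * k'" using cup.hyps k by simp
  \<comment> \<open>Coefficients are collected over the fibres of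
    \<open>insert_cup t\<close>.\<close>
  define c where "c q = (\<Sum>p | p \<in> TL_diagrams k' \<and> insert_cup t p = q. d p)" for q
  have "cup n t \<xi> x = (\<Sum>q\<in>TL_diagrams k. c q * diagram_vector n k q x)" for x
  proof -
    have "cup n t \<xi> x = (\<Sum>p\<in>TL_diagrams k'. d p * cup n t (diagram_vector n k' p) x)"
      by (cases x t rule: cup_cases) (auto simp: cup_short cup_append d intro!: sum.neutral)
    also have "\<dots> = (\<Sum>p\<in>TL_diagrams k'. d p * diagram_vector n k (insert_cup t p) x)"
      by (intro sum.cong refl) (simp add: diagram_vector_insert_cup t k)
    also have "\<dots> = (\<Sum>q\<in>TL_diagrams k. \<Sum>p | p \<in> TL_diagrams k' \<and> insert_cup t p = q.
        d p * diagram_vector n k (insert_cup t p) x)"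
      by (intro sum.group[symmetric]) (auto simp: k insert_cup_diagram t)
    also have "\<dots> = (\<Sum>q\<in>TL_diagrams k. c q * diagram_vector n k q x)"
      unfolding c_def sum_distrib_right by (intro sum.cong refl) auto
    finally show ?thesis .
  qed
  then show ?case by blast
qed

section \<open>Linear independence by triangularity in the openers\<close>

definition openers :: "nat set set \<Rightarrow> nat set" where
  "openers p = {a. \<exists>b. {a, b} \<in> p \<and> a < b}"

lemma openers_subset: "p \<in> TL_diagrams k \<Longrightarrow> openers p \<subseteq> {1..2 * k}"
  using TL_diagram_range unfolding openers_def by blast

lemma openers_block:
  assumes "p \<in> TL_diagrams k" "{a, b} \<in> p" "a < b"
  shows "a \<in> openers p" "b \<notin> openers p"
proof -
  show "a \<in> openers p" using assms(2,3) by (auto simp: openers_def)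
  have "c = a" if "{b, c} \<in> p" for c
    using TL_diagram_unique[OF assms(1) that, of a] assms(2) by (simp add: insert_commute)
  then show "b \<notin> openers p" using assms(3) by (auto simp: openers_def)
qed

text \<open>A bracket word determines its matching. By induction on the width, all points strictly
  between a and b are matched among themselves in \<open>q\<close> too. So the
  \<open>q\<close>-partner c of b is not among them; if c < a, the \<open>q\<close>-partner of a
  would cross {c, b} or lie strictly between a and b.\<close>

lemma openers_eq_imp_mem:
  assumes p: "p \<in> TL_diagrams k" and q: "q \<in> TL_diagrams k" and eq: "openers p = openers q"
  shows "{a, b} \<in> p \<Longrightarrow> a < b \<Longrightarrow> {a, b} \<in> q"
proof (induction "b - a" arbitrary: a b rule: less_induct)
  case less
  note ab = less.prems
  have swap: "{x, y} \<in> r \<longleftrightarrow> {y, x} \<in> r" for x y :: nat and r by (simp add: insert_commute)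
  have inside: "\<exists>d. {c, d} \<in> q \<and> a < d \<and> d < b" if c: "a < c" "c < b" for c
  proof -
    have "c \<in> {1..2 * k}" using c TL_diagram_range[OF p ab(1)] by auto
    then obtain d where d: "{c, d} \<in> p" using TL_diagram_partner[OF p] by blast
    have d': "a < d" "d < b" using TL_diagram_inside[OF p ab(1) c d] by blast+
    have "c \<noteq> d" using TL_diagram_neq[OF p d] .
    then have "{c, d} \<in> q"
      using less.hyps[of d c] less.hyps[of c d] c d d' swap[of c d] by (cases "c < d") auto
    with d' show ?thesis by blast
  qed
  have a: "a \<in> openers q" and b: "b \<notin> openers q" using openers_block[OF p ab] eq by simp_all
  obtain c where c: "{b, c} \<in> q"
    using TL_diagram_partner[OF q] TL_diagram_range[OF p ab(1)] by blast
  have "c < b" using b c TL_diagram_neq[OF q c] unfolding openers_def by force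
  consider "c = a" | "a < c" | "c < a" by linarith
  then show ?case
  proof cases
    case 1
    then show ?thesis using c swap by blast
  next
    case 2
    then obtain d where d: "{c, d} \<in> q" "d < b" using inside \<open>c < b\<close> by blast
    have "d = b" using TL_diagram_unique[OF q d(1)] c swap by blast
    with d(2) show ?thesis by simp
  next
    case 3
    obtain d where d: "{a, d} \<in> q" "a < d" using a unfolding openers_def by blast
    have "d \<noteq> b" using TL_diagram_unique[OF q c, of a] d(1) swap[of a d] 3 by auto
    moreover have "\<not> b < d"
      using TL_diagram_noncrossing[OF q 3 ab(2) _ _ d(1)] c swap[of b c] by blast
    ultimately have "d < b" by linarith
    then obtain e where e: "{d, e} \<in> q" "a < e" using inside d(2) by blast
    have "e = a" using TL_diagram_unique[OF q e(1)] d(1) swap by blast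
    with e(2) show ?thesis by simp
  qed
qed

lemma openers_inj:
  assumes p: "p \<in> TL_diagrams k" and q: "q \<in> TL_diagrams k" and eq: "openers p = openers q"
  shows "p = q"
proof (intro equalityI subsetI)
  fix X assume "X \<in> p"
  moreover from TL_diagram_block[OF p this] obtain a b where "X = {a, b}" "a < b" by blast
  ultimately show "X \<in> q" using openers_eq_imp_mem[OF p q eq] by blast
next
  fix X assume "X \<in> q"
  moreover from TL_diagram_block[OF q this] obtain a b where "X = {a, b}" "a < b" by blast
  ultimately show "X \<in> p" using openers_eq_imp_mem[OF q p eq[symmetric]] by blast
qed

text \<open>The word of \<open>q\<close> colours openers and closers differently; flipping the colours at even positions
  turns the condition \<open>equal colours\<close> on a pair, which joins positions of different parity, into
  \<open>one opener and one closer of q\<close>.\<close>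

definition opener_word :: "nat \<Rightarrow> nat set set \<Rightarrow> nat list" where
  "opener_word k q = map (\<lambda>i. if (i \<in> openers q) = even i then 1 else 2) [1..<Suc (2 * k)]"

lemma opener_word_in_words: "n \<ge> 2 \<Longrightarrow> opener_word k q \<in> words n (2 * k)"
  by (auto simp: opener_word_def words_def)

lemma diagram_vector_opener_word:
  assumes "p \<in> TL_diagrams k" "n \<ge> 2"
  shows "diagram_vector n k p (opener_word k q) =
    of_bool (\<forall>a b. {a, b} \<in> p \<longrightarrow> (a \<in> openers q) \<noteq> (b \<in> openers q))"
proof -
  have "opener_word k q ! (a - 1) = opener_word k q ! (b - 1) \<longleftrightarrow> (a \<in> openers q) \<noteq> (b \<in> openers q)"
    if ab: "{a, b} \<in> p" for a b
  proof -
    have nth: "opener_word k q ! (i - 1) = (if (i \<in> openers q) = even i then 1 else 2)" if "i \<in> {1..2 * k}" for i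
    proof -
      from that obtain j where "i = Suc j" "j < 2 * k" by (cases i) auto
      then show ?thesis by (simp add: opener_word_def del: upt_Suc)
    qed
    show ?thesis
      using nth[of a] nth[of b] TL_diagram_range[OF assms(1) ab] TL_diagram_parity[OF assms(1) ab] by auto
  qed
  then show ?thesis
    using opener_word_in_words[OF assms(2)] by (auto simp: diagram_vector_def)
qed

text \<open>A pair of \<open>p\<close> contains one opener of \<open>q\<close>, which is at least its opener in \<open>p\<close>.\<close>

lemma sum_openers_less:
  assumes p: "p \<in> TL_diagrams k" and q: "q \<in> TL_diagrams k" and "p \<noteq> q"
    and compat: "\<And>a b. {a, b} \<in> p \<Longrightarrow> (a \<in> openers q) \<noteq> (b \<in> openers q)"
  shows "\<Sum>(openers p) < \<Sum>(openers q)"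
proof -
  \<comment> \<open>Both sums are split along the blocks of \<open>p\<close>, also for the openers
    of \<open>q\<close>, so that they can be compared block by block.\<close>
  have sum_eq: "\<Sum>(openers r) = (\<Sum>X\<in>p. \<Sum>i\<in>X. if i \<in> openers r then i else 0)" if r: "r \<in> TL_diagrams k" for r
  proof -
    have "\<Sum>(openers r) = (\<Sum>i\<in>{1..2 * k}. if i \<in> openers r then i else 0)"
      using openers_subset[OF r] by (simp add: sum.If_cases Int_absorb1)
    also have "{1..2 * k} = \<Union>p" using partition_onD1[OF TL_diagram_partition[OF p]] .
    also have "(\<Sum>i\<in>\<Union>p. if i \<in> openers r then i else 0) = (\<Sum>X\<in>p. \<Sum>i\<in>X. if i \<in> openers r then i else 0)"
    proof (subst sum.Union_disjoint)
      show "\<forall>A\<in>p. finite A"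
      proof
        fix A assume "A \<in> p"
        then obtain a b where "A = {a, b}" using TL_diagram_block[OF p] by blast
        then show "finite A" by simp
      qed
      show "\<forall>A\<in>p. \<forall>B\<in>p. A \<noteq> B \<longrightarrow> A \<inter> B = {}"
        using disjointD[OF partition_onD2[OF TL_diagram_partition[OF p]]] by blast
    qed simp
    finally show ?thesis .
  qed
  have fin: "finite p"
  proof (rule finite_UnionD)
    show "finite (\<Union>p)" unfolding partition_onD1[OF TL_diagram_partition[OF p], symmetric] by simp
  qed
  have block_p: "(\<Sum>i\<in>{a, b}. if i \<in> openers p then i else 0) = a" if "{a, b} \<in> p" "a < b" for a b
    using openers_block[OF p that] that(2) by simp
  have block_q: "(\<Sum>i\<in>{a, b}. if i \<in> openers q then i else 0) = (if a \<in> openers q then a else b)"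
    if "{a, b} \<in> p" "a < b" for a b
    using compat[OF that(1)] that(2) by auto
  have "\<exists>X\<in>p. (\<Sum>i\<in>X. if i \<in> openers p then i else 0) < (\<Sum>i\<in>X. if i \<in> openers q then i else 0)"
  proof (rule ccontr)
    assume "\<not> ?thesis"
    then have le: "(\<Sum>i\<in>X. if i \<in> openers q then i else 0) \<le> (\<Sum>i\<in>X. if i \<in> openers p then i else 0)"
      if "X \<in> p" for X using that not_less by blast
    have a: "a \<in> openers q" if "{a, b} \<in> p" "a < b" for a b
      using le[OF that(1)] that(2) unfolding block_p[OF that] block_q[OF that] by (simp split: if_splits)
    have "openers p = openers q"
    proof (intro equalityI subsetI)
      fix i assume "i \<in> openers p"
      then show "i \<in> openers q" using a unfolding openers_def by blast
    next
      fix i assume i: "i \<in> openers q"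
      then obtain j where j: "{i, j} \<in> p" using openers_subset[OF q] TL_diagram_partner[OF p] by blast
      have "j \<notin> openers q" using compat[OF j] i by simp
      then have "\<not> j < i" using a[of j i] j by (auto simp: insert_commute)
      then have "i < j" using TL_diagram_neq[OF p j] by simp
      with j show "i \<in> openers p" unfolding openers_def by blast
    qed
    with openers_inj[OF p q] assms(3) show False by blast
  qed
  moreover have "(\<Sum>i\<in>X. if i \<in> openers p then i else 0) \<le> (\<Sum>i\<in>X. if i \<in> openers q then i else 0)"
    if X: "X \<in> p" for X
  proof -
    obtain a b where ab: "X = {a, b}" "a < b" using TL_diagram_block[OF p X] by blast
    with X show ?thesis using block_p[of a b] block_q[of a b] by simp
  qed
  ultimately show ?thesis
    unfolding sum_eq[OF p] sum_eq[OF q] by (intro sum_strict_mono_ex1[OF fin]) auto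
qed

text \<open>Among the diagrams with nonzero coefficient, take \<open>q\<close> with the least sum of
  openers. Any other such diagram whose vector is nonzero at the word of \<open>q\<close> would have
  a smaller sum, so only the term of \<open>q\<close> survives there.\<close>

lemma diagram_vectors_independent:
  assumes "n \<ge> 2" "\<exists>p\<in>TL_diagrams k. c p \<noteq> 0"
  shows "\<exists>x\<in>words n (2 * k). (\<Sum>p\<in>TL_diagrams k. c p * diagram_vector n k p x) \<noteq> 0"
proof -
  define A where "A = {p \<in> TL_diagrams k. c p \<noteq> 0}"
  have A: "finite A" "A \<noteq> {}" using assms(2) by (auto simp: A_def)
  then obtain q where q: "q \<in> A" "\<And>p. p \<in> A \<Longrightarrow> \<Sum>(openers q) \<le> \<Sum>(openers p)"
    using ex_min_if_finite[of "(\<lambda>p. \<Sum>(openers p)) ` A"] by (auto simp: not_less)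
  then have qk: "q \<in> TL_diagrams k" "c q \<noteq> 0" by (auto simp: A_def)
  have "c p * diagram_vector n k p (opener_word k q) = (if p = q then c q else 0)" if p: "p \<in> TL_diagrams k" for p
  proof (cases "p = q")
    case True
    have "(a \<in> openers q) \<noteq> (b \<in> openers q)" if ab: "{a, b} \<in> q" for a b
    proof -
      consider "a < b" | "b < a" using TL_diagram_neq[OF qk(1) ab] by linarith
      then show ?thesis
        using openers_block[OF qk(1), of a b] openers_block[OF qk(1), of b a] ab
        by cases (auto simp: insert_commute)
    qed
    then show ?thesis using True p assms(1) by (simp add: diagram_vector_opener_word)
  next
    case False
    have "\<not> (\<forall>a b. {a, b} \<in> p \<longrightarrow> (a \<in> openers q) \<noteq> (b \<in> openers q))" if "c p \<noteq> 0"
      using sum_openers_less[OF p qk(1) False] q(2)[of p] p that by (auto simp: A_def not_less[symmetric])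
    then show ?thesis
      using False p assms(1) by (auto simp: diagram_vector_opener_word)
  qed
  then have "(\<Sum>p\<in>TL_diagrams k. c p * diagram_vector n k p (opener_word k q)) = c q"
    using qk(1) by simp
  with qk(2) opener_word_in_words[OF assms(1)] show ?thesis by metis
qed

text \<open>A word compatible with all pairs of both diagrams is constant on each connected
  component, so such words correspond to free choices of a letter for every loop.\<close>

lemma card_loop_colourings:
  assumes p: "p \<in> TL_diagrams k" and q: "q \<in> TL_diagrams k"
  shows "card {x \<in> words s (2 * k). \<forall>i j. {i, j} \<in> p \<union> q \<longrightarrow> x ! (i - 1) = x ! (j - 1)} = s ^ loops k p q"
    (is "card ?W = _")
proof -
  define R where "R = {(x, y). {x, y} \<in> p \<union> q}"
  define Q where "Q = {1..2 * k} // R\<^sup>*"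
  define f where "f g = map (\<lambda>i. g (R\<^sup>* `` {i})) [1..<Suc (2 * k)]" for g :: "nat set \<Rightarrow> nat"
  have R_range: "i \<in> {1..2 * k}" "j \<in> {1..2 * k}" if "(i, j) \<in> R" for i j
    using that TL_diagram_range[OF p] TL_diagram_range[OF q] by (auto simp: R_def)
  have "sym R" by (auto simp: sym_def R_def insert_commute)
  then have sym: "sym (R\<^sup>*)" by (rule sym_rtrancl)
  have class_eq: "R\<^sup>* `` {i} = R\<^sup>* `` {j}" if "(i, j) \<in> R\<^sup>*" for i j
    using that symD[OF sym] by (auto intro: rtrancl_trans)
  have class_mem: "(i, j) \<in> R\<^sup>*" if "R\<^sup>* `` {i} = R\<^sup>* `` {j}" for i j
  proof -
    have "j \<in> R\<^sup>* `` {j}" by simp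
    then show ?thesis unfolding that[symmetric] by simp
  qed
  have class_in: "R\<^sup>* `` {i} \<in> Q" if "i \<in> {1..2 * k}" for i
    using that by (simp add: Q_def quotientI)
  have f_nth: "f g ! (i - 1) = g (R\<^sup>* `` {i})" if "i \<in> {1..2 * k}" for g i
  proof -
    from that obtain j where "i = Suc j" "j < 2 * k" by (cases i) auto
    then show ?thesis by (simp add: f_def del: upt_Suc)
  qed
  have "bij_betw f (Q \<rightarrow>\<^sub>E {1..s}) ?W"
  proof (rule bij_betwI')
    fix g g' assume g: "g \<in> Q \<rightarrow>\<^sub>E {1..s}" and g': "g' \<in> Q \<rightarrow>\<^sub>E {1..s}"
    have "g = g'" if eq: "f g = f g'"
    proof (rule PiE_ext[OF g g'])
      fix C assume "C \<in> Q"
      then obtain i where "i \<in> {1..2 * k}" "C = R\<^sup>* `` {i}" unfolding Q_def by (rule quotientE)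
      then show "g C = g' C" using f_nth[of i g] f_nth[of i g'] eq by simp
    qed
    then show "f g = f g' \<longleftrightarrow> g = g'" by blast
  next
    fix g assume g: "g \<in> Q \<rightarrow>\<^sub>E {1..s}"
    have "f g \<in> words s (2 * k)"
      using g class_in by (auto simp: f_def words_def PiE_iff)
    moreover have "f g ! (i - 1) = f g ! (j - 1)" if "{i, j} \<in> p \<union> q" for i j
    proof -
      have "(i, j) \<in> R" using that by (simp add: R_def)
      then have "R\<^sup>* `` {i} = R\<^sup>* `` {j}" "i \<in> {1..2 * k}" "j \<in> {1..2 * k}"
        using class_eq[OF r_into_rtrancl] R_range by blast+
      then show ?thesis using f_nth[of i g] f_nth[of j g] by simp
    qed
    ultimately show "f g \<in> ?W" by blast
  next
    fix x assume x: "x \<in> ?W"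
    have const: "x ! (i - 1) = x ! (j - 1)" if "(i, j) \<in> R\<^sup>*" for i j
      using that by (induction rule: rtrancl_induct) (use x in \<open>auto simp: R_def\<close>)
    define g where "g = restrict (\<lambda>C. x ! ((SOME i. i \<in> {1..2 * k} \<and> C = R\<^sup>* `` {i}) - 1)) Q"
    have g: "g (R\<^sup>* `` {i}) = x ! (i - 1)" if i: "i \<in> {1..2 * k}" for i
    proof -
      let ?j = "SOME j. j \<in> {1..2 * k} \<and> R\<^sup>* `` {i} = R\<^sup>* `` {j}"
      have "?j \<in> {1..2 * k} \<and> R\<^sup>* `` {i} = R\<^sup>* `` {?j}"
        by (rule someI[of _ i]) (use i in simp)
      then have "(i, ?j) \<in> R\<^sup>*" using class_mem[of i ?j] by blast
      from const[OF this] show ?thesis using class_in[OF i] by (simp add: g_def)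
    qed
    have "f g = x"
    proof (rule nth_equalityI)
      show "length (f g) = length x" using x by (simp add: f_def words_def del: upt_Suc)
    next
      fix i assume "i < length (f g)"
      then have "i < 2 * k" by (simp add: f_def del: upt_Suc)
      then show "f g ! i = x ! i" using f_nth[of "Suc i" g] g[of "Suc i"] by simp
    qed
    moreover have "g \<in> Q \<rightarrow>\<^sub>E {1..s}"
    proof (rule PiE_I)
      fix C assume "C \<in> Q"
      then obtain i where i: "i \<in> {1..2 * k}" "C = R\<^sup>* `` {i}" unfolding Q_def by (rule quotientE)
      have "x ! (i - 1) \<in> set x" using i(1) x by (intro nth_mem) (auto simp: words_def)
      then show "g C \<in> {1..s}" using x i g by (auto simp: words_def)
    qed (simp add: g_def)
    ultimately show "\<exists>g\<in>Q \<rightarrow>\<^sub>E {1..s}. x = f g" by blast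
  qed
  then have "card ?W = card (Q \<rightarrow>\<^sub>E {1..s})" by (simp add: bij_betw_same_card)
  also have "\<dots> = s ^ card Q"
    by (subst card_PiE) (auto simp: Q_def quotient_def)
  finally show ?thesis by (simp add: loops_def Q_def R_def)
qed

text \<open>One family of vectors serves both Gram matrices: restricting the inner product to words
  in \<open>{1..s}\<close> changes the loop value from \<open>n\<close> to \<open>s\<close>.\<close>

lemma sum_diagram_vectors:
  assumes "p \<in> TL_diagrams k" "q \<in> TL_diagrams k" "s \<le> n"
  shows "(\<Sum>x\<in>words s (2 * k). diagram_vector n k p x * diagram_vector n k q x) = gram k s p q"
proof -
  have "(\<Sum>x\<in>words s (2 * k). diagram_vector n k p x * diagram_vector n k q x) =
      (\<Sum>x\<in>words s (2 * k). of_bool (\<forall>i j. {i, j} \<in> p \<union> q \<longrightarrow> x ! (i - 1) = x ! (j - 1)))"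
  proof (rule sum.cong)
    fix x assume "x \<in> words s (2 * k)"
    then have "x \<in> words n (2 * k)" using assms(3) by (fastforce simp: words_def)
    then show "diagram_vector n k p x * diagram_vector n k q x =
        of_bool (\<forall>i j. {i, j} \<in> p \<union> q \<longrightarrow> x ! (i - 1) = x ! (j - 1))"
      unfolding diagram_vector_def of_bool_conj[symmetric] by (intro arg_cong[of _ _ of_bool]) (simp, blast)
  qed simp
  also have "\<dots> = real (card {x \<in> words s (2 * k). \<forall>i j. {i, j} \<in> p \<union> q \<longrightarrow> x ! (i - 1) = x ! (j - 1)})"
    by (simp add: Collect_conj_eq)
  finally show ?thesis unfolding card_loop_colourings[OF assms(1,2)] by (simp add: gram_def)
qed

lemma gram_commute: "gram k m p q = gram k m q p"
  by (simp add: gram_def loops_def Un_commute)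

text \<open>The form is the squared norm of the corresponding combination of diagram
  vectors.\<close>

lemma gram_positive_definite:
  assumes "n \<ge> 2" "\<exists>p\<in>TL_diagrams k. c p \<noteq> 0"
  shows "0 < (\<Sum>p\<in>TL_diagrams k. c p * (\<Sum>q\<in>TL_diagrams k. gram k n p q * c q))"
proof -
  let ?D = "TL_diagrams k" and ?v = "diagram_vector n k"
  have gram: "gram k n p q = (\<Sum>x\<in>words n (2 * k). ?v p x * ?v q x)" if "p \<in> ?D" "q \<in> ?D" for p q
    using sum_diagram_vectors[OF that order_refl, of n] by simp
  have "(\<Sum>p\<in>?D. c p * (\<Sum>q\<in>?D. gram k n p q * c q)) = (\<Sum>p\<in>?D. \<Sum>q\<in>?D. c p * c q * gram k n p q)"
    by (simp add: sum_distrib_left mult_ac)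
  also have "\<dots> = (\<Sum>p\<in>?D. \<Sum>q\<in>?D. \<Sum>x\<in>words n (2 * k). c p * ?v p x * (c q * ?v q x))"
    by (intro sum.cong refl) (simp add: gram sum_distrib_left mult_ac)
  also have "\<dots> = (\<Sum>x\<in>words n (2 * k). \<Sum>p\<in>?D. \<Sum>q\<in>?D. c p * ?v p x * (c q * ?v q x))"
    by (rule sum_rotate3[symmetric])
  also have "\<dots> = (\<Sum>x\<in>words n (2 * k). (\<Sum>p\<in>?D. c p * ?v p x)\<^sup>2)"
    by (simp add: power2_eq_square sum_product)
  also have "\<dots> > 0"
  proof -
    obtain x where "x \<in> words n (2 * k)" "(\<Sum>p\<in>?D. c p * ?v p x) \<noteq> 0"
      using diagram_vectors_independent[OF assms] by blast
    then show ?thesis by (intro sum_pos2[of _ x]) auto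
  qed
  finally show ?thesis .
qed

section \<open>The Weingarten matrix and its projection\<close>

definition weingarten :: "nat \<Rightarrow> nat \<Rightarrow> nat set set \<Rightarrow> nat set set \<Rightarrow> real" where
  "weingarten n k = mat_inv_on (TL_diagrams k) (gram k n)"

lemma weingarten_inverse:
  assumes "n \<ge> 2" "p \<in> TL_diagrams k" "q \<in> TL_diagrams k"
  shows "(\<Sum>r\<in>TL_diagrams k. weingarten n k p r * gram k n r q) = of_bool (p = q)"
  using positive_definite_mat_inv_on(2)[OF finite_TL_diagrams gram_positive_definite[OF assms(1)] assms(2,3)]
  by (simp add: weingarten_def mat_mult_on_def)

text \<open>W = W G W^T with G symmetric; the two ways of bracketing give the entries at (p, q) and
  (q, p).\<close>

lemma weingarten_commute:
  assumes n: "n \<ge> 2" and p: "p \<in> TL_diagrams k" and q: "q \<in> TL_diagrams k"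
  shows "weingarten n k p q = weingarten n k q p"
proof -
  let ?D = "TL_diagrams k" and ?W = "weingarten n k" and ?G = "gram k n"
  have "?W p q = (\<Sum>r\<in>?D. ?W p r * (\<Sum>t\<in>?D. ?W q t * ?G t r))"
    using q by (simp add: weingarten_inverse[OF n q])
  also have "\<dots> = (\<Sum>t\<in>?D. ?W q t * (\<Sum>r\<in>?D. ?W p r * ?G r t))"
    unfolding sum_distrib_left by (subst sum.swap) (simp add: mult_ac gram_commute)
  also have "\<dots> = ?W q p"
    using p by (simp add: weingarten_inverse[OF n p])
  finally show ?thesis .
qed

text \<open>For odd length, twice \<open>length y div 2\<close> differs from the length and the
  diagram vector vanishes at \<open>y\<close>; this is where the odd moments become 0.\<close>

definition TL_proj :: "nat \<Rightarrow> nat list \<Rightarrow> nat list \<Rightarrow> real" where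
  "TL_proj n x y = (let k = length y div 2 in
     \<Sum>p\<in>TL_diagrams k. \<Sum>q\<in>TL_diagrams k. weingarten n k p q * diagram_vector n k p x * diagram_vector n k q y)"

lemma TL_proj_eq:
  "length y = 2 * k \<Longrightarrow> TL_proj n x y =
    (\<Sum>p\<in>TL_diagrams k. \<Sum>q\<in>TL_diagrams k. weingarten n k p q * diagram_vector n k p x * diagram_vector n k q y)"
  by (simp add: TL_proj_def)

lemma TL_proj_odd: "odd (length y) \<Longrightarrow> TL_proj n x y = 0"
proof -
  assume "odd (length y)"
  then have "length y \<noteq> 2 * (length y div 2)" by (metis dvd_triv_left)
  then have "y \<notin> words n (2 * (length y div 2))" unfolding words_def by blast
  then show ?thesis by (simp add: TL_proj_def Let_def diagram_vector_outside)
qed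

lemma TL_proj_length: "length x \<noteq> length y \<Longrightarrow> TL_proj n x y = 0"
proof (cases "even (length y)")
  case True
  assume "length x \<noteq> length y"
  with True have "x \<notin> words n (2 * (length y div 2))" unfolding words_def by auto
  then show ?thesis by (simp add: TL_proj_def Let_def diagram_vector_outside)
qed (simp add: TL_proj_odd)

theorem TL_projection_TL_proj:
  assumes n: "n \<ge> 2"
  shows "TL_projection n (TL_proj n)"
proof
  fix x y
  show "TL_proj n x y = TL_proj n y x"
  proof (cases "length x = length y \<and> even (length y)")
    case True
    then obtain k where k: "length x = 2 * k" "length y = 2 * k" by auto
    show ?thesis
      unfolding TL_proj_eq[OF k(1)] TL_proj_eq[OF k(2)]
      by (subst sum.swap) (intro sum.cong refl, simp add: weingarten_commute[OF n] mult_ac)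
  next
    case False
    then show ?thesis by (metis TL_proj_length TL_proj_odd)
  qed
next
  fix y
  show "TL n (length y) (\<lambda>x. TL_proj n x y)"
  proof (cases "even (length y)")
    case True
    then obtain k where k: "length y = 2 * k" by blast
    have "TL n (2 * k) (\<lambda>x. \<Sum>p\<in>TL_diagrams k. (\<Sum>q\<in>TL_diagrams k. weingarten n k p q * diagram_vector n k q y) * diagram_vector n k p x)"
      by (intro TL_sum finite_TL_diagrams TL.scale TL_diagram_vector)
    then show ?thesis by (simp add: TL_proj_eq[OF k] k sum_distrib_left sum_distrib_right mult_ac)
  next
    case False
    then show ?thesis by (simp add: TL_proj_odd TL.zero)
  qed
next
  fix l \<xi> x assume \<xi>: "TL n l \<xi>"
  show "(\<Sum>y\<in>words n l. TL_proj n x y * \<xi> y) = \<xi> x"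
  proof (cases "even l")
    case False
    then show ?thesis using TL_odd[OF \<xi>] by simp
  next
    case True
    then obtain k where k: "l = 2 * k" by blast
    let ?D = "TL_diagrams k" and ?v = "diagram_vector n k" and ?W = "weingarten n k"
    have *: "(\<Sum>y\<in>words n l. TL_proj n x y * ?v r y) = ?v r x" if r: "r \<in> ?D" for r
    proof -
      have "(\<Sum>y\<in>words n l. TL_proj n x y * ?v r y) =
          (\<Sum>y\<in>words n l. \<Sum>p\<in>?D. \<Sum>q\<in>?D. ?W p q * ?v p x * (?v q y * ?v r y))"
        by (intro sum.cong refl) (simp add: TL_proj_eq[of _ k] words_def k sum_distrib_left sum_distrib_right mult_ac)
      also have "\<dots> = (\<Sum>p\<in>?D. \<Sum>q\<in>?D. ?W p q * ?v p x * gram k n q r)"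
        by (subst sum_rotate3, intro sum.cong refl)
          (simp add: sum_diagram_vectors r k flip: sum_distrib_left)
      also have "\<dots> = (\<Sum>p\<in>?D. ?v p x * (\<Sum>q\<in>?D. ?W p q * gram k n q r))"
        by (simp add: sum_distrib_left mult_ac)
      also have "\<dots> = ?v r x"
        using r by (simp add: weingarten_inverse[OF n _ r])
      finally show ?thesis .
    qed
    obtain c where c: "\<And>x. \<xi> x = (\<Sum>r\<in>?D. c r * ?v r x)"
      using TL_span[OF \<xi> k] by blast
    have "(\<Sum>y\<in>words n l. TL_proj n x y * \<xi> y) = (\<Sum>r\<in>?D. c r * (\<Sum>y\<in>words n l. TL_proj n x y * ?v r y))"
      unfolding c sum_distrib_left by (subst sum.swap) (simp add: mult_ac)
    also have "\<dots> = \<xi> x" by (simp add: * c)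
    finally show ?thesis .
  qed
qed

section \<open>The Haar functional\<close>

definition gen_prod :: "(nat \<Rightarrow> nat \<Rightarrow> 'a::monoid_mult) \<Rightarrow> nat list \<Rightarrow> nat list \<Rightarrow> 'a" where
  "gen_prod u x y = prod_list (map2 u x y)"

lemma gen_prod_simps [simp]:
  "gen_prod u [] y = 1" "gen_prod u (i # x) (j # y) = u i j * gen_prod u x y"
  by (simp_all add: gen_prod_def)

lemma gen_prod_append:
  "length x = length y \<Longrightarrow> gen_prod u (x @ x') (y @ y') = gen_prod u x y * gen_prod u x' y'"
  by (simp add: gen_prod_def)

definition gen_word :: "nat list \<Rightarrow> nat list \<Rightarrow> (nat \<times> nat) star_word" where
  "gen_word x y = Star_Word (map (\<lambda>z. (z, False)) (zip x y))"

lemma word_val_gen_word: "word_val (\<lambda>(i, j). u i j) (gen_word x y) = gen_prod u x y"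
  by (simp add: gen_word_def word_val_def gen_prod_def o_def case_prod_unfold)

lemma row_word_gen_word: "length x = length y \<Longrightarrow> row_word (gen_word x y) = x"
  and col_word_gen_word: "length x = length y \<Longrightarrow> col_word (gen_word x y) = y"
  by (simp_all add: gen_word_def o_def)

lemma sum_words_Cons: "(\<Sum>x\<in>words n (Suc l). f x) = (\<Sum>a=1..n. \<Sum>x\<in>words n l. f (a # x))"
  by (subst sum_words_insert[of 0]) (simp_all add: sum.swap[of _ "words n l"])

section \<open>Invariance identities for products of generators\<close>

locale A_o_haar =
  fixes n :: nat
    and u :: "nat \<Rightarrow> nat \<Rightarrow> 'a::cstar_algebra"
    and tens :: "'a \<Rightarrow> 'a \<Rightarrow> 't::cstar_algebra"
    and \<Delta> :: "'a \<Rightarrow> 't"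
    and h :: "'a \<Rightarrow> complex"
  assumes A_o: "is_A_o n u"
    and tensor: "is_min_tensor tens"
    and comult: "is_comultiplication n u tens \<Delta>"
    and haar: "is_haar_functional tens \<Delta> h"
begin

lemma rows_orthogonal:
  assumes "i \<in> {1..n}" "j \<in> {1..n}"
  shows "(\<Sum>k=1..n. u k i * u k j) = of_bool (i = j)"
proof -
  let ?r = "(\<Sum>k=1..n. gen (k, i) * gen (k, j)) - of_bool (i = j) :: (nat \<times> nat) free_star_algebra"
  have "?r \<in> orthogonality_relations n"
    using assms unfolding orthogonality_relations_def by blast
  then have zero: "eval_free (\<lambda>(i, j). u i j) ?r = 0"
    using A_o by (auto simp: is_A_o_def universal_cstar_def)
  have "eval_free v ?r + eval_free v (of_bool (i = j)) = eval_free v (\<Sum>k=1..n. gen (k, i) * gen (k, j))"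
    for v :: "nat \<times> nat \<Rightarrow> 'a" by (simp flip: eval_free_add)
  from this[of "\<lambda>(i, j). u i j", unfolded zero eval_free_sum eval_free_mult eval_free_gen]
  show ?thesis by (cases "i = j") simp_all
qed

lemma h_add: "h (a + b) = h a + h b" and h_scaleC: "h (c *\<^sub>C a) = c * h a" and h_one: "h 1 = 1"
  using haar by (auto simp: is_haar_functional_def clinear_def scaleC_complex_def)

lemma h_sum: "h (\<Sum>a\<in>A. f a) = (\<Sum>a\<in>A. h (f a))"
proof -
  have "h 0 = 0" using h_scaleC[of 0 0] by simp
  then show ?thesis by (induction A rule: infinite_finite_induct) (simp_all add: h_add)
qed

lemma h_scaleR: "h (r *\<^sub>R a) = complex_of_real r * h a"
  by (simp add: scaleR_scaleC h_scaleC)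

lemma tens_mult: "tens a b * tens c d = tens (a * c) (b * d)" and tens_one: "tens 1 1 = 1"
  using tensor by (simp_all add: is_min_tensor_def)

lemma comult_gen_prod:
  assumes "x \<in> words n l" "y \<in> words n l"
  shows "\<Delta> (gen_prod u x y) = (\<Sum>z\<in>words n l. tens (gen_prod u x z) (gen_prod u z y))"
  using assms
proof (induction l arbitrary: x y)
  case 0
  then show ?case using comult by (simp add: tens_one is_comultiplication_def star_hom_def)
next
  case (Suc l)
  then obtain i x' j y' where x: "x = i # x'" "i \<in> {1..n}" "x' \<in> words n l"
    and y: "y = j # y'" "j \<in> {1..n}" "y' \<in> words n l"
    by (cases x; cases y) (auto simp: words_def)
  have "\<Delta> (gen_prod u x y) = \<Delta> (u i j) * \<Delta> (gen_prod u x' y')"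
    using comult by (simp add: x y is_comultiplication_def star_hom_def)
  also have "\<dots> = (\<Sum>k=1..n. tens (u i k) (u k j)) * (\<Sum>z\<in>words n l. tens (gen_prod u x' z) (gen_prod u z y'))"
    using comult x y by (simp add: is_comultiplication_def Suc.IH)
  also have "\<dots> = (\<Sum>z\<in>words n (Suc l). tens (gen_prod u x z) (gen_prod u z y))"
    by (simp add: sum_words_Cons sum_product tens_mult x y)
  finally show ?case .
qed

text \<open>Left invariance in matrix form: applying (id tensor h) to the comultiplication of a
  product of generators turns U H into H.\<close>

lemma haar_invariance:
  assumes "x \<in> words n l" "y \<in> words n l"
  shows "(\<Sum>z\<in>words n l. h (gen_prod u z y) *\<^sub>C gen_prod u x z) = h (gen_prod u x y) *\<^sub>C 1"
proof -
  obtain L where L: "is_id_tensor tens h L" "\<And>a. L (\<Delta> a) = h a *\<^sub>C 1"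
    using haar unfolding is_haar_functional_def by blast
  have L_add: "L (a + b) = L a + L b" and L_scaleC: "L (c *\<^sub>C a) = c *\<^sub>C L a"
    and L_tens: "L (tens a' b') = h b' *\<^sub>C a'" for a b c a' b'
    using L(1) by (auto simp: is_id_tensor_def bounded_clinear_def clinear_def)
  have "L 0 = 0" using L_scaleC[of 0 0] by simp
  then have L_sum: "L (\<Sum>a\<in>A. f a) = (\<Sum>a\<in>A. L (f a))" for A :: "nat list set" and f
    by (induction A rule: infinite_finite_induct) (simp_all add: L_add)
  have "h (gen_prod u x y) *\<^sub>C 1 = L (\<Delta> (gen_prod u x y))" by (simp add: L(2))
  also have "\<dots> = (\<Sum>z\<in>words n l. h (gen_prod u z y) *\<^sub>C gen_prod u x z)"
    by (simp add: comult_gen_prod[OF assms] L_sum L_tens)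
  finally show ?thesis by simp
qed

text \<open>A cup inserted into \<open>\<xi>\<close> produces the sum of
  \<open>u a i * u a j\<close> over \<open>a\<close>, which collapses by orthogonality and removes
  two letters of \<open>y\<close>.\<close>

lemma TL_invariant:
  assumes "TL n l \<xi>" "y \<in> words n l"
  shows "(\<Sum>x\<in>words n l. \<xi> x *\<^sub>R gen_prod u x y) = \<xi> y *\<^sub>R 1"
  using assms
proof (induction arbitrary: y rule: TL.induct)
  case (add l \<xi> \<eta>)
  then show ?case by (simp add: scaleR_add_left sum.distrib)
next
  case (scale l \<xi> c)
  then have "c *\<^sub>R (\<Sum>x\<in>words n l. \<xi> x *\<^sub>R gen_prod u x y) = c *\<^sub>R (\<xi> y *\<^sub>R 1)" by simp
  then show ?case by (simp add: scaleR_sum_right)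
next
  case (cup l \<xi> t)
  have "length y = l + 2" using cup.prems by (simp add: words_def)
  then obtain v i j w where y: "y = v @ i # j # w" "length v = t"
    using cup.hyps(2) by (metis add_le_mono1 length_ge_append2)
  have mem: "v @ w \<in> words n l" "i \<in> {1..n}" "j \<in> {1..n}" using cup.prems y by (auto simp: words_def)
  have *: "(\<Sum>a=1..n. gen_prod u (take t x @ a # a # drop t x) y) = of_bool (i = j) * gen_prod u x (v @ w)"
    if "x \<in> words n l" for x
  proof -
    have len: "length (take t x) = length v" using that y cup.hyps(2) by (simp add: words_def)
    have "(\<Sum>a=1..n. gen_prod u (take t x @ a # a # drop t x) y) =
        gen_prod u (take t x) v * (\<Sum>a=1..n. u a i * u a j) * gen_prod u (drop t x) w"
      by (simp add: y(1) gen_prod_append[OF len] sum_distrib_left sum_distrib_right mult.assoc)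
    also have "\<dots> = of_bool (i = j) * gen_prod u (take t x @ drop t x) (v @ w)"
      unfolding rows_orthogonal[OF mem(2,3)] gen_prod_append[OF len] by simp
    finally show ?thesis by simp
  qed
  have "(\<Sum>x\<in>words n (Suc (Suc l)). cup n t \<xi> x *\<^sub>R gen_prod u x y) =
      (\<Sum>x\<in>words n l. \<xi> x *\<^sub>R (of_bool (i = j) * gen_prod u x (v @ w)))"
    unfolding sum_cup_scaleR[OF cup.hyps(2)] by (intro sum.cong refl) (simp only: *)
  also have "\<dots> = cup n t \<xi> y *\<^sub>R 1"
    using cup.IH[OF mem(1)] mem y by (simp add: cup_append)
  finally show ?case .
qed auto

text \<open>With \<open>H\<close> the matrix of Haar integrals of the products of \<open>l\<close> generators and \<open>U\<close> the matrix of these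
  products, \<open>proj U = proj\<close> gives \<open>proj H = proj\<close>. Applying the Weingarten state to \<open>U H = H\<close> gives
  \<open>proj H = H\<close>.\<close>

theorem haar_gen_prod:
  assumes "TL_projection n proj" and x: "x \<in> words n l" and y: "y \<in> words n l"
  shows "h (gen_prod u x y) = complex_of_real (proj x y)"
proof -
  interpret TL_projection n proj by (rule assms(1))
  have len: "length z = l" if "z \<in> words n l" for z using that by (simp add: words_def)
  let ?P = "\<lambda>z. h (gen_prod u z y)"
  have "(\<Sum>z\<in>words n l. proj x z *\<^sub>R gen_prod u z y) = proj x y *\<^sub>R 1"
    using TL_invariant[OF _ y, of "proj x"] proj_TL'[of x] len[OF x] by simp
  then have "h (\<Sum>z\<in>words n l. proj x z *\<^sub>R gen_prod u z y) = h (proj x y *\<^sub>R 1)" by simp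
  then have 1: "(\<Sum>z\<in>words n l. complex_of_real (proj x z) * ?P z) = complex_of_real (proj x y)"
    by (simp add: h_sum h_scaleR h_one)
  \<comment> \<open>The (x, y) entry of U H - H, lifted to the free star-algebra; the scalar entry
    of H becomes the coefficient of the empty word.\<close>
  define f where "f = (\<Sum>z\<in>words n l. mon (?P z) (gen_word x z)) + mon (- ?P x) 0"
  have "eval_free (\<lambda>(i, j). u i j) f =
      (\<Sum>z\<in>words n l. ?P z *\<^sub>C gen_prod u x z) + (- ?P x) *\<^sub>C 1"
    by (simp add: f_def eval_free_add eval_free_sum eval_free_mon word_val_gen_word)
  also have "\<dots> = (?P x + - ?P x) *\<^sub>C 1"
    unfolding haar_invariance[OF x y] scaleC_add_left ..
  finally have "eval_free (\<lambda>(i, j). u i j) f = 0" by simp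
  moreover have "f \<in> free_star_on ({1..n} \<times> {1..n})"
  proof -
    have sum: "(\<Sum>z\<in>A. g z) \<in> free_star_on X"
      if "finite A" "\<And>z. z \<in> A \<Longrightarrow> g z \<in> free_star_on X" for A X and g :: "nat list \<Rightarrow> (nat \<times> nat) free_star_algebra"
      using that
    proof (induction A rule: finite_induct)
      case empty
      then show ?case by (simp add: free_star_on_def zero_free_star_algebra.rep_eq)
    qed (simp add: free_star_on_add)
    have "mon c (gen_word x z) \<in> free_star_on ({1..n} \<times> {1..n})" if "z \<in> words n l" for c z
    proof (rule mon_in_free_star_on)
      have "fst ` set (letters (gen_word x z)) = set (zip x z)"
        by (simp add: gen_word_def image_image)
      then show "fst ` set (letters (gen_word x z)) \<subseteq> {1..n} \<times> {1..n}"
        using x that by (auto simp only: words_def mem_Collect_eq dest: set_zip_leftD set_zip_rightD)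
    qed
    moreover have "mon c 0 \<in> free_star_on ({1..n} \<times> {1..n})" for c
      by (intro mon_in_free_star_on) simp
    ultimately show ?thesis unfolding f_def by (intro free_star_on_add sum finite_words) auto
  qed
  ultimately have "state f = 0"
    using A_o state_eq_0_if_eval_free_eq_0 unfolding is_A_o_def by blast
  \<comment> \<open>The state replaces each product of generators by an entry of \<open>proj\<close>
    and the empty word by \<open>proj [] [] = 1\<close>.\<close>
  then have "(\<Sum>z\<in>words n l. ?P z * complex_of_real (proj x z)) = ?P x"
    using x by (simp add: f_def state_add state_sum state_mon row_word_gen_word col_word_gen_word len proj_Nil)
  with 1 show ?thesis by (simp add: mult.commute)
qed

end

lemma power_sum_diagonal:
  fixes u :: "nat \<Rightarrow> nat \<Rightarrow> 'a::ring_1"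
  shows "(\<Sum>i=1..s. u i i) ^ m = (\<Sum>x\<in>words s m. gen_prod u x x)"
  by (induction m) (simp_all add: sum_words_Cons sum_product)

theorem theorem5p1:
  fixes n s :: nat
    and u :: "nat \<Rightarrow> nat \<Rightarrow> 'a::cstar_algebra"
    and tens :: "'a \<Rightarrow> 'a \<Rightarrow> 't::cstar_algebra"
    and \<Delta> :: "'a \<Rightarrow> 't"
    and h :: "'a \<Rightarrow> complex"
  assumes "n \<ge> 2" and "1 \<le> s" and "s \<le> n"
    and "is_A_o n u"
    and "is_min_tensor tens"
    and "is_comultiplication n u tens \<Delta>"
    and "is_haar_functional tens \<Delta> h"
  shows "(\<forall>k\<ge>1. h ((\<Sum>i=1..s. u i i) ^ (2 * k)) =
            complex_of_real (trace_on (TL_diagrams k)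
              (mat_mult_on (TL_diagrams k) (mat_inv_on (TL_diagrams k) (gram k n)) (gram k s)))) \<and>
         (\<forall>k. h ((\<Sum>i=1..s. u i i) ^ (2 * k + 1)) = 0)"
proof -
  interpret A_o_haar n u tens \<Delta> h
    by unfold_locales (use assms in blast)+
  have power: "h ((\<Sum>i=1..s. u i i) ^ m) = complex_of_real (\<Sum>x\<in>words s m. TL_proj n x x)" for m
  proof -
    have "h (gen_prod u x x) = complex_of_real (TL_proj n x x)" if "x \<in> words s m" for x
    proof -
      have "x \<in> words n m" using that assms(3) by (fastforce simp: words_def)
      then show ?thesis by (intro haar_gen_prod[OF TL_projection_TL_proj[OF assms(1)]])
    qed
    then show ?thesis unfolding power_sum_diagonal h_sum by simp
  qed
  have "(\<Sum>x\<in>words s (2 * k). TL_proj n x x) =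
      trace_on (TL_diagrams k) (mat_mult_on (TL_diagrams k) (weingarten n k) (gram k s))" for k
  proof -
    let ?D = "TL_diagrams k" and ?v = "diagram_vector n k" and ?W = "weingarten n k"
    have "(\<Sum>x\<in>words s (2 * k). TL_proj n x x) =
        (\<Sum>x\<in>words s (2 * k). \<Sum>p\<in>?D. \<Sum>q\<in>?D. ?W p q * (?v q x * ?v p x))"
      by (intro sum.cong refl) (simp add: TL_proj_eq[of _ k] words_def mult_ac)
    \<comment> \<open>The Weingarten matrix still has loop value \<open>n\<close>; only the diagonal
      sum over words in \<open>{1..s}\<close> introduces \<open>s\<close>.\<close>
    also have "\<dots> = (\<Sum>p\<in>?D. \<Sum>q\<in>?D. ?W p q * gram k s q p)"
      by (subst sum_rotate3) (simp add: sum_diagram_vectors[OF _ _ assms(3), symmetric] sum_distrib_left)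
    finally show ?thesis by (simp add: trace_on_def mat_mult_on_def)
  qed
  moreover have "(\<Sum>x\<in>words s (2 * k + 1). TL_proj n x x) = 0" for k
    by (rule sum.neutral) (simp add: TL_proj_odd words_def)
  ultimately show ?thesis unfolding power weingarten_def by simp
qed

end
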